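(* Consider the regularized SGD recursion $X_{k+1}^S=(1-\lambda\eta)X_k^S-\eta\,\widehat g_S(X_k^S,U_k)$, $X_0^S\sim\mu_0$, with $\eta,\lambda>0$, $\lambda\eta<1$. Assume that $\ell(w,z)$ is $\Sigma^2$-subgaussian and that the Compatibility Assumption (stated in the context) is satisfied with $\pi:=\mathcal N(0,\sigma^2I_d)$ for some $\sigma>0$. Set $\mu_0=\pi$ and assume that there exist constants $a,b>0$ such that for all $S\in\mathcal Z^n$, all $t\ge0$ and all $x\in\mathbb R^d$, $\left\|\nabla\log u_t^S(x)+x/\sigma^2\right\|\le a\|x\|+b$, where $u_t^S$ is the Lebesgue density of $\rho_t^S$. Let $\zeta\in(0,1)$. Then, with probability at least $1-\zeta$ over $S\sim\mu_z^{\otimes n}$, for all $T>0$, $$\mathbb E\left[G_S(Y_T^S)\mid S\right]\le\frac{2\Sigma}{\sqrt n}\left\{\int_0^Te^{-\lambda\eta(T-t)}\,\mathrm N_S(t)\left(a\,\mathrm N_S(t)+a\,\mathrm M_S(t)+b\right)dt+\log\frac3\zeta\right\}^{1/2},$$ with $\mathrm N_S(t)^2:=\eta^2\,\mathbb E[\|\widehat g_S(Y_t^S,U)\|^2\mid S]+\sigma^2\lambda\eta d$ and $\mathrm M_S(t)^2:=2\,\mathbb E[\|Y_t^S\|^2\mid S]$, where $U\sim\mu_U$ is independent of $Y_t^S$.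
   Context: $\mathcal P(\mathbb R^d)$ is the set of Borel probability measures on $\mathbb R^d$; for a Markov kernel $K$, $\mu K(A)=\int K(x,A)\,d\mu(x)$. $(\mathcal Z,\mathcal F)$ is a measurable space with a probability measure $\mu_z$, $n\ge1$, $\ell:\mathbb R^d\times\mathcal Z\to\mathbb R_+$ is a loss. For $S=(z_1,\dots,z_n)\in\mathcal Z^n$: $\mathcal R(w)=\int\ell(w,z)\,d\mu_z(z)$, $\widehat{\mathcal R}_S(w)=\frac1n\sum_i\ell(w,z_i)$, $G_S=\mathcal R-\widehat{\mathcal R}_S$. The loss is $\Sigma^2$-subgaussian if for all $w\in\mathbb R^d$ and all $\lambda'\in\mathbb R$, $\mathbb E_{Z\sim\mu_z}[e^{\lambda'(\ell(w,Z)-\mathcal R(w))}]\le e^{\lambda'^2\Sigma^2/2}$. $\widehat g_S(x,u)$ is a stochastic gradient; $(U_k)$ (batch randomness) are i.i.d. with law $\mu_U$, independent of $S$ and of $X_0^S$. $P_S$ is the Markov kernel of $(X_k^S)$. $(N_t)_{t\ge0}$ is a Poisson process of intensity $1$ independent of all other random variables; $Y^S_t:=X^S_{N_t}$ and $\rho_t^S$ is the law of $Y_t^S$ given $S$; $v_t:=\frac{d\rho_t^S}{d\pi}$. Dual operator: if $K$ is a Markov kernel such that $\mu\ll\pi\Rightarrow\mu K\ll\pi$, then $K^\star:L^1(\pi)\to L^1(\pi)$ is defined on non-negative $f$ with $\int f\,d\pi=1$ by $K^\star f=\frac{d(\mu K)}{d\pi}$ with $d\mu=f\,d\pi$, and extended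 linearly. Compatibility Assumption: $\mathrm{KL}(\mu_0\|\pi)<+\infty$; $v_0=d\mu_0/d\pi$ is bounded away from $0$; for all $t\ge0$ the map $S\mapsto\mathrm{KL}(\rho_t^S\|\pi)$ is $\mathcal F^{\otimes n}$-measurable; and for all $S\in\mathcal Z^n$: (H.1) for all $\mu\in\mathcal P(\mathbb R^d)$, $\mu\ll\pi$ implies $\mu P_S\ll\pi$; (H.2) for all $t\ge0$, $\Phi(P_S^\star v_t)\in L^1(\pi)$, where $\Phi(x)=x\log x$, $\Phi(0)=0$. *)

theory Defs
  imports "HOL-Probability.Probability"
begin

text \<open>
  Conventions. The ambient space is a type of class \<open>euclidean_space\<close>, of dimension \<open>DIM('a)\<close>.
  A sample of size \<open>n\<close> is an element of the space of \<open>sample_space n \<mu>z\<close>. The sample is independent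
  of the remaining randomness, so conditioning on it amounts to freezing it: every conditional
  law or expectation given the sample is taken, for a fixed sample, on the probability space that
  carries the initial point, the batches and the clock.
\<close>

definition sample_space :: "nat \<Rightarrow> 'z measure \<Rightarrow> (nat \<Rightarrow> 'z) measure" where
  "sample_space n \<mu>z = Pi\<^sub>M {..<n} (\<lambda>_. \<mu>z)"

definition isotropic_gaussian :: "real \<Rightarrow> 'a::euclidean_space measure" where
  "isotropic_gaussian \<sigma> =
     density lborel (\<lambda>x. ennreal (\<Prod>i\<in>Basis. normal_density 0 \<sigma> (x \<bullet> i)))"


subsection \<open>Risks and subgaussian losses\<close>

definition risk :: "('a \<Rightarrow> 'z \<Rightarrow> real) \<Rightarrow> 'z measure \<Rightarrow> 'a \<Rightarrow> real" where
  "risk l \<mu>z w = (\<integral>z. l w z \<partial>\<mu>z)"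

definition empirical_risk :: "('a \<Rightarrow> 'z \<Rightarrow> real) \<Rightarrow> nat \<Rightarrow> (nat \<Rightarrow> 'z) \<Rightarrow> 'a \<Rightarrow> real" where
  "empirical_risk l n S w = (\<Sum>i<n. l w (S i)) / real n"

definition gen_gap :: "('a \<Rightarrow> 'z \<Rightarrow> real) \<Rightarrow> 'z measure \<Rightarrow> nat \<Rightarrow> (nat \<Rightarrow> 'z) \<Rightarrow> 'a \<Rightarrow> real" where
  "gen_gap l \<mu>z n S w = risk l \<mu>z w - empirical_risk l n S w"

text \<open>
  For a measurable non-negative loss, finiteness of the exponential moments forces \<open>l w\<close> to be
  integrable, so \<^const>\<open>risk\<close> is a genuine expectation here.
\<close>

definition subgaussian_loss :: "real \<Rightarrow> ('a \<Rightarrow> 'z \<Rightarrow> real) \<Rightarrow> 'z measure \<Rightarrow> bool" where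
  "subgaussian_loss Sig l \<mu>z \<longleftrightarrow>
     (\<forall>w r. (\<integral>\<^sup>+z. ennreal (exp (r * (l w z - risk l \<mu>z w))) \<partial>\<mu>z)
              \<le> ennreal (exp (r\<^sup>2 * Sig\<^sup>2 / 2)))"


subsection \<open>Relative entropy and dual operators\<close>

text \<open>
  \<^const>\<open>KL_divergence\<close> is a Bochner integral and hence \<open>0\<close> when that integral diverges. For
  probability measures the negative part of the integrand is always integrable, so a divergent
  integral means an infinite relative entropy.
\<close>

definition KL_ext :: "'a measure \<Rightarrow> 'a measure \<Rightarrow> ereal" where
  "KL_ext \<mu> \<nu> =
     (if absolutely_continuous \<nu> \<mu> \<and> integrable \<mu> (entropy_density (exp 1) \<nu> \<mu>)
      then ereal (KL_divergence (exp 1) \<nu> \<mu>) else \<infinity>)"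

definition real_RN_deriv :: "'a measure \<Rightarrow> 'a measure \<Rightarrow> 'a \<Rightarrow> real" where
  "real_RN_deriv \<nu> \<mu> x = enn2real (RN_deriv \<nu> \<mu> x)"

definition Phi :: "real \<Rightarrow> real" where
  "Phi x = (if x = 0 then 0 else x * ln x)"

text \<open>
  The action of a kernel \<open>K\<close> on a probability measure \<open>\<mu>\<close> is the Giry bind \<open>\<mu> \<bind> K\<close>.
  \<open>dual_density\<close> is the dual operator on probability densities, and \<open>dual_op\<close> its linear
  extension, obtained by normalising the positive and the negative part.
\<close>

definition dual_density ::
  "'a measure \<Rightarrow> ('a \<Rightarrow> 'a measure) \<Rightarrow> ('a \<Rightarrow> real) \<Rightarrow> 'a \<Rightarrow> real" where
  "dual_density \<nu> K f = real_RN_deriv \<nu> (density \<nu> (\<lambda>x. ennreal (f x)) \<bind> K)"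

definition dual_op ::
  "'a measure \<Rightarrow> ('a \<Rightarrow> 'a measure) \<Rightarrow> ('a \<Rightarrow> real) \<Rightarrow> 'a \<Rightarrow> real" where
  "dual_op \<nu> K f =
     (let p = (\<integral>x. max 0 (f x) \<partial>\<nu>); m = (\<integral>x. max 0 (- f x) \<partial>\<nu>)
      in (\<lambda>x. p * dual_density \<nu> K (\<lambda>y. max 0 (f y) / p) x
            - m * dual_density \<nu> K (\<lambda>y. max 0 (- f y) / m) x))"


subsection \<open>The recursion and its Poissonised version\<close>

text \<open>
  The counting paths are monotone, so the truncated subtraction on \<^typ>\<open>nat\<close> is the true increment.
  Independence along all infinite strictly increasing time sequences is the same as along all
  finite ones.
\<close>

definition poisson_process :: "'w measure \<Rightarrow> real \<Rightarrow> (real \<Rightarrow> 'w \<Rightarrow> nat) \<Rightarrow> bool" where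
  "poisson_process M r N \<longleftrightarrow>
     (\<forall>t\<ge>0. N t \<in> M \<rightarrow>\<^sub>M count_space UNIV) \<and>
     (AE \<omega> in M. N 0 \<omega> = 0) \<and>
     (AE \<omega> in M. mono_on {0..} (\<lambda>t. N t \<omega>) \<and> (\<forall>t\<ge>0. continuous (at_right t) (\<lambda>s. N s \<omega>))) \<and>
     (\<forall>s t. 0 \<le> s \<and> s < t \<longrightarrow>
        distr M (count_space UNIV) (\<lambda>\<omega>. N t \<omega> - N s \<omega>) = measure_pmf (poisson_pmf (r * (t - s)))) \<and>
     (\<forall>\<tau> :: nat \<Rightarrow> real. strict_mono \<tau> \<and> 0 \<le> \<tau> 0 \<longrightarrow>
        prob_space.indep_vars M (\<lambda>_. count_space UNIV)
          (\<lambda>i \<omega>. N (\<tau> (Suc i)) \<omega> - N (\<tau> i) \<omega>) UNIV)"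

datatype source = Init | Batch nat | Clock

definition source_events ::
  "'w measure \<Rightarrow> 'a::euclidean_space measure \<Rightarrow> 'u measure \<Rightarrow> ('w \<Rightarrow> 'a) \<Rightarrow> (nat \<Rightarrow> 'w \<Rightarrow> 'u)
     \<Rightarrow> (real \<Rightarrow> 'w \<Rightarrow> nat) \<Rightarrow> source \<Rightarrow> 'w set set" where
  "source_events M \<mu>0 \<mu>U X0 U N i =
     (case i of
        Init \<Rightarrow> sets (vimage_algebra (space M) X0 \<mu>0)
      | Batch k \<Rightarrow> sets (vimage_algebra (space M) (U k) \<mu>U)
      | Clock \<Rightarrow> sets (vimage_algebra (space M) (\<lambda>\<omega>. \<lambda>t\<in>{0..}. N t \<omega>)
                         (Pi\<^sub>M {0..} (\<lambda>_. count_space UNIV))))"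

text \<open>
  \<open>X0\<close> has law \<open>\<mu>0\<close>, the \<open>U k\<close> have law \<open>\<mu>U\<close>, \<open>N\<close> is a Poisson process of intensity 1, and all of
  these are mutually independent.
\<close>

definition sgd_randomness ::
  "'w measure \<Rightarrow> 'a::euclidean_space measure \<Rightarrow> 'u measure \<Rightarrow> ('w \<Rightarrow> 'a) \<Rightarrow> (nat \<Rightarrow> 'w \<Rightarrow> 'u)
     \<Rightarrow> (real \<Rightarrow> 'w \<Rightarrow> nat) \<Rightarrow> bool" where
  "sgd_randomness M \<mu>0 \<mu>U X0 U N \<longleftrightarrow>
     prob_space M \<and>
     X0 \<in> M \<rightarrow>\<^sub>M \<mu>0 \<and> distr M \<mu>0 X0 = \<mu>0 \<and>
     (\<forall>k. U k \<in> M \<rightarrow>\<^sub>M \<mu>U \<and> distr M \<mu>U (U k) = \<mu>U) \<and>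
     poisson_process M 1 N \<and>
     prob_space.indep_sets M (source_events M \<mu>0 \<mu>U X0 U N) UNIV"

definition sgd_step :: "real \<Rightarrow> real \<Rightarrow> ('a::euclidean_space \<Rightarrow> 'u \<Rightarrow> 'a) \<Rightarrow> 'a \<Rightarrow> 'u \<Rightarrow> 'a" where
  "sgd_step \<eta> lam g x u = (1 - lam * \<eta>) *\<^sub>R x - \<eta> *\<^sub>R g x u"

primrec sgd_iterate ::
  "real \<Rightarrow> real \<Rightarrow> ('a::euclidean_space \<Rightarrow> 'u \<Rightarrow> 'a) \<Rightarrow> ('w \<Rightarrow> 'a) \<Rightarrow> (nat \<Rightarrow> 'w \<Rightarrow> 'u)
     \<Rightarrow> nat \<Rightarrow> 'w \<Rightarrow> 'a" where
  "sgd_iterate \<eta> lam g X0 U 0 \<omega> = X0 \<omega>"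
| "sgd_iterate \<eta> lam g X0 U (Suc k) \<omega> =
     sgd_step \<eta> lam g (sgd_iterate \<eta> lam g X0 U k \<omega>) (U k \<omega>)"

definition sgd_kernel ::
  "real \<Rightarrow> real \<Rightarrow> ('a::euclidean_space \<Rightarrow> 'u \<Rightarrow> 'a) \<Rightarrow> 'u measure \<Rightarrow> 'a \<Rightarrow> 'a measure" where
  "sgd_kernel \<eta> lam g \<mu>U x = distr \<mu>U borel (sgd_step \<eta> lam g x)"

definition poissonized :: "(nat \<Rightarrow> 'w \<Rightarrow> 'a) \<Rightarrow> (real \<Rightarrow> 'w \<Rightarrow> nat) \<Rightarrow> real \<Rightarrow> 'w \<Rightarrow> 'a" where
  "poissonized X N t \<omega> = X (N t \<omega>) \<omega>"


subsection \<open>Compatibility assumption\<close>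

text \<open>
  \<open>P S\<close> is the kernel and \<open>\<rho> S t\<close> the law at time \<open>t\<close> attached to the sample \<open>S\<close>; \<open>\<nu>\<close> is the
  reference measure.
\<close>

definition compatible ::
  "nat \<Rightarrow> 'z measure \<Rightarrow> 'a::euclidean_space measure \<Rightarrow> 'a measure
     \<Rightarrow> ((nat \<Rightarrow> 'z) \<Rightarrow> 'a \<Rightarrow> 'a measure) \<Rightarrow> ((nat \<Rightarrow> 'z) \<Rightarrow> real \<Rightarrow> 'a measure) \<Rightarrow> bool" where
  "compatible n \<mu>z \<nu> \<mu>0 P \<rho> \<longleftrightarrow>
     KL_ext \<mu>0 \<nu> < \<infinity> \<and>
     (\<exists>c>0. AE x in \<nu>. c \<le> real_RN_deriv \<nu> \<mu>0 x) \<and>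
     (\<forall>t\<ge>0. (\<lambda>S. KL_ext (\<rho> S t) \<nu>) \<in> borel_measurable (sample_space n \<mu>z)) \<and>
     (\<forall>S\<in>space (sample_space n \<mu>z).
        (\<forall>\<mu>. prob_space \<mu> \<and> sets \<mu> = sets borel \<and> absolutely_continuous \<nu> \<mu> \<longrightarrow>
           absolutely_continuous \<nu> (\<mu> \<bind> P S)) \<and>
        (\<forall>t\<ge>0. integrable \<nu> (\<lambda>x. Phi (dual_op \<nu> (P S) (real_RN_deriv \<nu> (\<rho> S t)) x))))"


subsection \<open>The quantities in the bound\<close>

text \<open>
  The second moments below may be infinite, so the bound is computed in \<^typ>\<open>ennreal\<close>.
\<close>

definition ennreal_sqrt :: "ennreal \<Rightarrow> ennreal" where
  "ennreal_sqrt x = (if x = \<infinity> then \<infinity> else ennreal (sqrt (enn2real x)))"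

definition step_size ::
  "real \<Rightarrow> real \<Rightarrow> real \<Rightarrow> ('a::euclidean_space \<Rightarrow> 'u \<Rightarrow> 'a) \<Rightarrow> 'u measure \<Rightarrow> 'a measure \<Rightarrow> ennreal" where
  "step_size \<eta> lam \<sigma> g \<mu>U \<rho> =
     ennreal_sqrt (ennreal (\<eta>\<^sup>2) * (\<integral>\<^sup>+(x, u). ennreal ((norm (g x u))\<^sup>2) \<partial>(\<rho> \<Otimes>\<^sub>M \<mu>U))
                   + ennreal (\<sigma>\<^sup>2 * lam * \<eta> * real DIM('a)))"

definition moment_size :: "'a::euclidean_space measure \<Rightarrow> ennreal" where
  "moment_size \<rho> = ennreal_sqrt (2 * (\<integral>\<^sup>+x. ennreal ((norm x)\<^sup>2) \<partial>\<rho>))"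

definition entropy_bound ::
  "real \<Rightarrow> real \<Rightarrow> real \<Rightarrow> real \<Rightarrow> (real \<Rightarrow> ennreal) \<Rightarrow> (real \<Rightarrow> ennreal) \<Rightarrow> real \<Rightarrow> ennreal" where
  "entropy_bound \<eta> lam a b Nsz Msz T =
     (\<integral>\<^sup>+t\<in>{0..T}. ennreal (exp (- lam * \<eta> * (T - t)))
         * (Nsz t * (ennreal a * Nsz t + ennreal a * Msz t + ennreal b)) \<partial>lborel)"

end

theory Submission
  imports Defs
begin

text \<open>
  The sub-Gaussian loss makes \<open>exp (\<kappa> G\<^sub>S\<^sup>2)\<close> integrable under the sample and the prior \<open>\<pi>\<close> for
  \<open>\<kappa> = 3n / (8 \<Sigma>\<^sup>2)\<close>, so Markov's inequality and the Donsker--Varadhan formula bound \<open>G\<^sub>S\<close> under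
  all posteriors at once. The constant of the statement leaves room for a factor \<open>3/2\<close> in front of the
  entropy bound.

  For fixed \<open>S\<close>, put \<open>h = ln (d\<rho>\<^sub>T / d\<pi>)\<close>. Conditioning on the last jump before \<open>T\<close> expresses
  \<open>KL(\<rho>\<^sub>T | \<pi>) = \<integral> h d\<rho>\<^sub>T\<close> as an integral over \<open>t \<le> T\<close> of \<open>\<integral> P h d\<rho>\<^sub>t\<close>, with \<open>h\<close> fixed. Replace the
  SGD step by the Ornstein-Uhlenbeck step \<open>x \<mapsto> r x + s Z\<close>, \<open>r = 1 - \<lambda>\<eta>\<close>, which preserves \<open>\<pi>\<close>.
  The error is controlled by the growth of \<open>\<nabla>h\<close> and costs a factor \<open>\<surd>2 \<le> 3/2\<close>, because the noise has variance
  \<open>s\<^sup>2 \<sigma>\<^sup>2 \<le> 2 \<lambda>\<eta> \<sigma>\<^sup>2\<close>. By Donsker--Varadhan again, the Ornstein-Uhlenbeck step contracts relative entropy by \<open>r\<close>, and a Gronwall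
  argument gives the bound. No differentiability of the entropy in time is needed, and the contraction follows from the rotation
  invariance of \<open>\<pi> \<otimes> \<pi>\<close> alone.
\<close>


subsection \<open>Gaussian measures\<close>

text \<open>Relative entropy appears only as \<open>ent_le\<close>, a bound against bounded test
  functions \<open>f\<close> with \<open>\<integral> exp f dG \<le> 1\<close>. This form asks for no
  integrability of log-densities and is what the PAC-Bayesian step consumes. The optimal test
  function for a law with log-density \<open>h\<close> is \<open>h\<close> itself, so
  \<open>clamp_to n h\<close> is used: truncation preserves the modulus of continuity coming from
  the score assumption, and subtracting \<open>exp (- n)\<close> restores the normalization.

  The sharp contraction factor of the Ornstein-Uhlenbeck step is \<open>r\<^sup>2\<close>. Settling
  for \<open>r\<close> leaves a gap in which a factor obtained exactly by finitely many algebraic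
  operations can be placed, so no limit of operators is taken.

  The integral inequality for the entropy yields a bound only once the entropy is known to be
  finite. Finiteness comes from the quadratic growth of the log-density and a finite second moment,
  which a finite right-hand side guarantees at almost every time but not at
  \<open>T\<close>.\<close>

lemma nn_integral_lborel_affine:
  fixes t :: "'a::euclidean_space"
  assumes c: "c \<noteq> 0" and [measurable]: "f \<in> borel_measurable borel"
  shows "(\<integral>\<^sup>+x. f x \<partial>lborel) = ennreal (\<bar>c\<bar> ^ DIM('a)) * (\<integral>\<^sup>+x. f (t + c *\<^sub>R x) \<partial>lborel)"
proof -
  have "(\<integral>\<^sup>+x. f x \<partial>lborel)
      = (\<integral>\<^sup>+x. f x \<partial>density (distr lborel borel (\<lambda>x. t + c *\<^sub>R x)) (\<lambda>_. ennreal (\<bar>c\<bar> ^ DIM('a))))"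
    using lborel_affine[OF c, of t] by (simp add: ennreal_power)
  also have "\<dots> = ennreal (\<bar>c\<bar> ^ DIM('a)) * (\<integral>\<^sup>+x. f (t + c *\<^sub>R x) \<partial>lborel)"
    by (simp add: nn_integral_density nn_integral_distr nn_integral_cmult)
  finally show ?thesis .
qed

text \<open>The block matrix with rows \<open>(\<alpha>, \<beta>)\<close> and
  \<open>(\<beta>, - \<alpha>)\<close> is symmetric and orthogonal, hence its own inverse; this is
  why the same formula reappears when the variables are changed back.\<close>

lemma norm_sq_rotation:
  fixes x z :: "'a::real_inner"
  assumes "\<alpha>\<^sup>2 + \<beta>\<^sup>2 = (1::real)"
  shows "(norm (\<alpha> *\<^sub>R x + \<beta> *\<^sub>R z))\<^sup>2 + (norm (\<beta> *\<^sub>R x - \<alpha> *\<^sub>R z))\<^sup>2 = (norm x)\<^sup>2 + (norm z)\<^sup>2"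
proof -
  have "(norm (\<alpha> *\<^sub>R x + \<beta> *\<^sub>R z))\<^sup>2 + (norm (\<beta> *\<^sub>R x - \<alpha> *\<^sub>R z))\<^sup>2
      = (\<alpha>\<^sup>2 + \<beta>\<^sup>2) * ((norm x)\<^sup>2 + (norm z)\<^sup>2)"
    unfolding power2_norm_eq_inner
    by (simp add: inner_add_left inner_add_right inner_diff_left
        inner_diff_right inner_commute[of z x] power2_eq_square algebra_simps)
  with assms show ?thesis by simp
qed

locale gaussian =
  fixes \<sigma> :: real and G :: "'a::euclidean_space measure"
  assumes sigma_pos: "0 < \<sigma>" and G_eq: "G = isotropic_gaussian \<sigma>"
begin

definition dens :: "'a \<Rightarrow> real" where
  "dens x = (1 / sqrt (2 * pi * \<sigma>\<^sup>2)) ^ DIM('a) * exp (- (norm x)\<^sup>2 / (2 * \<sigma>\<^sup>2))"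

lemma dens_pos: "0 < dens x"
  using sigma_pos by (simp add: dens_def)

lemma dens_measurable [measurable]: "dens \<in> borel_measurable borel"
  unfolding dens_def by measurable

lemma dens_eq_prod: "(\<Prod>i\<in>Basis. normal_density 0 \<sigma> (x \<bullet> i)) = dens x"
proof -
  have "(norm x)\<^sup>2 = (\<Sum>i\<in>Basis. (x \<bullet> i)\<^sup>2)"
    unfolding power2_norm_eq_inner by (subst euclidean_inner) (simp add: power2_eq_square)
  then have "exp (- (norm x)\<^sup>2 / (2 * \<sigma>\<^sup>2)) = (\<Prod>i\<in>Basis. exp (- (x \<bullet> i)\<^sup>2 / (2 * \<sigma>\<^sup>2)))"
    by (subst exp_sum[symmetric]) (simp_all add: sum_negf sum_divide_distrib)
  then show ?thesis
    by (simp only: normal_density_def dens_def prod.distrib prod_constant diff_0_right)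
qed

lemma G_density: "G = density lborel (\<lambda>x. ennreal (dens x))"
  by (simp add: G_eq isotropic_gaussian_def dens_eq_prod)

lemma sets_G [measurable_cong, simp]: "sets G = sets borel"
  and space_G [simp]: "space G = UNIV"
  by (simp_all add: G_density)

lemma nn_integral_G:
  "f \<in> borel_measurable borel \<Longrightarrow> (\<integral>\<^sup>+x. f x \<partial>G) = (\<integral>\<^sup>+x. ennreal (dens x) * f x \<partial>lborel)"
  by (simp add: G_density nn_integral_density)

sublocale G: prob_space G
proof
  have "emeasure G (space G) = (\<integral>\<^sup>+(x::'a). (\<Prod>i\<in>Basis. ennreal (normal_density 0 \<sigma> (x \<bullet> i))) \<partial>lborel)"
    by (simp add: G_density emeasure_density dens_eq_prod[symmetric] prod_ennreal)
  also have "\<dots> = (\<Prod>i\<in>(Basis::'a set). (\<integral>\<^sup>+x. ennreal (normal_density 0 \<sigma> x) \<partial>lborel))"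
    by (subst nn_integral_lborel_prod) auto
  also have "\<dots> = 1"
    using sigma_pos by (simp add: nn_integral_eq_integral)
  finally show "emeasure G (space G) = 1" .
qed

lemma nn_integral_G_uminus:
  assumes [measurable]: "f \<in> borel_measurable borel"
  shows "(\<integral>\<^sup>+x. f (- x) \<partial>G) = (\<integral>\<^sup>+x. f x \<partial>G)"
  using nn_integral_lborel_affine[of "-1" "\<lambda>x. ennreal (dens x) * f x" "0::'a"]
  by (simp add: nn_integral_G) (simp add: dens_def)

lemma nn_integral_G_coord:
  assumes b: "b \<in> Basis"
  shows "(\<integral>\<^sup>+x. ennreal ((x \<bullet> b)\<^sup>2) \<partial>G) = ennreal (\<sigma>\<^sup>2)"
proof -
  have m: "(\<integral>\<^sup>+x. ennreal (normal_density 0 \<sigma> x) * ennreal (x\<^sup>2) \<partial>lborel) = ennreal (\<sigma>\<^sup>2)"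
  proof -
    have "has_bochner_integral lborel (\<lambda>x. normal_density 0 \<sigma> x * x\<^sup>2) (\<sigma>\<^sup>2)"
      using normal_moment_even[of \<sigma> 0 1] sigma_pos by (simp add: fact_2 power2_eq_square)
    then have "(\<integral>\<^sup>+x. ennreal (normal_density 0 \<sigma> x * x\<^sup>2) \<partial>lborel) = ennreal (\<sigma>\<^sup>2)"
      by (subst nn_integral_eq_integral) (auto simp: has_bochner_integral_iff)
    then show ?thesis by (simp add: ennreal_mult)
  qed
  have o: "(\<integral>\<^sup>+x. ennreal (normal_density 0 \<sigma> x) \<partial>lborel) = 1"
    using sigma_pos by (simp add: nn_integral_eq_integral)
  \<comment> \<open>Written as a product over all coordinates, with factor 1 away from
    \<open>b\<close>, the integrand splits into one-dimensional integrals.\<close>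
  have "(\<integral>\<^sup>+x. ennreal ((x \<bullet> b)\<^sup>2) \<partial>G)
      = (\<integral>\<^sup>+x. (\<Prod>i\<in>Basis. ennreal (normal_density 0 \<sigma> (x \<bullet> i)) *
           (if i = b then ennreal ((x \<bullet> i)\<^sup>2) else 1)) \<partial>lborel)"
    using b by (simp add: nn_integral_G prod.distrib prod_ennreal dens_eq_prod prod.delta)
  also have "\<dots> = (\<Prod>i\<in>(Basis::'a set). (\<integral>\<^sup>+x. ennreal (normal_density 0 \<sigma> x) *
           (if i = b then ennreal (x\<^sup>2) else 1) \<partial>lborel))"
    by (rule nn_integral_lborel_prod) auto
  also have "\<dots> = (\<Prod>i\<in>(Basis::'a set). if i = b then ennreal (\<sigma>\<^sup>2) else 1)"
    by (intro prod.cong refl) (simp add: m o)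
  also have "\<dots> = ennreal (\<sigma>\<^sup>2)" using b by (simp add: prod.delta)
  finally show ?thesis .
qed

lemma nn_integral_G_norm_sq:
  "(\<integral>\<^sup>+x. ennreal ((norm x)\<^sup>2) \<partial>G) = ennreal (real DIM('a) * \<sigma>\<^sup>2)"
proof -
  have "(\<integral>\<^sup>+x. ennreal ((norm x)\<^sup>2) \<partial>G) = (\<integral>\<^sup>+x. (\<Sum>b\<in>Basis. ennreal ((x \<bullet> b)\<^sup>2)) \<partial>G)"
    unfolding power2_norm_eq_inner by (subst euclidean_inner) (simp add: power2_eq_square sum_ennreal)
  also have "\<dots> = (\<Sum>b\<in>(Basis::'a set). ennreal (\<sigma>\<^sup>2))"
    by (subst nn_integral_sum) (auto simp: nn_integral_G_coord)
  finally show ?thesis by (simp add: ennreal_of_nat_eq_real_of_nat ennreal_mult)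
qed

text \<open>The product density depends only on the joint norm, so it suffices to change variables
  in Lebesgue measure. The orthogonal map is split into two affine substitutions of one variable
  each: \<open>p = \<alpha> x + \<beta> z\<close> at fixed \<open>x\<close>, then
  \<open>x = \<alpha> p + \<beta> q\<close> at fixed \<open>p\<close>. Their Jacobians cancel. For
  \<open>\<beta> = 0\<close> only sign changes remain.\<close>

lemma nn_integral_G_rotation:
  assumes ab: "\<alpha>\<^sup>2 + \<beta>\<^sup>2 = 1"
    and F [measurable]: "(\<lambda>(x, z). F x z) \<in> borel_measurable (borel \<Otimes>\<^sub>M borel)"
  shows "(\<integral>\<^sup>+x. \<integral>\<^sup>+z. F (\<alpha> *\<^sub>R x + \<beta> *\<^sub>R z) (\<beta> *\<^sub>R x - \<alpha> *\<^sub>R z) \<partial>G \<partial>G)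
       = (\<integral>\<^sup>+x. \<integral>\<^sup>+z. F x z \<partial>G \<partial>G)"
proof (cases "\<beta> = 0")
  case True
  then have a: "\<alpha> = 1 \<or> \<alpha> = -1" using ab by (simp add: power2_eq_1_iff)
  have "(\<integral>\<^sup>+x. \<integral>\<^sup>+z. F (\<alpha> *\<^sub>R x) (- \<alpha> *\<^sub>R z) \<partial>G \<partial>G) = (\<integral>\<^sup>+x. \<integral>\<^sup>+z. F x z \<partial>G \<partial>G)"
  proof -
    have 1: "(\<integral>\<^sup>+z. F x (- z) \<partial>G) = (\<integral>\<^sup>+z. F x z \<partial>G)" for x
      by (rule nn_integral_G_uminus) measurable
    have 2: "(\<integral>\<^sup>+x. \<integral>\<^sup>+z. F (- x) z \<partial>G \<partial>G) = (\<integral>\<^sup>+x. \<integral>\<^sup>+z. F x z \<partial>G \<partial>G)"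
      by (rule nn_integral_G_uminus[of "\<lambda>x. \<integral>\<^sup>+z. F x z \<partial>G"]) measurable
    show ?thesis using a 1 2 by auto
  qed
  with True show ?thesis by simp
next
  case False
  let ?d = "\<lambda>x. ennreal (dens x)"
  let ?c = "ennreal (\<bar>1 / \<beta>\<bar> ^ DIM('a))"
  have dens2: "dens (\<alpha> *\<^sub>R p + \<beta> *\<^sub>R q) * dens (\<beta> *\<^sub>R p - \<alpha> *\<^sub>R q) = dens p * dens q" for p q
    using norm_sq_rotation[OF ab, of p q]
    by (simp add: dens_def mult_exp_exp field_simps flip: add_divide_distrib)
  have dens3: "?d (\<alpha> *\<^sub>R p + \<beta> *\<^sub>R q) * (?d (\<beta> *\<^sub>R p - \<alpha> *\<^sub>R q) * X) = ?d p * (?d q * X)" for p q X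
    using dens2[of p q] by (simp add: mult.assoc[symmetric] ennreal_mult''[symmetric] less_imp_le[OF dens_pos])
  have "(\<integral>\<^sup>+x. \<integral>\<^sup>+z. F (\<alpha> *\<^sub>R x + \<beta> *\<^sub>R z) (\<beta> *\<^sub>R x - \<alpha> *\<^sub>R z) \<partial>G \<partial>G)
      = (\<integral>\<^sup>+x. \<integral>\<^sup>+z. ?d x * ?d z * F (\<alpha> *\<^sub>R x + \<beta> *\<^sub>R z) (\<beta> *\<^sub>R x - \<alpha> *\<^sub>R z) \<partial>lborel \<partial>lborel)"
    by (simp add: nn_integral_G nn_integral_cmult mult.assoc)
  also have "\<dots> = (\<integral>\<^sup>+x. ?c * (\<integral>\<^sup>+p. ?d x * ?d ((1 / \<beta>) *\<^sub>R (p - \<alpha> *\<^sub>R x)) *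
        F p ((1 / \<beta>) *\<^sub>R (x - \<alpha> *\<^sub>R p)) \<partial>lborel) \<partial>lborel)"
  proof (rule nn_integral_cong)
    fix x :: 'a
    have e1: "- (\<alpha> / \<beta>) *\<^sub>R x + (1 / \<beta>) *\<^sub>R p = (1 / \<beta>) *\<^sub>R (p - \<alpha> *\<^sub>R x)" for p
      by (simp add: algebra_simps)
    have e2: "\<alpha> *\<^sub>R x + \<beta> *\<^sub>R ((1 / \<beta>) *\<^sub>R (p - \<alpha> *\<^sub>R x)) = p" for p
      using False by simp
    have e3: "\<beta> *\<^sub>R x - \<alpha> *\<^sub>R ((1 / \<beta>) *\<^sub>R (p - \<alpha> *\<^sub>R x)) = (1 / \<beta>) *\<^sub>R (x - \<alpha> *\<^sub>R p)" for p
    proof -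
      have "\<beta> + \<alpha> * \<alpha> / \<beta> = 1 / \<beta>" using ab False by (simp add: field_simps power2_eq_square)
      then have "(\<beta> + \<alpha> * \<alpha> / \<beta>) *\<^sub>R x = (1 / \<beta>) *\<^sub>R x" by simp
      then show ?thesis by (simp add: algebra_simps)
    qed
    show "(\<integral>\<^sup>+z. ?d x * ?d z * F (\<alpha> *\<^sub>R x + \<beta> *\<^sub>R z) (\<beta> *\<^sub>R x - \<alpha> *\<^sub>R z) \<partial>lborel)
       = ?c * (\<integral>\<^sup>+p. ?d x * ?d ((1 / \<beta>) *\<^sub>R (p - \<alpha> *\<^sub>R x)) * F p ((1 / \<beta>) *\<^sub>R (x - \<alpha> *\<^sub>R p)) \<partial>lborel)"
      using False
      by (subst nn_integral_lborel_affine[of "1 / \<beta>" _ "- (\<alpha> / \<beta>) *\<^sub>R x"])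
        (auto simp: e1 e2 e3 simp del: scaleR_minus_left scaleR_scaleR)
  qed
  also have "\<dots> = (\<integral>\<^sup>+x. \<integral>\<^sup>+p. ?c * (?d x * ?d ((1 / \<beta>) *\<^sub>R (p - \<alpha> *\<^sub>R x)) *
        F p ((1 / \<beta>) *\<^sub>R (x - \<alpha> *\<^sub>R p))) \<partial>lborel \<partial>lborel)"
    by (simp add: nn_integral_cmult)
  also have "\<dots> = (\<integral>\<^sup>+p. \<integral>\<^sup>+x. ?c * (?d x * ?d ((1 / \<beta>) *\<^sub>R (p - \<alpha> *\<^sub>R x)) *
        F p ((1 / \<beta>) *\<^sub>R (x - \<alpha> *\<^sub>R p))) \<partial>lborel \<partial>lborel)"
    by (rule lborel_pair.Fubini') measurable
  also have "\<dots> = (\<integral>\<^sup>+p. \<integral>\<^sup>+q. ?d p * ?d q * F p q \<partial>lborel \<partial>lborel)"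
  proof (rule nn_integral_cong)
    fix p :: 'a
    have e1: "(1 / \<beta>) *\<^sub>R (p - \<alpha> *\<^sub>R (\<alpha> *\<^sub>R p + \<beta> *\<^sub>R q)) = \<beta> *\<^sub>R p - \<alpha> *\<^sub>R q" for q
    proof -
      have "(1 - \<alpha> * \<alpha>) / \<beta> = \<beta>" using ab False by (simp add: field_simps power2_eq_square)
      then have "((1 - \<alpha> * \<alpha>) / \<beta>) *\<^sub>R p = \<beta> *\<^sub>R p" by simp
      then show ?thesis using False by (simp add: algebra_simps diff_divide_distrib)
    qed
    have e2: "(1 / \<beta>) *\<^sub>R (\<alpha> *\<^sub>R p + \<beta> *\<^sub>R q - \<alpha> *\<^sub>R p) = q" for q
      using False by simp
    have e3: "ennreal (\<bar>\<beta>\<bar> ^ DIM('a)) * ?c = 1"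
      using False by (simp flip: ennreal_mult power_mult_distrib)
    have "(\<integral>\<^sup>+x. ?c * (?d x * ?d ((1 / \<beta>) *\<^sub>R (p - \<alpha> *\<^sub>R x)) *
        F p ((1 / \<beta>) *\<^sub>R (x - \<alpha> *\<^sub>R p))) \<partial>lborel)
       = ennreal (\<bar>\<beta>\<bar> ^ DIM('a)) * (\<integral>\<^sup>+q. ?c * (?d (\<alpha> *\<^sub>R p + \<beta> *\<^sub>R q) * ?d (\<beta> *\<^sub>R p - \<alpha> *\<^sub>R q) * F p q) \<partial>lborel)"
      using False by (subst nn_integral_lborel_affine[of "\<beta>" _ "\<alpha> *\<^sub>R p"])
        (simp_all only: e1 e2 if_True, measurable)
    also have "\<dots> = (ennreal (\<bar>\<beta>\<bar> ^ DIM('a)) * ?c) * (\<integral>\<^sup>+q. (?d p * ?d q * F p q) \<partial>lborel)"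
      by (simp add: nn_integral_cmult mult.assoc dens3 del: abs_divide)
    finally show "(\<integral>\<^sup>+x. ?c * (?d x * ?d ((1 / \<beta>) *\<^sub>R (p - \<alpha> *\<^sub>R x)) *
        F p ((1 / \<beta>) *\<^sub>R (x - \<alpha> *\<^sub>R p))) \<partial>lborel) = (\<integral>\<^sup>+q. ?d p * ?d q * F p q \<partial>lborel)"
      by (simp only: e3 mult_1)
  qed
  also have "\<dots> = (\<integral>\<^sup>+x. \<integral>\<^sup>+z. F x z \<partial>G \<partial>G)"
    by (simp add: nn_integral_G nn_integral_cmult mult.assoc)
  finally show ?thesis .
qed

end


subsection \<open>Contraction of the Ornstein-Uhlenbeck operator\<close>

definition bdd_borel :: "('b::topological_space \<Rightarrow> real) \<Rightarrow> bool" where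
  "bdd_borel f \<longleftrightarrow> f \<in> borel_measurable borel \<and> (\<exists>C. \<forall>x. \<bar>f x\<bar> \<le> C)"

lemma bdd_borelI: "f \<in> borel_measurable borel \<Longrightarrow> (\<And>x. \<bar>f x\<bar> \<le> C) \<Longrightarrow> bdd_borel f"
  by (auto simp: bdd_borel_def)

lemma bdd_borel_measurable: "bdd_borel f \<Longrightarrow> f \<in> borel_measurable borel"
  by (simp add: bdd_borel_def)

lemma bdd_borel_bound:
  assumes "bdd_borel f" obtains C where "0 \<le> C" "\<And>x. \<bar>f x\<bar> \<le> C"
  using assms unfolding bdd_borel_def by (meson abs_ge_zero order_trans)

lemma bdd_comp:
  "bdd_borel f \<Longrightarrow> h \<in> borel \<rightarrow>\<^sub>M borel \<Longrightarrow> bdd_borel (\<lambda>x. f (h x))"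
  unfolding bdd_borel_def by auto

lemma (in finite_measure) integrable_bdd:
  assumes "h \<in> borel_measurable M" "\<And>x. \<bar>h x\<bar> \<le> (C::real)"
  shows "integrable M h"
  using assms by (intro integrable_const_bound[of _ C]) auto

lemma (in prob_space) abs_integral_le:
  assumes "h \<in> borel_measurable M" "\<And>x. \<bar>h x\<bar> \<le> (C::real)"
  shows "\<bar>\<integral>x. h x \<partial>M\<bar> \<le> C"
proof -
  have "\<bar>\<integral>x. h x \<partial>M\<bar> \<le> (\<integral>x. \<bar>h x\<bar> \<partial>M)" by (rule integral_abs_bound)
  also have "\<dots> \<le> (\<integral>x. C \<partial>M)"
    using assms by (intro integral_mono integrable_abs integrable_bdd) auto
  finally show ?thesis by (simp add: prob_space)
qed

text \<open>Jensen's inequality, from the tangent of \<open>exp\<close> at the mean; the right-hand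
  side may be infinite.\<close>

lemma (in prob_space) exp_integral_le:
  assumes h: "integrable M h"
  shows "ennreal (exp (\<integral>x. h x \<partial>M)) \<le> (\<integral>\<^sup>+x. ennreal (exp (h x)) \<partial>M)"
proof (cases "(\<integral>\<^sup>+x. ennreal (exp (h x)) \<partial>M) = \<infinity>")
  case False
  let ?m = "\<integral>x. h x \<partial>M"
  have e: "integrable M (\<lambda>x. exp (h x))"
    using False h by (intro integrableI_nonneg) (auto simp: top.not_eq_extremum)
  have "exp ?m = (\<integral>x. exp ?m * (1 + (h x - ?m)) \<partial>M)"
    using h by (simp add: prob_space)
  also have "\<dots> \<le> (\<integral>x. exp (h x) \<partial>M)"
  proof (rule integral_mono)
    show "exp ?m * (1 + (h x - ?m)) \<le> exp (h x)" for x
      using mult_left_mono[OF exp_ge_add_one_self[of "h x - ?m"], of "exp ?m"] by (simp add: exp_diff)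
  qed (use h e in auto)
  finally show ?thesis
    using e by (subst nn_integral_eq_integral) auto
qed simp

lemma exp_convex_combination:
  assumes "0 \<le> (q::real)"
  shows "exp ((u + q * v) / (1 + q)) \<le> (exp u + q * exp v) / (1 + q)"
proof -
  define m where "m = (u + q * v) / (1 + q)"
  have m: "m * (1 + q) = u + q * v" using assms by (simp add: m_def)
  have t: "exp m * (1 + (z - m)) \<le> exp z" for z
    using mult_left_mono[OF exp_ge_add_one_self[of "z - m"], of "exp m"] by (simp add: exp_diff)
  have "exp m * (1 + (u - m)) + q * (exp m * (1 + (v - m))) \<le> exp u + q * exp v"
    using t assms by (intro add_mono mult_left_mono) auto
  moreover have "exp m * (1 + (u - m)) + q * (exp m * (1 + (v - m)))
      = exp m * ((1 + q) + (u + q * v) - m * (1 + q))"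
    by (simp add: algebra_simps)
  ultimately have "exp m * (1 + q) \<le> exp u + q * exp v" by (simp add: m)
  then show ?thesis using assms by (simp add: m_def[symmetric] pos_le_divide_eq)
qed

section \<open>Mehler's formula and entropy contraction in dual form\<close>

context gaussian
begin

sublocale GG: pair_prob_space G G ..

text \<open>The test class of the Donsker-Varadhan formula: relative entropy with respect to
  \<open>G\<close> is the supremum of \<open>\<integral> f d\<mu>\<close> over such
  \<open>f\<close>. Asking for \<open>\<le> 1\<close> rather than equality makes the class closed
  under decreasing \<open>f\<close>.\<close>

definition normalized :: "('a \<Rightarrow> real) \<Rightarrow> bool" where
  "normalized f \<longleftrightarrow> (\<integral>\<^sup>+x. ennreal (exp (f x)) \<partial>G) \<le> 1"

text \<open>Mehler's formula for the Ornstein-Uhlenbeck semigroup at time \<open>t\<close>, with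
  \<open>y = exp (- 2 * t)\<close>; in this parametrization composition becomes
  multiplication.\<close>

definition ou :: "real \<Rightarrow> ('a \<Rightarrow> real) \<Rightarrow> 'a \<Rightarrow> real" where
  "ou y f x = (\<integral>z. f (sqrt y *\<^sub>R x + sqrt (1 - y) *\<^sub>R z) \<partial>G)"

text \<open>Dual form of the statement that the operator with parameter \<open>y\<close> contracts the relative entropy
  with respect to \<open>G\<close> by the factor \<open>q\<close>.\<close>

definition contr :: "real \<Rightarrow> real \<Rightarrow> bool" where
  "contr y q \<longleftrightarrow> (\<forall>f. bdd_borel f \<longrightarrow> normalized f \<longrightarrow>
     (\<exists>V. bdd_borel V \<and> normalized V \<and> (\<forall>x. ou y f x \<le> q * V x)))"

lemma bdd_ou:
  assumes f: "bdd_borel f" shows "bdd_borel (ou y f)"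
proof -
  obtain C where C: "\<And>x. \<bar>f x\<bar> \<le> C" using f bdd_borel_bound by blast
  have [measurable]: "f \<in> borel_measurable borel" using f by (rule bdd_borel_measurable)
  show ?thesis
  proof (rule bdd_borelI)
    show "ou y f \<in> borel_measurable borel" unfolding ou_def by measurable
    show "\<bar>ou y f x\<bar> \<le> C" for x unfolding ou_def by (rule G.abs_integral_le) (auto simp: C)
  qed
qed

lemma integrable_G_bdd: "bdd_borel f \<Longrightarrow> integrable G f"
  by (metis G.integrable_bdd bdd_borel_def measurable_cong_sets sets_G)

text \<open>The first component of the rotation with coefficients \<open>\<alpha> / s\<close> and
  \<open>\<beta> / s\<close>, the second being integrated out.\<close>

lemma nn_integral_lin_comb:
  assumes s: "\<alpha>\<^sup>2 + \<beta>\<^sup>2 = s\<^sup>2" and F [measurable]: "F \<in> borel_measurable borel"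
  shows "(\<integral>\<^sup>+x. \<integral>\<^sup>+z. F (\<alpha> *\<^sub>R x + \<beta> *\<^sub>R z) \<partial>G \<partial>G) = (\<integral>\<^sup>+x. F (s *\<^sub>R x) \<partial>G)"
proof (cases "s = 0")
  case True
  then have "\<alpha> = 0" "\<beta> = 0" using s by (auto simp: sum_power2_eq_zero_iff)
  with True show ?thesis by (simp add: G.emeasure_space_1[simplified])
next
  case False
  have "(\<alpha> / s)\<^sup>2 + (\<beta> / s)\<^sup>2 = 1"
    using s False by (simp add: power_divide add_divide_distrib[symmetric])
  from nn_integral_G_rotation[OF this, of "\<lambda>x z. F (s *\<^sub>R x)"] False
  show ?thesis by (simp add: scaleR_add_right G.emeasure_space_1[simplified])
qed

text \<open>Stated for image measures, the identity carries over from non-negative integrands to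
  bounded signed ones.\<close>

lemma distr_lin_comb:
  assumes s: "\<alpha>\<^sup>2 + \<beta>\<^sup>2 = s\<^sup>2"
  shows "distr (G \<Otimes>\<^sub>M G) borel (\<lambda>(x, z). \<alpha> *\<^sub>R x + \<beta> *\<^sub>R z) = distr G borel (\<lambda>x. s *\<^sub>R x)"
proof (rule measure_eqI)
  fix A assume "A \<in> sets (distr (G \<Otimes>\<^sub>M G) borel (\<lambda>(x, z). \<alpha> *\<^sub>R x + \<beta> *\<^sub>R z))"
  then have [measurable]: "A \<in> sets borel" by simp
  have "emeasure (distr (G \<Otimes>\<^sub>M G) borel (\<lambda>(x, z). \<alpha> *\<^sub>R x + \<beta> *\<^sub>R z)) A
      = (\<integral>\<^sup>+p. indicator A p \<partial>distr (G \<Otimes>\<^sub>M G) borel (\<lambda>(x, z). \<alpha> *\<^sub>R x + \<beta> *\<^sub>R z))"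
    by (rule nn_integral_indicator[symmetric]) simp
  also have "\<dots> = (\<integral>\<^sup>+p. indicator A (case p of (x, z) \<Rightarrow> \<alpha> *\<^sub>R x + \<beta> *\<^sub>R z) \<partial>(G \<Otimes>\<^sub>M G))"
    by (rule nn_integral_distr) simp_all
  also have "\<dots> = (\<integral>\<^sup>+x. \<integral>\<^sup>+z. indicator A (\<alpha> *\<^sub>R x + \<beta> *\<^sub>R z) \<partial>G \<partial>G)"
    by (subst G.nn_integral_fst[symmetric]) simp_all
  also have "\<dots> = (\<integral>\<^sup>+x. indicator A (s *\<^sub>R x) \<partial>G)"
    by (rule nn_integral_lin_comb[OF s]) simp
  also have "\<dots> = (\<integral>\<^sup>+p. indicator A p \<partial>distr G borel (\<lambda>x. s *\<^sub>R x))"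
    by (rule nn_integral_distr[symmetric]) simp_all
  finally show "emeasure (distr (G \<Otimes>\<^sub>M G) borel (\<lambda>(x, z). \<alpha> *\<^sub>R x + \<beta> *\<^sub>R z)) A
      = emeasure (distr G borel (\<lambda>x. s *\<^sub>R x)) A" by simp
qed simp

lemma integral_lin_comb:
  assumes s: "\<alpha>\<^sup>2 + \<beta>\<^sup>2 = s\<^sup>2" and F: "bdd_borel F"
  shows "(\<integral>x. \<integral>z. F (\<alpha> *\<^sub>R x + \<beta> *\<^sub>R z) \<partial>G \<partial>G) = (\<integral>x. F (s *\<^sub>R x) \<partial>G)"
proof -
  have [measurable]: "F \<in> borel_measurable borel" using F by (rule bdd_borel_measurable)
  obtain C where C: "\<And>x. \<bar>F x\<bar> \<le> C" using F bdd_borel_bound by blast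
  have "(\<integral>x. \<integral>z. F (\<alpha> *\<^sub>R x + \<beta> *\<^sub>R z) \<partial>G \<partial>G)
      = (\<integral>p. F (case p of (x, z) \<Rightarrow> \<alpha> *\<^sub>R x + \<beta> *\<^sub>R z) \<partial>(G \<Otimes>\<^sub>M G))"
    by (subst GG.integral_fst'[symmetric]) (auto intro!: GG.P.integrable_bdd[of _ C] simp: C)
  also have "\<dots> = (\<integral>p. F p \<partial>distr (G \<Otimes>\<^sub>M G) borel (\<lambda>(x, z). \<alpha> *\<^sub>R x + \<beta> *\<^sub>R z))"
    by (subst integral_distr) auto
  also have "\<dots> = (\<integral>x. F (s *\<^sub>R x) \<partial>G)"
    by (simp add: distr_lin_comb[OF s] integral_distr)
  finally show ?thesis .
qed

lemma ou_ou:
  assumes x: "0 \<le> x" "x \<le> 1" and y: "0 \<le> y" "y \<le> 1" and f: "bdd_borel f"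
  shows "ou x (ou y f) p = ou (x * y) f p"
proof -
  have [measurable]: "f \<in> borel_measurable borel" using f by (rule bdd_borel_measurable)
  obtain C where C: "\<And>x. \<bar>f x\<bar> \<le> C" using f bdd_borel_bound by blast
  have xy: "x * y \<le> 1" using x y by (simp add: mult_le_one)
  \<comment> \<open>The inner noise is damped by \<open>sqrt y\<close>: the variances
    \<open>y * (1 - x)\<close> and \<open>1 - y\<close> add up to \<open>1 - x * y\<close>.\<close>
  have s: "(sqrt y * sqrt (1 - x))\<^sup>2 + (sqrt (1 - y))\<^sup>2 = (sqrt (1 - x * y))\<^sup>2"
    using x y xy by (simp add: power_mult_distrib algebra_simps)
  have "ou x (ou y f) p
      = (\<integral>z. \<integral>z'. f (sqrt (x * y) *\<^sub>R p + ((sqrt y * sqrt (1 - x)) *\<^sub>R z + sqrt (1 - y) *\<^sub>R z')) \<partial>G \<partial>G)"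
    by (simp add: ou_def real_sqrt_mult algebra_simps)
  also have "\<dots> = (\<integral>z. f (sqrt (x * y) *\<^sub>R p + sqrt (1 - x * y) *\<^sub>R z) \<partial>G)"
    by (rule integral_lin_comb[OF s, of "\<lambda>v. f (sqrt (x * y) *\<^sub>R p + v)"]) (rule bdd_comp[OF f], measurable)
  finally show ?thesis by (simp add: ou_def)
qed

lemma ou_mono:
  assumes "bdd_borel f" "bdd_borel g" "\<And>x. f x \<le> g x"
  shows "ou y f x \<le> ou y g x"
  unfolding ou_def using assms
  by (intro integral_mono integrable_G_bdd[OF bdd_comp]) auto

lemma ou_cmult: "ou y (\<lambda>x. c * f x) x = c * ou y f x"
  by (simp add: ou_def)

lemma bdd_cmult: "bdd_borel f \<Longrightarrow> bdd_borel (\<lambda>x. c * f x)"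
  unfolding bdd_borel_def by (auto simp: abs_mult intro!: exI[of _ "\<bar>c\<bar> * C" for C] mult_left_mono)

lemma contr_mult:
  assumes x: "0 \<le> x" "x \<le> 1" and y: "0 \<le> y" "y \<le> 1" and q: "0 \<le> q"
    and cx: "contr x p" and cy: "contr y q"
  shows "contr (x * y) (q * p)"
  unfolding contr_def
proof (intro allI impI)
  fix f assume f: "bdd_borel f" "normalized f"
  obtain V where V: "bdd_borel V" "normalized V" "\<And>z. ou y f z \<le> q * V z"
    using cy f unfolding contr_def by blast
  obtain W where W: "bdd_borel W" "normalized W" "\<And>z. ou x V z \<le> p * W z"
    using cx V unfolding contr_def by blast
  have "ou (x * y) f z \<le> q * p * W z" for z
  proof -
    have "ou (x * y) f z = ou x (ou y f) z" using x y f by (simp add: ou_ou)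
    also have "\<dots> \<le> ou x (\<lambda>z. q * V z) z"
      using V f by (intro ou_mono bdd_ou bdd_cmult) auto
    also have "\<dots> \<le> q * (p * W z)" using W(3)[of z] q by (simp add: ou_cmult mult_left_mono)
    finally show ?thesis by simp
  qed
  then show "\<exists>V. bdd_borel V \<and> normalized V \<and> (\<forall>z. ou (x * y) f z \<le> q * p * V z)"
    using W by blast
qed

lemma integral_normalized_le_0:
  assumes "integrable G f" "normalized f"
  shows "(\<integral>x. f x \<partial>G) \<le> 0"
  using G.exp_integral_le[OF assms(1)] assms(2) unfolding normalized_def
  by (metis order_trans ennreal_le_1 exp_le_one_iff)

text \<open>At \<open>y = 0\<close> the operator returns the constant
  \<open>\<integral> f dG\<close>, which is at most 0 by Jensen. This seeds the family of
  contraction factors.\<close>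

lemma contr_0: "contr 0 0"
  unfolding contr_def
proof (intro allI impI)
  fix f assume "bdd_borel f" "normalized f"
  then have "ou 0 f x \<le> 0 * 0" for x
    using integral_normalized_le_0[OF integrable_G_bdd] by (simp add: ou_def)
  then show "\<exists>V. bdd_borel V \<and> normalized V \<and> (\<forall>x. ou 0 f x \<le> 0 * V x)"
    by (intro exI[of _ "\<lambda>_. 0"]) (auto simp: bdd_borel_def normalized_def G.emeasure_space_1[simplified])
qed

text \<open>By Jensen and the invariance of \<open>G\<close>, \<open>ou y f\<close> is itself
  normalized: entropy never increases.\<close>

lemma contr_1:
  assumes y: "0 \<le> y" "y \<le> 1" shows "contr y 1"
  unfolding contr_def
proof (intro allI impI)
  fix f assume f: "bdd_borel f" "normalized f"
  have [measurable]: "f \<in> borel_measurable borel" using f by (simp add: bdd_borel_measurable)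
  obtain C where C: "\<And>x. \<bar>f x\<bar> \<le> C" using f bdd_borel_bound by blast
  have "(\<integral>\<^sup>+x. ennreal (exp (ou y f x)) \<partial>G)
      \<le> (\<integral>\<^sup>+x. \<integral>\<^sup>+z. ennreal (exp (f (sqrt y *\<^sub>R x + sqrt (1 - y) *\<^sub>R z))) \<partial>G \<partial>G)"
    unfolding ou_def
    by (intro nn_integral_mono G.exp_integral_le G.integrable_bdd[of _ C]) (auto simp: C)
  also have "\<dots> = (\<integral>\<^sup>+x. ennreal (exp (f (1 *\<^sub>R x))) \<partial>G)"
    using y by (intro nn_integral_lin_comb) auto
  finally have "normalized (ou y f)" using f by (simp add: normalized_def)
  then show "\<exists>V. bdd_borel V \<and> normalized V \<and> (\<forall>x. ou y f x \<le> 1 * V x)"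
    using bdd_ou f by auto
qed


text \<open>Rotate \<open>(X, Z, Z')\<close> to \<open>(B, A, C)\<close> with \<open>B = \<surd>y X + \<surd>(1 - y) Z\<close> such that, given \<open>X\<close>, both
  \<open>D = \<kappa> B + \<tau> A\<close> and \<open>D' = \<kappa> B + \<tau> C\<close> have the law of the step with parameter \<open>w = (1 + y) / 2\<close>. Under
  independent \<open>B, A, C\<close>, \<open>D\<close> and \<open>D'\<close> are conditionally independent given \<open>B\<close>, so subtracting
  \<open>g B = ln E[exp (f D) | B]\<close> once from \<open>f D + f D'\<close> keeps the exponential normalized.\<close>

lemma contr_half_step:
  assumes y: "0 \<le> y" "y \<le> 1" and q: "0 \<le> q" and cy: "contr y q"
  shows "contr ((1 + y) / 2) ((1 + q) / 2)"
  unfolding contr_def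
proof (intro allI impI)
  fix f assume f: "bdd_borel f" "normalized f"
  have [measurable]: "f \<in> borel_measurable borel" using f by (simp add: bdd_borel_measurable)
  obtain C where C: "\<And>x. \<bar>f x\<bar> \<le> C" using f bdd_borel_bound by blast
  \<comment> \<open>The pair \<open>(\<kappa>, \<tau>)\<close> is
    \<open>(sqrt y, sqrt ((1 - y) / 2))\<close> divided by its length \<open>sqrt w\<close>. These
    are the coefficients of \<open>X\<close> in \<open>B\<close> and in \<open>A\<close>, so
    \<open>D\<close> is the unit combination of \<open>B\<close> and \<open>A\<close> most
    correlated with \<open>X\<close>, and \<open>sqrt w\<close> is that correlation.\<close>
  define w where "w = (1 + y) / 2"
  define \<kappa> where "\<kappa> = sqrt y / sqrt w"
  define \<tau> where "\<tau> = sqrt (1 - y) / (sqrt 2 * sqrt w)"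
  have w: "0 < w" "w \<le> 1" using y by (auto simp: w_def)
  have kt: "\<kappa>\<^sup>2 + \<tau>\<^sup>2 = 1"
  proof -
    have "\<kappa>\<^sup>2 + \<tau>\<^sup>2 = y / w + (1 - y) / (2 * w)"
      using y w by (simp add: \<kappa>_def \<tau>_def power_divide power_mult_distrib)
    also have "\<dots> = 1" using y w(1) by (simp add: divide_simps) (simp add: w_def)
    finally show ?thesis .
  qed
  define \<phi> where "\<phi> b a = f (\<kappa> *\<^sub>R b + \<tau> *\<^sub>R a)" for a b
  have \<phi>_measurable [measurable]: "(\<lambda>(b, a). \<phi> b a) \<in> borel_measurable (borel \<Otimes>\<^sub>M borel)"
    unfolding \<phi>_def by measurable
  have \<phi>_le: "\<bar>\<phi> b a\<bar> \<le> C" for a b by (simp add: \<phi>_def C)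
  have int_exp: "integrable G (\<lambda>a. exp (\<phi> b a))" for b
    using \<phi>_le by (intro G.integrable_bdd[of _ "exp C"]) (auto simp: abs_le_iff)
  define g where "g b = ln (\<integral>a. exp (\<phi> b a) \<partial>G)" for b
  have g_bounds: "exp (- C) \<le> (\<integral>a. exp (\<phi> b a) \<partial>G)" "(\<integral>a. exp (\<phi> b a) \<partial>G) \<le> exp C" for b
  proof -
    have "(\<integral>a. exp (- C) \<partial>G) \<le> (\<integral>a. exp (\<phi> b a) \<partial>G)"
      using \<phi>_le[of b] int_exp by (intro integral_mono) (auto simp: abs_le_iff minus_le_iff)
    then show "exp (- C) \<le> (\<integral>a. exp (\<phi> b a) \<partial>G)" by (simp add: G.prob_space[simplified])
    have "(\<integral>a. exp (\<phi> b a) \<partial>G) \<le> (\<integral>a. exp C \<partial>G)"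
      using \<phi>_le[of b] int_exp by (intro integral_mono) (auto simp: abs_le_iff)
    then show "(\<integral>a. exp (\<phi> b a) \<partial>G) \<le> exp C" by (simp add: G.prob_space[simplified])
  qed
  have pos: "0 < (\<integral>a. exp (\<phi> b a) \<partial>G)" for b
    using g_bounds(1)[of b] exp_gt_zero[of "- C"] by linarith
  have exp_g: "ennreal (exp (g b)) = (\<integral>\<^sup>+a. ennreal (exp (\<phi> b a)) \<partial>G)" for b
    using pos[of b] int_exp[of b] by (simp add: g_def nn_integral_eq_integral)
  have g_le: "\<bar>g b\<bar> \<le> C" for b
  proof -
    have "ln (exp (- C)) \<le> g b" "g b \<le> ln (exp C)"
      unfolding g_def using g_bounds[of b] pos[of b] by (subst ln_le_cancel_iff; simp)+
    then show ?thesis by simp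
  qed
  have g_measurable [measurable]: "g \<in> borel_measurable borel"
    unfolding g_def by measurable
  have bdd_g: "bdd_borel g" using g_le by (intro bdd_borelI) auto
  have "normalized g"
  proof -
    have "(\<integral>\<^sup>+b. ennreal (exp (g b)) \<partial>G) = (\<integral>\<^sup>+b. \<integral>\<^sup>+a. ennreal (exp (f (\<kappa> *\<^sub>R b + \<tau> *\<^sub>R a))) \<partial>G \<partial>G)"
      by (simp add: exp_g \<phi>_def)
    also have "\<dots> = (\<integral>\<^sup>+b. ennreal (exp (f (1 *\<^sub>R b))) \<partial>G)"
      using kt by (intro nn_integral_lin_comb) auto
    finally show ?thesis using f by (simp add: normalized_def)
  qed
  then obtain V where V: "bdd_borel V" "normalized V" "\<And>z. ou y g z \<le> q * V z"
    using cy bdd_g unfolding contr_def by blast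
  \<comment> \<open>\<open>U X\<close> is the conditional mean of \<open>f D + f D' - g B\<close>
    given \<open>X\<close>. Once it is normalized,
    \<open>2 * ou w f = U + ou y g \<le> U + q * V\<close> leads to the claim.\<close>
  define U where "U x = 2 * ou w f x - ou y g x" for x
  obtain C1 C2 where C1: "\<And>x. \<bar>ou w f x\<bar> \<le> C1" and C2: "\<And>x. \<bar>ou y g x\<bar> \<le> C2"
    using bdd_ou[OF f(1), of w] bdd_ou[OF bdd_g, of y] bdd_borel_bound by metis
  have [measurable]: "ou w f \<in> borel_measurable borel" "ou y g \<in> borel_measurable borel"
    "V \<in> borel_measurable borel"
    using bdd_ou[OF f(1), of w] bdd_ou[OF bdd_g, of y] V(1) by (auto dest: bdd_borel_measurable)
  have U_measurable [measurable]: "U \<in> borel_measurable borel" unfolding U_def by measurable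
  define B where "B x z = sqrt y *\<^sub>R x + sqrt (1 - y) *\<^sub>R z" for x z :: 'a
  define E where "E x z = sqrt (1 - y) *\<^sub>R x - sqrt y *\<^sub>R z" for x z :: 'a
  define \<theta> :: real where "\<theta> = 1 / sqrt 2"
  have \<theta>: "\<theta>\<^sup>2 + \<theta>\<^sup>2 = 1" by (simp add: \<theta>_def power_divide)
  define H where "H b a c = \<phi> b a + \<phi> b c - g b" for a b c
  have H_le: "\<bar>H b a c\<bar> \<le> 3 * C" for a b c
    using \<phi>_le[of b a] \<phi>_le[of b c] g_le[of b] by (simp add: H_def)
  have BE_measurable [measurable]: "(\<lambda>(x, z). B x z) \<in> borel \<Otimes>\<^sub>M borel \<rightarrow>\<^sub>M borel"
    "(\<lambda>(x, z). E x z) \<in> borel \<Otimes>\<^sub>M borel \<rightarrow>\<^sub>M borel"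
    unfolding B_def E_def by measurable
  define \<Theta> where "\<Theta> x z z' = H (B x z) (\<theta> *\<^sub>R E x z + \<theta> *\<^sub>R z') (\<theta> *\<^sub>R E x z - \<theta> *\<^sub>R z')" for x z z'
  have \<Theta>_le: "\<bar>\<Theta> x z z'\<bar> \<le> 3 * C" for x z z' by (simp add: \<Theta>_def H_le)
  have \<Theta>_measurable [measurable]: "(\<lambda>(x, z, z'). \<Theta> x z z') \<in> borel_measurable (borel \<Otimes>\<^sub>M borel \<Otimes>\<^sub>M borel)"
    unfolding \<Theta>_def H_def B_def E_def by measurable
  have mean_\<phi>: "(\<integral>z. \<integral>z'. \<phi> (B x z) (\<theta> *\<^sub>R E x z + \<epsilon> *\<^sub>R z') \<partial>G \<partial>G) = ou w f x"
    if e: "\<epsilon>\<^sup>2 = 1 / 2" for x and \<epsilon> :: real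
  proof -
    \<comment> \<open>The coefficient of \<open>Z\<close> in
      \<open>\<kappa> B + \<tau> (\<theta> E + \<epsilon> Z')\<close>. The sign of
      \<open>\<epsilon>\<close> separates \<open>D\<close> from \<open>D'\<close> and does not
      affect the law.\<close>
    let ?\<alpha> = "\<kappa> * sqrt (1 - y) - \<tau> * \<theta> * sqrt y"
    have c1: "\<kappa> * sqrt y + \<tau> * \<theta> * sqrt (1 - y) = sqrt w"
    proof -
      have "\<kappa> * sqrt y + \<tau> * \<theta> * sqrt (1 - y) = (y + (1 - y) / 2) / sqrt w"
        using y by (simp add: \<kappa>_def \<tau>_def \<theta>_def add_divide_distrib)
      also have "\<dots> = w / sqrt w" by (simp add: w_def field_simps)
      finally show ?thesis using w by (simp add: real_div_sqrt)
    qed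
    have c2: "?\<alpha>\<^sup>2 + (\<tau> * \<epsilon>)\<^sup>2 = (sqrt (1 - w))\<^sup>2"
    proof -
      have "?\<alpha> = sqrt y * sqrt (1 - y) / (2 * sqrt w)"
        by (simp add: \<kappa>_def \<tau>_def \<theta>_def field_simps)
      then have "?\<alpha>\<^sup>2 = y * (1 - y) / (4 * w)"
        using y w by (simp add: power_divide power_mult_distrib)
      moreover have "(\<tau> * \<epsilon>)\<^sup>2 = (1 - y) / (4 * w)"
        using y w by (simp add: \<tau>_def power_divide power_mult_distrib e)
      ultimately have "?\<alpha>\<^sup>2 + (\<tau> * \<epsilon>)\<^sup>2 = (y * (1 - y) + (1 - y)) / (4 * w)"
        by (simp only: add_divide_distrib)
      also have "\<dots> = (1 - y) * (1 + y) / (4 * w)"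
        by (simp add: algebra_simps)
      also have "\<dots> = 1 - w" using y w by (simp add: w_def field_simps)
      finally show ?thesis using w by simp
    qed
    have "(\<integral>z. \<integral>z'. \<phi> (B x z) (\<theta> *\<^sub>R E x z + \<epsilon> *\<^sub>R z') \<partial>G \<partial>G)
        = (\<integral>z. \<integral>z'. f (sqrt w *\<^sub>R x + (?\<alpha> *\<^sub>R z + (\<tau> * \<epsilon>) *\<^sub>R z')) \<partial>G \<partial>G)"
      unfolding c1[symmetric] \<phi>_def B_def E_def by (simp add: algebra_simps)
    also have "\<dots> = (\<integral>z. f (sqrt w *\<^sub>R x + sqrt (1 - w) *\<^sub>R z) \<partial>G)"
      by (rule integral_lin_comb[OF c2, of "\<lambda>v. f (sqrt w *\<^sub>R x + v)"]) (rule bdd_comp[OF f(1)], measurable)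
    finally show ?thesis by (simp add: ou_def)
  qed
  have U_eq: "U x = (\<integral>z. \<integral>z'. \<Theta> x z z' \<partial>G \<partial>G)" for x
  proof -
    let ?A = "\<lambda>\<epsilon> z z'. \<phi> (B x z) (\<theta> *\<^sub>R E x z + \<epsilon> *\<^sub>R z')"
    have i1: "integrable G (?A \<epsilon> z)" for \<epsilon> z
      by (intro G.integrable_bdd[of _ C] \<phi>_le) simp
    have i2: "integrable G (\<lambda>z. \<integral>z'. ?A \<epsilon> z z' \<partial>G)" for \<epsilon>
      by (intro G.integrable_bdd[of _ C] G.abs_integral_le \<phi>_le) simp_all
    have i3: "integrable G (\<lambda>z. g (B x z))"
      by (intro G.integrable_bdd[of _ C] g_le) simp
    have "\<Theta> x z z' = ?A \<theta> z z' + ?A (- \<theta>) z z' - g (B x z)" for z z'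
      by (simp add: \<Theta>_def H_def)
    then have "(\<integral>z. \<integral>z'. \<Theta> x z z' \<partial>G \<partial>G)
        = (\<integral>z. (\<integral>z'. ?A \<theta> z z' \<partial>G) + (\<integral>z'. ?A (- \<theta>) z z' \<partial>G) - g (B x z) \<partial>G)"
      using i1 by (simp add: G.prob_space[simplified] del: scaleR_minus_left)
    also have "\<dots> = ou w f x + ou w f x - ou y g x"
      using i2 i3 \<theta> mean_\<phi>[of \<theta>] mean_\<phi>[of "- \<theta>"]
      by (simp add: ou_def[of y] B_def del: scaleR_minus_left)
    finally show ?thesis by (simp add: U_def)
  qed
  have mH: "(\<lambda>(b, e). \<integral>\<^sup>+z'. ennreal (exp (H b (\<theta> *\<^sub>R e + \<theta> *\<^sub>R z') (\<theta> *\<^sub>R e - \<theta> *\<^sub>R z'))) \<partial>G)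
      \<in> borel_measurable (borel \<Otimes>\<^sub>M borel)"
    unfolding H_def by measurable
  have nU: "normalized U"
  proof -
    \<comment> \<open>Jensen over \<open>z\<close> and over \<open>z'\<close> moves
      \<open>exp\<close> inside. A rotation of \<open>(x, z)\<close> and then one of the last two
      variables turn the integral into one over an independent triple
      \<open>(b, a, c)\<close>.\<close>
    have "(\<integral>\<^sup>+x. ennreal (exp (U x)) \<partial>G) \<le> (\<integral>\<^sup>+x. \<integral>\<^sup>+z. \<integral>\<^sup>+z'. ennreal (exp (\<Theta> x z z')) \<partial>G \<partial>G \<partial>G)"
    proof (rule nn_integral_mono)
      fix x
      have "ennreal (exp (U x)) \<le> (\<integral>\<^sup>+z. ennreal (exp (\<integral>z'. \<Theta> x z z' \<partial>G)) \<partial>G)"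
        unfolding U_eq
        by (intro G.exp_integral_le G.integrable_bdd[of _ "3 * C"] G.abs_integral_le \<Theta>_le) simp_all
      also have "\<dots> \<le> (\<integral>\<^sup>+z. \<integral>\<^sup>+z'. ennreal (exp (\<Theta> x z z')) \<partial>G \<partial>G)"
        by (intro nn_integral_mono G.exp_integral_le G.integrable_bdd[of _ "3 * C"] \<Theta>_le) simp
      finally show "ennreal (exp (U x)) \<le> (\<integral>\<^sup>+z. \<integral>\<^sup>+z'. ennreal (exp (\<Theta> x z z')) \<partial>G \<partial>G)" .
    qed
    also have "\<dots> = (\<integral>\<^sup>+b. \<integral>\<^sup>+e. \<integral>\<^sup>+z'. ennreal (exp (H b (\<theta> *\<^sub>R e + \<theta> *\<^sub>R z') (\<theta> *\<^sub>R e - \<theta> *\<^sub>R z'))) \<partial>G \<partial>G \<partial>G)"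
      using nn_integral_G_rotation[OF _ mH, of "sqrt y" "sqrt (1 - y)"] y
      by (simp add: \<Theta>_def B_def E_def)
    also have "\<dots> = (\<integral>\<^sup>+b. \<integral>\<^sup>+a. \<integral>\<^sup>+c. ennreal (exp (H b a c)) \<partial>G \<partial>G \<partial>G)"
      by (intro nn_integral_cong nn_integral_G_rotation[OF \<theta>, of "\<lambda>a c. ennreal (exp (H b a c))" for b])
        (simp add: H_def)
    also have "\<dots> = (\<integral>\<^sup>+b. ennreal (exp (g b)) \<partial>G)"
    proof (rule nn_integral_cong)
      fix b
      have "(\<integral>\<^sup>+a. \<integral>\<^sup>+c. ennreal (exp (H b a c)) \<partial>G \<partial>G)
          = (\<integral>\<^sup>+a. \<integral>\<^sup>+c. ennreal (exp (- g b)) * (ennreal (exp (\<phi> b a)) * ennreal (exp (\<phi> b c))) \<partial>G \<partial>G)"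
        by (simp add: H_def ennreal_mult'[symmetric] exp_add[symmetric] algebra_simps)
      also have "\<dots> = ennreal (exp (- g b)) * (ennreal (exp (g b)) * ennreal (exp (g b)))"
        by (simp add: nn_integral_cmult nn_integral_multc exp_g)
      also have "\<dots> = ennreal (exp (g b))"
        by (simp add: ennreal_mult'[symmetric] exp_add[symmetric])
      finally show "(\<integral>\<^sup>+a. \<integral>\<^sup>+c. ennreal (exp (H b a c)) \<partial>G \<partial>G) = ennreal (exp (g b))" .
    qed
    finally show ?thesis using \<open>normalized g\<close> unfolding normalized_def by (rule order_trans)
  qed
  \<comment> \<open>\<open>(1 + q) * W = U + q * V\<close> exhibits \<open>W\<close> as a convex
    combination, so it stays normalized, and dividing \<open>U + q * V\<close> by 2 produces the
    factor \<open>(1 + q) / 2\<close>.\<close>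
  define W where "W x = (U x + q * V x) / (1 + q)" for x
  have "normalized W"
  proof -
    have "(\<integral>\<^sup>+x. ennreal (exp (W x)) \<partial>G)
        \<le> (\<integral>\<^sup>+x. ennreal (1 / (1 + q)) * ennreal (exp (U x)) + ennreal (q / (1 + q)) * ennreal (exp (V x)) \<partial>G)"
    proof (rule nn_integral_mono)
      fix x
      have "exp (W x) \<le> 1 / (1 + q) * exp (U x) + q / (1 + q) * exp (V x)"
        using exp_convex_combination[OF q, of "U x" "V x"] by (simp add: W_def add_divide_distrib)
      then show "ennreal (exp (W x))
          \<le> ennreal (1 / (1 + q)) * ennreal (exp (U x)) + ennreal (q / (1 + q)) * ennreal (exp (V x))"
        using q by (simp add: ennreal_mult'[symmetric] ennreal_plus[symmetric] ennreal_leI del: ennreal_plus)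
    qed
    also have "\<dots> = ennreal (1 / (1 + q)) * (\<integral>\<^sup>+x. ennreal (exp (U x)) \<partial>G)
        + ennreal (q / (1 + q)) * (\<integral>\<^sup>+x. ennreal (exp (V x)) \<partial>G)"
      by (simp add: nn_integral_add nn_integral_cmult)
    also have "\<dots> \<le> ennreal (1 / (1 + q)) * 1 + ennreal (q / (1 + q)) * 1"
      using nU V(2) unfolding normalized_def by (intro add_mono mult_left_mono) auto
    also have "\<dots> = 1"
      using q by (simp add: ennreal_plus[symmetric] add_divide_distrib[symmetric] del: ennreal_plus)
    finally show ?thesis by (simp add: normalized_def)
  qed
  moreover have "bdd_borel W"
  proof -
    obtain C3 where C3: "\<And>x. \<bar>V x\<bar> \<le> C3" using V(1) bdd_borel_bound by blast
    show ?thesis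
    proof (rule bdd_borelI)
      show "W \<in> borel_measurable borel" unfolding W_def by measurable
      show "\<bar>W x\<bar> \<le> (2 * C1 + C2 + q * C3) / (1 + q)" for x
      proof -
        have "\<bar>U x\<bar> \<le> 2 * C1 + C2" using C1[of x] C2[of x] by (simp add: U_def)
        moreover have "\<bar>q * V x\<bar> \<le> q * C3" using C3[of x] q by (simp add: abs_mult mult_left_mono)
        ultimately have "\<bar>U x + q * V x\<bar> \<le> 2 * C1 + C2 + q * C3" by linarith
        then show ?thesis using q by (simp add: W_def divide_right_mono)
      qed
    qed
  qed
  moreover have "ou ((1 + y) / 2) f x \<le> (1 + q) / 2 * W x" for x
  proof -
    have "W x * (1 + q) = U x + q * V x" using q by (simp add: W_def)
    moreover have "(1 + q) / 2 * W x = W x * (1 + q) / 2" by simp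
    ultimately show ?thesis using V(3)[of x] by (simp add: U_def w_def)
  qed
  ultimately show "\<exists>V. bdd_borel V \<and> normalized V \<and> (\<forall>x. ou ((1 + y) / 2) f x \<le> (1 + q) / 2 * V x)"
    by blast
qed

text \<open>Starting from 1/2, the maps \<open>q \<mapsto> q / 2\<close> (composition with factor
  1/2) and \<open>q \<mapsto> (1 + q) / 2\<close> (the half step) reach a dense set. The induction
  rescales the half of the unit interval that contains \<open>(l, u)\<close>, which doubles its
  length; a length above 1 is impossible, so at some stage 1/2 lies inside.\<close>

lemma contr_dense:
  assumes "0 \<le> l" "u \<le> 1" "(1 / 2) ^ n < u - l"
  shows "\<exists>q. l < q \<and> q < u \<and> contr q q"
  using assms
proof (induction n arbitrary: l u)
  case 0
  then show ?case by simp
next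
  case (Suc n)
  have half: "contr (1 / 2) (1 / 2)" using contr_half_step[OF _ _ _ contr_0] by simp
  consider "u \<le> 1 / 2" | "1 / 2 \<le> l" | "l < 1 / 2" "1 / 2 < u" by linarith
  then show ?case
  proof cases
    case 1
    then obtain q where q: "2 * l < q" "q < 2 * u" "contr q q"
      using Suc.IH[of "2 * l" "2 * u"] Suc.prems by auto
    then have "contr (1 / 2 * q) (q * (1 / 2))"
      using 1 Suc.prems by (intro contr_mult half) auto
    with q show ?thesis by (intro exI[of _ "q / 2"]) auto
  next
    case 2
    then obtain q where q: "2 * l - 1 < q" "q < 2 * u - 1" "contr q q"
      using Suc.IH[of "2 * l - 1" "2 * u - 1"] Suc.prems by auto
    then have "contr ((1 + q) / 2) ((1 + q) / 2)"
      using 2 Suc.prems by (intro contr_half_step) auto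
    with q show ?thesis by (intro exI[of _ "(1 + q) / 2"]) auto
  next
    case 3
    with half show ?thesis by blast
  qed
qed

text \<open>Since \<open>r\<^sup>2 < r\<close>, an exact factor \<open>q\<close> strictly between
  them suffices: split \<open>r\<^sup>2 = q * (r\<^sup>2 / q)\<close> and use contraction by
  \<open>q\<close> for the first factor, mere non-expansion for the second.\<close>

lemma contr_square:
  assumes r: "0 < r" "r < 1" shows "\<exists>q. 0 \<le> q \<and> q \<le> r \<and> contr (r\<^sup>2) q"
proof -
  have lt: "r\<^sup>2 < r" using r by (simp add: power2_eq_square)
  then obtain n where "(1 / 2) ^ n < r - r\<^sup>2"
    using real_arch_pow_inv[of "r - r\<^sup>2" "1 / 2"] by auto
  then obtain q where q: "r\<^sup>2 < q" "q < r" "contr q q"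
    using contr_dense[of "r\<^sup>2" r n] r by auto
  have q0: "0 < q" using q(1) zero_le_power2[of r] by linarith
  have "contr (q * (r\<^sup>2 / q)) (1 * q)"
    using r q q0 by (intro contr_mult contr_1) auto
  with q0 show ?thesis using q by (intro exI[of _ q]) auto
qed

end


subsection \<open>Relative entropy in variational form\<close>

definition clamp_to :: "real \<Rightarrow> real \<Rightarrow> real" where
  "clamp_to n t = max (- n) (min n t)"

lemma abs_clamp_to: "0 \<le> n \<Longrightarrow> \<bar>clamp_to n t\<bar> \<le> n"
  by (auto simp: clamp_to_def)

lemma abs_clamp_to_le: "0 \<le> n \<Longrightarrow> \<bar>clamp_to n t\<bar> \<le> \<bar>t\<bar>"
  by (auto simp: clamp_to_def)

lemma clamp_to_diff: "\<bar>clamp_to n s - clamp_to n t\<bar> \<le> \<bar>s - t\<bar>"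
  by (auto simp: clamp_to_def max_def min_def abs_if)

lemma clamp_to_measurable [measurable]: "clamp_to n \<in> borel_measurable borel"
  unfolding clamp_to_def by measurable

text \<open>Truncation from above only lowers the value, truncation from below lifts it to
  \<open>exp (- n)\<close>; this is the whole loss of normalization.\<close>

lemma exp_clamp_to_le: "0 \<le> n \<Longrightarrow> exp (clamp_to n t) \<le> exp t + exp (- n)"
  by (cases "t < - n") (auto simp: clamp_to_def add_increasing add_increasing2)

text \<open>Young's inequality \<open>v f \<le> v ln v - v + e\<^sup>f\<close> at \<open>v = e\<^sup>t\<close>, which survives truncation of \<open>ln v\<close>.\<close>

lemma young_clamp_to:
  assumes "\<bar>f\<bar> + 1 \<le> n"
  shows "exp t * (f - clamp_to n t) \<le> exp f - exp t"
proof -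
  have y: "exp t * (f - t + 1) \<le> exp f" for t
    using mult_left_mono[OF exp_ge_add_one_self[of "f - t"], of "exp t"] by (simp add: exp_diff add.commute)
  consider "\<bar>t\<bar> \<le> n" | "n < t" | "t < - n" by linarith
  then show ?thesis
  proof cases
    case 1
    then have "clamp_to n t = t" by (auto simp: clamp_to_def)
    then show ?thesis using y[of t] by (simp add: algebra_simps)
  next
    case 2
    then have c: "clamp_to n t = n" using assms by (auto simp: clamp_to_def)
    have "exp t * (f - n + 1) \<le> 0" using assms by (intro mult_nonneg_nonpos) auto
    then have "exp t * (f - n + 1) \<le> exp f" using exp_gt_zero[of f] by linarith
    then show ?thesis by (simp add: c algebra_simps)
  next
    case 3
    then have c: "clamp_to n t = - n" using assms by (auto simp: clamp_to_def)
    \<comment> \<open>Here \<open>f + n + 1\<close> is non-negative, so \<open>exp t\<close> may be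
      raised to \<open>exp (- n)\<close>, where the untruncated inequality applies.\<close>
    have "exp t * (f + n + 1) \<le> exp (- n) * (f + n + 1)"
      using 3 assms by (intro mult_right_mono) auto
    also have "\<dots> \<le> exp f" using y[of "- n"] by simp
    finally show ?thesis by (simp add: c algebra_simps)
  qed
qed

section \<open>Donsker-Varadhan test functions and truncated log-densities\<close>

context gaussian
begin

text \<open>By the Donsker--Varadhan formula this says that the relative entropy of \<open>\<mu>\<close> with respect
  to \<open>G\<close> is at most \<open>k\<close>.\<close>

definition ent_le :: "'a measure \<Rightarrow> real \<Rightarrow> bool" where
  "ent_le \<mu> k \<longleftrightarrow> (\<forall>f. bdd_borel f \<longrightarrow> normalized f \<longrightarrow> (\<integral>x. f x \<partial>\<mu>) \<le> k)"

lemma normalized_0: "normalized (\<lambda>_. 0)"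
  by (simp add: normalized_def G.emeasure_space_1[simplified])

lemma ent_le_nonneg: "ent_le \<mu> k \<Longrightarrow> 0 \<le> k"
  unfolding ent_le_def using normalized_0 by (auto simp: bdd_borel_def dest!: spec[of _ "\<lambda>_. 0"])

lemma ent_le_mono: "ent_le \<mu> k \<Longrightarrow> k \<le> k' \<Longrightarrow> ent_le \<mu> k'"
  by (auto simp: ent_le_def intro: order_trans)

lemma ent_le_approx:
  assumes "\<And>\<epsilon>. 0 < \<epsilon> \<Longrightarrow> ent_le \<mu> (k + \<epsilon>)" shows "ent_le \<mu> k"
  unfolding ent_le_def
proof (intro allI impI)
  fix f assume f: "bdd_borel f" "normalized f"
  show "(\<integral>x. f x \<partial>\<mu>) \<le> k"
  proof (rule field_le_epsilon)
    show "(\<integral>x. f x \<partial>\<mu>) \<le> k + \<epsilon>" if "0 < \<epsilon>" for \<epsilon>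
      using assms[OF that] f unfolding ent_le_def by blast
  qed
qed

lemma integrable_bdd_borel:
  assumes "prob_space \<mu>" "sets \<mu> = sets borel" "bdd_borel f"
  shows "integrable \<mu> f"
proof -
  interpret prob_space \<mu> by fact
  show ?thesis using assms(2,3)
    by (metis integrable_bdd bdd_borel_def measurable_cong_sets)
qed

text \<open>The pointwise domination in \<open>contr\<close> pays off here:
  \<open>ou (r\<^sup>2) f \<le> q * V\<close> can be integrated against any \<open>\<mu>\<close>,
  and the entropy bound is then applied to \<open>V\<close>.\<close>

lemma ent_le_ou:
  assumes r: "0 < r" "r < 1" and \<mu>: "prob_space \<mu>" "sets \<mu> = sets borel"
    and k: "ent_le \<mu> k" and f: "bdd_borel f" "normalized f"
  shows "(\<integral>x. ou (r\<^sup>2) f x \<partial>\<mu>) \<le> r * k"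
proof -
  obtain q where q: "0 \<le> q" "q \<le> r" "contr (r\<^sup>2) q" using contr_square[OF r] by blast
  then obtain V where V: "bdd_borel V" "normalized V" "\<And>x. ou (r\<^sup>2) f x \<le> q * V x"
    using f unfolding contr_def by blast
  have "(\<integral>x. ou (r\<^sup>2) f x \<partial>\<mu>) \<le> (\<integral>x. q * V x \<partial>\<mu>)"
    using V f by (intro integral_mono integrable_bdd_borel \<mu> bdd_ou bdd_cmult) auto
  also have "\<dots> = q * (\<integral>x. V x \<partial>\<mu>)" by simp
  also have "\<dots> \<le> q * k" using k V q by (intro mult_left_mono) (auto simp: ent_le_def)
  also have "\<dots> \<le> r * k" using q ent_le_nonneg[OF k] by (intro mult_right_mono) auto
  finally show ?thesis .
qed

lemma exp_density_integral:
  assumes \<mu>: "prob_space \<mu>" "\<mu> = density G (\<lambda>x. ennreal (exp (h x)))"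
    and [measurable]: "h \<in> borel_measurable borel"
  shows "integrable G (\<lambda>x. exp (h x))" "(\<integral>x. exp (h x) \<partial>G) = 1"
    "(\<integral>\<^sup>+x. ennreal (exp (h x)) \<partial>G) = 1"
proof -
  interpret prob_space \<mu> by fact
  have "emeasure \<mu> UNIV = (\<integral>\<^sup>+x. ennreal (exp (h x)) \<partial>G)"
    unfolding \<mu>(2) by (subst emeasure_density) auto
  moreover have "space \<mu> = UNIV" by (simp add: \<mu>(2))
  ultimately show n: "(\<integral>\<^sup>+x. ennreal (exp (h x)) \<partial>G) = 1"
    using emeasure_space_1 by simp
  then show "integrable G (\<lambda>x. exp (h x))" by (intro integrableI_nonneg) auto
  then show "(\<integral>x. exp (h x) \<partial>G) = 1" using n by (simp add: nn_integral_eq_integral)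
qed

text \<open>The log-density is the maximizer in the Donsker-Varadhan formula, so its truncations are
  the only test functions to check. Once \<open>n\<close> exceeds the bound of \<open>f\<close> by
  1, Young's inequality gives \<open>\<integral> (f - clamp_to n h) d\<mu> \<le> \<integral> exp f
  dG - 1 \<le> 0\<close>.\<close>

lemma ent_le_clampI:
  assumes \<mu>: "prob_space \<mu>" "\<mu> = density G (\<lambda>x. ennreal (exp (h x)))"
    and h [measurable]: "h \<in> borel_measurable borel"
    and le: "\<And>n::nat. (\<integral>x. clamp_to n (h x) \<partial>\<mu>) \<le> k + exp (- real n)"
  shows "ent_le \<mu> k"
  unfolding ent_le_def
proof (intro allI impI)
  fix f assume f: "bdd_borel f" "normalized f"
  note e = exp_density_integral[OF \<mu> h]
  have [measurable]: "f \<in> borel_measurable borel" using f by (simp add: bdd_borel_measurable)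
  have sets_\<mu>: "sets \<mu> = sets borel" by (simp add: \<mu>(2))
  obtain C where C: "\<And>x. \<bar>f x\<bar> \<le> C" using f bdd_borel_bound by blast
  have exp_f: "integrable G (\<lambda>x. exp (f x))"
    using C by (intro G.integrable_bdd[of _ "exp C"]) (auto simp: abs_le_iff)
  have exp_f_le: "(\<integral>x. exp (f x) \<partial>G) \<le> 1"
    using f(2) exp_f by (simp add: normalized_def nn_integral_eq_integral)
  have main: "(\<integral>x. f x \<partial>\<mu>) \<le> k + exp (- real n)" if n: "C + 1 \<le> real n" for n
  proof -
    have bc: "bdd_borel (\<lambda>x. clamp_to n (h x))"
      by (rule bdd_borelI[of _ n]) (auto simp: abs_clamp_to)
    have bd: "bdd_borel (\<lambda>x. f x - clamp_to n (h x))"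
      using C by (intro bdd_borelI[of _ "C + n"]) (auto intro!: order_trans[OF abs_triangle_ineq4] add_mono abs_clamp_to)
    have i: "integrable \<mu> (\<lambda>x. f x - clamp_to n (h x))" by (rule integrable_bdd_borel[OF \<mu>(1) sets_\<mu> bd])
    have "(\<integral>x. f x - clamp_to n (h x) \<partial>\<mu>) = (\<integral>x. exp (h x) * (f x - clamp_to n (h x)) \<partial>G)"
      unfolding \<mu>(2) by (subst integral_density) auto
    also have "\<dots> \<le> (\<integral>x. exp (f x) - exp (h x) \<partial>G)"
    proof (rule integral_mono)
      show "integrable G (\<lambda>x. exp (h x) * (f x - clamp_to n (h x)))"
        using i unfolding \<mu>(2) by (subst (asm) integrable_density) auto
      show "exp (h x) * (f x - clamp_to n (h x)) \<le> exp (f x) - exp (h x)" for x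
        using C[of x] n by (intro young_clamp_to) linarith
    qed (use e exp_f in auto)
    also have "\<dots> \<le> 0" using e exp_f exp_f_le by simp
    finally have "(\<integral>x. f x - clamp_to n (h x) \<partial>\<mu>) \<le> 0" .
    then have "(\<integral>x. f x \<partial>\<mu>) \<le> (\<integral>x. clamp_to n (h x) \<partial>\<mu>)"
      using integrable_bdd_borel[OF \<mu>(1) sets_\<mu> bc] integrable_bdd_borel[OF \<mu>(1) sets_\<mu> f(1)] by simp
    then show ?thesis using le[of n] by simp
  qed
  have "(\<lambda>n. k + exp (- real n)) \<longlonglongrightarrow> k + 0"
    by (intro tendsto_intros filterlim_compose[OF exp_at_bot]
        filterlim_compose[OF filterlim_uminus_at_bot_at_top] filterlim_real_sequentially)
  moreover have "\<exists>N. \<forall>n\<ge>N. (\<integral>x. f x \<partial>\<mu>) \<le> k + exp (- real n)"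
    using main real_arch_simple[of "C + 1"] by (meson of_nat_le_iff order_trans)
  ultimately show "(\<integral>x. f x \<partial>\<mu>) \<le> k"
    using LIMSEQ_le_const[of "\<lambda>n. k + exp (- real n)" "k + 0" "\<integral>x. f x \<partial>\<mu>"] by simp
qed

text \<open>With \<open>e = exp (- n)\<close> the integral is at most
  \<open>exp (- e) * (1 + e)\<close>, and \<open>1 + e \<le> exp e\<close>.\<close>

lemma normalized_clamp:
  assumes \<mu>: "prob_space \<mu>" "\<mu> = density G (\<lambda>x. ennreal (exp (h x)))"
    and h [measurable]: "h \<in> borel_measurable borel" and n: "0 \<le> n"
  shows "normalized (\<lambda>x. clamp_to n (h x) - exp (- n))"
proof -
  note e = exp_density_integral[OF \<mu> h]
  let ?e = "ennreal (exp (- exp (- n)))"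
  have "(\<integral>\<^sup>+x. ennreal (exp (clamp_to n (h x) - exp (- n))) \<partial>G)
      \<le> (\<integral>\<^sup>+x. ?e * (ennreal (exp (h x)) + ennreal (exp (- n))) \<partial>G)"
  proof (rule nn_integral_mono)
    fix x
    have "exp (clamp_to n (h x) - exp (- n)) \<le> exp (- exp (- n)) * (exp (h x) + exp (- n))"
    proof -
      have "exp (clamp_to n (h x) - exp (- n)) = exp (- exp (- n)) * exp (clamp_to n (h x))"
        by (simp add: exp_add[symmetric])
      then show ?thesis using exp_clamp_to_le[OF n, of "h x"] by (simp add: mult_left_mono)
    qed
    then show "ennreal (exp (clamp_to n (h x) - exp (- n)))
        \<le> ?e * (ennreal (exp (h x)) + ennreal (exp (- n)))"
      by (simp add: ennreal_mult'[symmetric] ennreal_plus[symmetric] ennreal_leI del: ennreal_plus)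
  qed
  also have "\<dots> = ?e * (1 + ennreal (exp (- n)))"
    by (simp add: nn_integral_cmult nn_integral_add e(3) G.emeasure_space_1[simplified])
  also have "\<dots> = ennreal (exp (- exp (- n)) * (1 + exp (- n)))"
    by (simp add: ennreal_mult'[symmetric] ennreal_plus[symmetric] ennreal_1[symmetric] del: ennreal_plus ennreal_1)
  also have "\<dots> \<le> ennreal (exp (- exp (- n)) * exp (exp (- n)))"
    by (intro ennreal_leI mult_left_mono exp_ge_add_one_self) auto
  also have "\<dots> = 1" by (simp add: exp_minus)
  finally show ?thesis by (simp add: normalized_def)
qed

text \<open>The Donsker-Varadhan inequality for unbounded \<open>F\<close>: each
  \<open>min m F - ln c\<close> is an admissible bounded test function, and monotone convergence
  removes \<open>m\<close>.\<close>

lemma ent_le_nn_integral: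
  assumes \<mu>: "prob_space \<mu>" "sets \<mu> = sets borel" and k: "ent_le \<mu> k"
    and F [measurable]: "F \<in> borel_measurable borel" and F0: "\<And>x. 0 \<le> F x"
    and c: "0 < c" "(\<integral>\<^sup>+x. ennreal (exp (F x)) \<partial>G) \<le> ennreal c"
  shows "(\<integral>\<^sup>+x. ennreal (F x) \<partial>\<mu>) \<le> ennreal (k + ln c)"
proof -
  interpret prob_space \<mu> by fact
  have [measurable_cong]: "sets \<mu> = sets borel" by fact
  have le: "(\<integral>\<^sup>+x. ennreal (min (real m) (F x)) \<partial>\<mu>) \<le> ennreal (k + ln c)" for m :: nat
  proof -
    have b: "bdd_borel (\<lambda>x. min (real m) (F x))"
      using F0 by (intro bdd_borelI[of _ m]) (auto simp: min_def)
    have b2: "bdd_borel (\<lambda>x. min (real m) (F x) - ln c)"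
      using F0 by (intro bdd_borelI[of _ "m + \<bar>ln c\<bar>"]) (auto intro!: order_trans[OF abs_triangle_ineq4] simp: min_def)
    have "(\<integral>\<^sup>+x. ennreal (exp (min (real m) (F x) - ln c)) \<partial>G) \<le> (\<integral>\<^sup>+x. ennreal (1 / c) * ennreal (exp (F x)) \<partial>G)"
      using c(1) by (intro nn_integral_mono)
        (simp add: ennreal_mult'[symmetric] exp_diff divide_right_mono ennreal_leI)
    also have "\<dots> = ennreal (1 / c) * (\<integral>\<^sup>+x. ennreal (exp (F x)) \<partial>G)"
      by (simp add: nn_integral_cmult)
    also have "\<dots> \<le> ennreal (1 / c) * ennreal c" using c by (intro mult_left_mono) auto
    also have "\<dots> = 1" using c(1) by (simp add: ennreal_mult'[symmetric])
    finally have "normalized (\<lambda>x. min (real m) (F x) - ln c)" by (simp add: normalized_def)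
    then have "(\<integral>x. min (real m) (F x) - ln c \<partial>\<mu>) \<le> k" using k b2 unfolding ent_le_def by blast
    then have "(\<integral>x. min (real m) (F x) \<partial>\<mu>) \<le> k + ln c"
      using integrable_bdd_borel[OF \<mu> b] by (simp add: prob_space)
    then show ?thesis using integrable_bdd_borel[OF \<mu> b] F0
      by (subst nn_integral_eq_integral) (auto intro: ennreal_leI)
  qed
  have "(\<integral>\<^sup>+x. ennreal (F x) \<partial>\<mu>) = (\<integral>\<^sup>+x. (SUP m::nat. ennreal (min (real m) (F x))) \<partial>\<mu>)"
  proof (rule nn_integral_cong)
    fix x
    obtain m :: nat where m: "F x \<le> m" using real_arch_simple by blast
    have "ennreal (F x) = ennreal (min (real m) (F x))" using m by (simp add: min_def)
    then have "ennreal (F x) \<le> (SUP m::nat. ennreal (min (real m) (F x)))"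
      by (simp add: SUP_upper2[of m])
    then show "ennreal (F x) = (SUP m::nat. ennreal (min (real m) (F x)))"
      by (intro antisym SUP_least) (auto intro: ennreal_leI)
  qed
  also have "\<dots> = (SUP m::nat. \<integral>\<^sup>+x. ennreal (min (real m) (F x)) \<partial>\<mu>)"
    by (intro nn_integral_monotone_convergence_SUP) (auto simp: incseq_def le_fun_def intro!: ennreal_leI)
  also have "\<dots> \<le> ennreal (k + ln c)" using le by (intro SUP_least)
  finally show ?thesis .
qed

end

text \<open>Along the segment the norm is below the linear interpolation of the end norms, whose
  mean is \<open>(norm x + norm y) / 2\<close>. The function \<open>gap\<close>, the bound
  integrated up to \<open>\<theta>\<close> minus the value of \<open>h\<close>, has non-negative
  derivative; its monotonicity replaces the integration of a gradient that may be
  discontinuous.\<close>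

lemma gradient_growth_diff:
  fixes h :: "'a::real_inner \<Rightarrow> real"
  assumes grad: "\<And>x. \<exists>D. GDERIV h x :> D \<and> norm D \<le> a * norm x + b" and ab: "0 \<le> a" "0 \<le> b"
  shows "\<bar>h x - h y\<bar> \<le> norm (x - y) * (a * ((norm x + norm y) / 2) + b)"
proof -
  have one: "h x - h y \<le> norm (x - y) * (a * ((norm x + norm y) / 2) + b)" for x y
  proof -
    obtain D where D: "\<And>x. GDERIV h x :> D x" "\<And>x. norm (D x) \<le> a * norm x + b"
      using grad by metis
    define L where "L = norm (x - y)"
    define gap where "gap \<theta> = L * (a * (norm y * (\<theta> - \<theta>\<^sup>2 / 2) + norm x * (\<theta>\<^sup>2 / 2)) + b * \<theta>)
      - h (y + \<theta> *\<^sub>R (x - y))" for \<theta> :: real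
    have d: "(gap has_real_derivative
        L * (a * (norm y * (1 - \<theta>) + norm x * \<theta>) + b) - (x - y) \<bullet> D (y + \<theta> *\<^sub>R (x - y))) (at \<theta>)" for \<theta>
    proof -
      have "((\<lambda>\<theta>. h (y + \<theta> *\<^sub>R (x - y))) has_derivative (\<lambda>s. (s *\<^sub>R (x - y)) \<bullet> D (y + \<theta> *\<^sub>R (x - y)))) (at \<theta>)"
        by (rule has_derivative_compose[OF _ D(1)[unfolded gderiv_def], where f = "\<lambda>\<theta>. y + \<theta> *\<^sub>R (x - y)"])
          (auto intro!: derivative_eq_intros)
      then have "((\<lambda>\<theta>. h (y + \<theta> *\<^sub>R (x - y))) has_real_derivative (x - y) \<bullet> D (y + \<theta> *\<^sub>R (x - y))) (at \<theta>)"
        by (simp add: has_field_derivative_def mult_commute_abs)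
      then show ?thesis
        unfolding gap_def by (auto intro!: derivative_eq_intros simp: algebra_simps)
    qed
    have "gap 0 \<le> gap 1"
    proof (rule DERIV_nonneg_imp_nondecreasing[of 0 1 gap])
      fix \<theta> :: real assume \<theta>: "0 \<le> \<theta>" "\<theta> \<le> 1"
      have "norm (y + \<theta> *\<^sub>R (x - y)) = norm ((1 - \<theta>) *\<^sub>R y + \<theta> *\<^sub>R x)" by (simp add: algebra_simps)
      also have "\<dots> \<le> norm y * (1 - \<theta>) + norm x * \<theta>"
        using \<theta> by (intro order_trans[OF norm_triangle_ineq]) (simp add: mult.commute)
      finally have n: "a * norm (y + \<theta> *\<^sub>R (x - y)) \<le> a * (norm y * (1 - \<theta>) + norm x * \<theta>)"
        using ab by (intro mult_left_mono)
      have "(x - y) \<bullet> D (y + \<theta> *\<^sub>R (x - y)) \<le> L * norm (D (y + \<theta> *\<^sub>R (x - y)))"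
        unfolding L_def by (rule norm_cauchy_schwarz)
      also have "\<dots> \<le> L * (a * (norm y * (1 - \<theta>) + norm x * \<theta>) + b)"
        using D(2)[of "y + \<theta> *\<^sub>R (x - y)"] n by (intro mult_left_mono) (auto simp: L_def)
      finally show "\<exists>D. (gap has_real_derivative D) (at \<theta>) \<and> 0 \<le> D" using d[of \<theta>] by auto
    qed simp
    then show ?thesis by (simp add: gap_def L_def algebra_simps add_divide_distrib)
  qed
  show ?thesis using one[of x y] one[of y x] by (simp add: abs_le_iff norm_minus_commute add.commute)
qed


subsection \<open>The Poissonised chain\<close>

definition poisson_weight :: "real \<Rightarrow> nat \<Rightarrow> real" where
  "poisson_weight t k = t ^ k / fact k * exp (- t)"

lemma poisson_weight_0: "poisson_weight t 0 = exp (- t)"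
  by (simp add: poisson_weight_def)

lemma poisson_weight_measurable [measurable]: "(\<lambda>t. poisson_weight t k) \<in> borel_measurable borel"
  unfolding poisson_weight_def by measurable

text \<open>The integrand is the density of the time \<open>r\<close> of the last jump before
  \<open>T\<close>, when that is jump number \<open>k + 1\<close>: \<open>k\<close> jumps before
  \<open>r\<close> and none after it.\<close>

lemma poisson_weight_Suc:
  assumes T: "0 \<le> T"
  shows "ennreal (poisson_weight T (Suc k))
     = (\<integral>\<^sup>+r\<in>{0..T}. ennreal (exp (- (T - r))) * ennreal (poisson_weight r k) \<partial>lborel)"
proof -
  have "(\<integral>\<^sup>+r\<in>{0..T}. ennreal (exp (- (T - r))) * ennreal (poisson_weight r k) \<partial>lborel)
      = (\<integral>\<^sup>+r. ennreal (exp (- T) * r ^ k / fact k) * indicator {0..T} r \<partial>lborel)"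
    by (intro nn_integral_cong)
      (auto simp: poisson_weight_def ennreal_mult'[symmetric] mult_exp_exp split: split_indicator)
  also have "\<dots> = ennreal (exp (- T) * T ^ Suc k / fact (Suc k) - exp (- T) * 0 ^ Suc k / fact (Suc k))"
  proof (rule nn_integral_FTC_Icc)
    show "((\<lambda>r. exp (- T) * r ^ Suc k / fact (Suc k)) has_real_derivative exp (- T) * r ^ k / fact k) (at r)" for r
    proof -
      have "((\<lambda>r. exp (- T) * r ^ Suc k / fact (Suc k)) has_real_derivative
          exp (- T) * (real (Suc k) * r ^ k) / fact (Suc k)) (at r)"
        by (intro DERIV_cdivide DERIV_cmult) (use DERIV_pow[of "Suc k" r] in simp)
      moreover have "exp (- T) * (real (Suc k) * r ^ k) / fact (Suc k) = exp (- T) * r ^ k / fact k"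
        by (simp only: fact_Suc of_nat_mult) (simp del: of_nat_Suc)
      ultimately show ?thesis by simp
    qed
  qed (use T in auto)
  also have "\<dots> = ennreal (poisson_weight T (Suc k))"
    by (simp add: poisson_weight_def ac_simps)
  finally show ?thesis by simp
qed

section \<open>Sources of randomness, Markov property and Poisson mixture\<close>

locale sgd_chain =
  fixes M :: "'w measure" and \<mu>0 :: "'a::euclidean_space measure" and \<mu>U :: "'u measure"
    and X0 :: "'w \<Rightarrow> 'a" and U :: "nat \<Rightarrow> 'w \<Rightarrow> 'u" and N :: "real \<Rightarrow> 'w \<Rightarrow> nat"
    and \<eta> lam :: real and g :: "'a \<Rightarrow> 'u \<Rightarrow> 'a"
  assumes rnd: "sgd_randomness M \<mu>0 \<mu>U X0 U N"
    and sets_\<mu>0: "sets \<mu>0 = sets borel" and prob_\<mu>U: "prob_space \<mu>U"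
    and g_measurable [measurable]: "(\<lambda>(x, v). g x v) \<in> borel_measurable (borel \<Otimes>\<^sub>M \<mu>U)"
begin

sublocale M: prob_space M using rnd by (simp add: sgd_randomness_def)
sublocale \<mu>U: prob_space \<mu>U by (rule prob_\<mu>U)

abbreviation step :: "'a \<Rightarrow> 'u \<Rightarrow> 'a" where "step \<equiv> sgd_step \<eta> lam g"
abbreviation X :: "nat \<Rightarrow> 'w \<Rightarrow> 'a" where "X \<equiv> sgd_iterate \<eta> lam g X0 U"
abbreviation Y :: "real \<Rightarrow> 'w \<Rightarrow> 'a" where "Y \<equiv> poissonized X N"
abbreviation law :: "nat \<Rightarrow> 'a measure" where "law k \<equiv> distr M borel (X k)"
abbreviation events_of :: "source \<Rightarrow> 'w set set" where
  "events_of \<equiv> source_events M \<mu>0 \<mu>U X0 U N"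
abbreviation src :: "source set \<Rightarrow> 'w measure" where
  "src I \<equiv> sigma (space M) (\<Union>i\<in>I. events_of i)"

lemma X0_measurable: "X0 \<in> M \<rightarrow>\<^sub>M \<mu>0"
  and U_measurable [measurable]: "U k \<in> M \<rightarrow>\<^sub>M \<mu>U"
  and distr_X0: "distr M \<mu>0 X0 = \<mu>0" and distr_U: "distr M \<mu>U (U k) = \<mu>U"
  and poisson: "poisson_process M 1 N"
  and indep_sources: "M.indep_sets events_of UNIV"
  using rnd unfolding sgd_randomness_def by auto

lemma X0_borel_measurable [measurable]: "X0 \<in> M \<rightarrow>\<^sub>M borel"
  using X0_measurable sets_\<mu>0 by (metis measurable_cong_sets)

lemma N_measurable [measurable]: "0 \<le> t \<Longrightarrow> N t \<in> M \<rightarrow>\<^sub>M count_space UNIV"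
  using poisson by (simp add: poisson_process_def)

lemma step_measurable [measurable]: "(\<lambda>(x, v). step x v) \<in> borel \<Otimes>\<^sub>M \<mu>U \<rightarrow>\<^sub>M borel"
  unfolding sgd_step_def by measurable

lemma X_measurable [measurable]: "X k \<in> M \<rightarrow>\<^sub>M borel"
proof (induction k)
  case 0
  then show ?case by (simp add: measurable_cong[of _ "X 0" X0])
next
  case (Suc k)
  then have "(\<lambda>\<omega>. step (X k \<omega>) (U k \<omega>)) \<in> M \<rightarrow>\<^sub>M borel" by measurable
  then show ?case by simp
qed

lemma Y_measurable: "0 \<le> t \<Longrightarrow> Y t \<in> M \<rightarrow>\<^sub>M borel"
  unfolding poissonized_def
  by (rule measurable_compose_countable[of X]) auto

lemma events_of_subset: "(\<Union>i\<in>I. events_of i) \<subseteq> Pow (space M)"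
proof -
  have "events_of i \<subseteq> Pow (space M)" for i
    by (cases i) (auto simp: source_events_def sets_vimage_algebra dest: sigma_sets_into_sp[rotated])
  then show ?thesis by blast
qed

lemma Int_stable_events_of: "Int_stable (events_of i)"
  by (cases i) (auto simp: source_events_def Int_stable_def)

lemma measurable_src:
  assumes f: "f \<in> space M \<rightarrow> space Q" and i: "i \<in> I" and e: "events_of i = sets (vimage_algebra (space M) f Q)"
  shows "f \<in> src I \<rightarrow>\<^sub>M Q"
proof (rule measurableI)
  show "f x \<in> space Q" if "x \<in> space (src I)" for x
    using that f events_of_subset[of I] by (auto simp: space_measure_of)
  show "f -` A \<inter> space (src I) \<in> sets (src I)" if "A \<in> sets Q" for A
  proof -
    have "f -` A \<inter> space M \<in> events_of i"
      unfolding e using that by (rule in_vimage_algebra)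
    then show ?thesis using i events_of_subset[of I]
      by (auto simp: space_measure_of sets_measure_of intro!: sigma_sets.Basic)
  qed
qed

lemma X0_src:
  assumes "Init \<in> I" shows "X0 \<in> src I \<rightarrow>\<^sub>M borel"
proof -
  have "X0 \<in> src I \<rightarrow>\<^sub>M \<mu>0"
    using assms by (intro measurable_src[of _ _ Init] Pi_I measurable_space[OF X0_measurable])
      (auto simp: source_events_def)
  then show ?thesis using sets_\<mu>0 by (metis measurable_cong_sets)
qed

lemma U_src: "Batch k \<in> I \<Longrightarrow> U k \<in> src I \<rightarrow>\<^sub>M \<mu>U"
  by (intro measurable_src[of _ _ "Batch k"] Pi_I measurable_space[OF U_measurable])
    (auto simp: source_events_def)

lemma N_src:
  assumes t: "0 \<le> t" and I: "Clock \<in> I"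
  shows "N t \<in> src I \<rightarrow>\<^sub>M count_space UNIV"
proof -
  have "(\<lambda>\<omega>. \<lambda>t\<in>{0..}. N t \<omega>) \<in> src I \<rightarrow>\<^sub>M Pi\<^sub>M {0..} (\<lambda>_. count_space UNIV)"
    using I by (intro measurable_src[of _ _ Clock]) (auto simp: source_events_def space_PiM)
  from measurable_compose[OF this measurable_component_singleton[of t]] t
  show ?thesis by simp
qed

lemma X_src: "insert Init (Batch ` {..<k}) \<subseteq> I \<Longrightarrow> X k \<in> src I \<rightarrow>\<^sub>M borel"
proof (induction k)
  case 0
  then have "X0 \<in> src I \<rightarrow>\<^sub>M borel" by (intro X0_src) auto
  then show ?case by (simp add: measurable_cong[of _ "X 0" X0])
next
  case (Suc k)
  then have [measurable]: "X k \<in> src I \<rightarrow>\<^sub>M borel" "U k \<in> src I \<rightarrow>\<^sub>M \<mu>U"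
    by (auto intro!: U_src Suc.IH)
  have "(\<lambda>\<omega>. step (X k \<omega>) (U k \<omega>)) \<in> src I \<rightarrow>\<^sub>M borel" by measurable
  then show ?case by simp
qed

text \<open>Disjoint groups of independent sources generate independent sigma-algebras, and the
  joint law is compared with the product on rectangles. Later uses of independence between sources
  go through this lemma.\<close>

lemma distr_Pair_src:
  assumes disj: "I \<inter> J = {}"
    and V: "V \<in> src I \<rightarrow>\<^sub>M S" "V \<in> M \<rightarrow>\<^sub>M S" and W: "W \<in> src J \<rightarrow>\<^sub>M T" "W \<in> M \<rightarrow>\<^sub>M T"
  shows "distr M (S \<Otimes>\<^sub>M T) (\<lambda>\<omega>. (V \<omega>, W \<omega>)) = distr M S V \<Otimes>\<^sub>M distr M T W"
proof -
  have [measurable]: "V \<in> M \<rightarrow>\<^sub>M S" "W \<in> M \<rightarrow>\<^sub>M T" by fact+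
  have "M.indep_sets (\<lambda>b. sigma_sets (space M) (\<Union>i\<in>case_bool I J b. events_of i)) UNIV"
    using disj
    by (intro M.indep_sets_collect_sigma M.indep_sets_mono_index[OF _ indep_sources] Int_stable_events_of)
      (auto simp: disjoint_family_on_def split: bool.split)
  then have ind: "M.indep_set (sigma_sets (space M) (\<Union>i\<in>I. events_of i)) (sigma_sets (space M) (\<Union>i\<in>J. events_of i))"
    unfolding M.indep_set_def by (rule M.indep_sets_mono_sets) (auto split: bool.split)
  have sub: "f -` A \<inter> space M \<in> sigma_sets (space M) (\<Union>i\<in>K. events_of i)"
    if "f \<in> src K \<rightarrow>\<^sub>M Q" "A \<in> sets Q" for f K A and Q :: "'q measure"
    using measurable_sets[OF that] events_of_subset[of K] by (simp add: space_measure_of sets_measure_of)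
  interpret V: prob_space "distr M S V" by (rule M.prob_space_distr) simp
  interpret W: prob_space "distr M T W" by (rule M.prob_space_distr) simp
  show ?thesis
  proof (rule pair_measure_eqI[symmetric])
    fix A B assume AB: "A \<in> sets (distr M S V)" "B \<in> sets (distr M T W)"
    then have [measurable]: "A \<in> sets S" "B \<in> sets T" by auto
    have "emeasure (distr M (S \<Otimes>\<^sub>M T) (\<lambda>\<omega>. (V \<omega>, W \<omega>))) (A \<times> B)
        = emeasure M ((V -` A \<inter> space M) \<inter> (W -` B \<inter> space M))"
      by (subst emeasure_distr) (auto intro!: arg_cong[where f = "emeasure M"])
    also have "\<dots> = emeasure M (V -` A \<inter> space M) * emeasure M (W -` B \<inter> space M)"
      using ind sub[OF V(1)] sub[OF W(1)]
      unfolding M.indep_sets2_eq M.emeasure_eq_measure by (simp add: ennreal_mult)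
    finally show "emeasure (distr M S V) A * emeasure (distr M T W) B
        = emeasure (distr M (S \<Otimes>\<^sub>M T) (\<lambda>\<omega>. (V \<omega>, W \<omega>))) (A \<times> B)"
      by (simp add: emeasure_distr)
  qed (auto intro: V.sigma_finite_measure W.sigma_finite_measure V.sigma_finite_measure_axioms W.sigma_finite_measure_axioms
       intro!: sets_pair_measure_cong)
qed

lemma law_0: "law 0 = \<mu>0"
  using distr_X0 sets_\<mu>0 by (metis distr_cong sgd_iterate.simps(1))

text \<open>The Markov property: \<open>X k\<close> depends on the initial point and the batches
  below \<open>k\<close> only, hence is independent of \<open>U k\<close>.\<close>

lemma nn_integral_law_Suc:
  assumes [measurable]: "F \<in> borel_measurable borel"
  shows "(\<integral>\<^sup>+x. F x \<partial>law (Suc k)) = (\<integral>\<^sup>+x. \<integral>\<^sup>+v. F (step x v) \<partial>\<mu>U \<partial>law k)"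
proof -
  have d: "distr M (borel \<Otimes>\<^sub>M \<mu>U) (\<lambda>\<omega>. (X k \<omega>, U k \<omega>)) = law k \<Otimes>\<^sub>M \<mu>U"
    by (subst distr_U[of k, symmetric],
        rule distr_Pair_src[OF _ X_src X_measurable U_src U_measurable,
          where I = "insert Init (Batch ` {..<k})" and J = "{Batch k}"]) auto
  have "(\<integral>\<^sup>+x. F x \<partial>law (Suc k)) = (\<integral>\<^sup>+\<omega>. F (step (X k \<omega>) (U k \<omega>)) \<partial>M)"
    by (subst nn_integral_distr) (auto intro!: X_measurable)
  also have "\<dots> = (\<integral>\<^sup>+p. F (case p of (x, v) \<Rightarrow> step x v) \<partial>distr M (borel \<Otimes>\<^sub>M \<mu>U) (\<lambda>\<omega>. (X k \<omega>, U k \<omega>)))"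
    by (subst nn_integral_distr) auto
  also have "\<dots> = (\<integral>\<^sup>+x. \<integral>\<^sup>+v. F (step x v) \<partial>\<mu>U \<partial>law k)"
    unfolding d by (subst \<mu>U.nn_integral_fst[symmetric]) auto
  finally show ?thesis .
qed

text \<open>\<open>poisson_process\<close> prescribes the laws of increments over intervals of
  positive length, so the law of \<open>N t\<close> is read off from the increment after 0, where
  \<open>N 0 = 0\<close> almost surely.\<close>

lemma emeasure_N:
  assumes t: "0 < t"
  shows "emeasure M {\<omega>\<in>space M. N t \<omega> = k} = ennreal (poisson_weight t k)"
proof -
  have [measurable]: "N t \<in> M \<rightarrow>\<^sub>M count_space UNIV" "N 0 \<in> M \<rightarrow>\<^sub>M count_space UNIV"
    using t by auto
  have N0: "AE \<omega> in M. N 0 \<omega> = 0"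
    and d: "distr M (count_space UNIV) (\<lambda>\<omega>. N t \<omega> - N 0 \<omega>) = measure_pmf (poisson_pmf t)"
    using poisson t unfolding poisson_process_def by auto
  have "emeasure M {\<omega>\<in>space M. N t \<omega> = k} = emeasure M {\<omega>\<in>space M. N t \<omega> - N 0 \<omega> = k}"
    using N0 by (intro emeasure_eq_AE) auto
  also have "\<dots> = emeasure (distr M (count_space UNIV) (\<lambda>\<omega>. N t \<omega> - N 0 \<omega>)) {k}"
    by (subst emeasure_distr) (auto intro!: arg_cong[where f = "emeasure M"])
  also have "\<dots> = ennreal (poisson_weight t k)"
    unfolding d using t by (simp add: emeasure_pmf_single poisson_weight_def)
  finally show ?thesis .
qed

text \<open>The clock is independent of each \<open>X k\<close>; the random index is resolved by
  summing over the events \<open>N t = k\<close>, which makes the law at time \<open>t\<close> a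
  Poisson mixture.\<close>

lemma nn_integral_poissonized:
  assumes t: "0 < t" and [measurable]: "F \<in> borel_measurable borel"
  shows "(\<integral>\<^sup>+x. F x \<partial>distr M borel (Y t)) = (\<Sum>k. ennreal (poisson_weight t k) * (\<integral>\<^sup>+x. F x \<partial>law k))"
proof -
  have Nt [measurable]: "N t \<in> M \<rightarrow>\<^sub>M count_space UNIV" using t by auto
  have one: "(\<integral>\<^sup>+\<omega>. indicator {k} (N t \<omega>) * F (X k \<omega>) \<partial>M)
      = ennreal (poisson_weight t k) * (\<integral>\<^sup>+x. F x \<partial>law k)" for k
  proof -
    have d: "distr M (count_space UNIV \<Otimes>\<^sub>M borel) (\<lambda>\<omega>. (N t \<omega>, X k \<omega>))
        = distr M (count_space UNIV) (N t) \<Otimes>\<^sub>M law k"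
      using t by (intro distr_Pair_src[of "{Clock}" "insert Init (Batch ` {..<k})"] X_src N_src) auto
    interpret L: prob_space "law k" by (rule M.prob_space_distr) simp
    have [measurable]: "(\<lambda>(n, x). indicator {k} n * F x) \<in> borel_measurable (count_space UNIV \<Otimes>\<^sub>M borel)"
      unfolding split_beta
      by (intro borel_measurable_times_ennreal measurable_compose[OF measurable_fst]
          measurable_compose[OF measurable_snd]) auto
    have "(\<integral>\<^sup>+\<omega>. indicator {k} (N t \<omega>) * F (X k \<omega>) \<partial>M)
        = (\<integral>\<^sup>+p. (case p of (n, x) \<Rightarrow> indicator {k} n * F x)
            \<partial>distr M (count_space UNIV \<Otimes>\<^sub>M borel) (\<lambda>\<omega>. (N t \<omega>, X k \<omega>)))"
      by (subst nn_integral_distr) auto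
    also have "\<dots> = (\<integral>\<^sup>+n. \<integral>\<^sup>+x. indicator {k} n * F x \<partial>law k \<partial>distr M (count_space UNIV) (N t))"
      unfolding d by (subst L.nn_integral_fst[symmetric]) auto
    also have "\<dots> = (\<integral>\<^sup>+n. indicator {k} n * (\<integral>\<^sup>+x. F x \<partial>law k) \<partial>distr M (count_space UNIV) (N t))"
      by (simp add: nn_integral_cmult)
    also have "\<dots> = emeasure (distr M (count_space UNIV) (N t)) {k} * (\<integral>\<^sup>+x. F x \<partial>law k)"
      by (subst nn_integral_multc) auto
    also have "emeasure (distr M (count_space UNIV) (N t)) {k} = emeasure M {\<omega>\<in>space M. N t \<omega> = k}"
      by (subst emeasure_distr) (auto intro!: arg_cong[where f = "emeasure M"])
    finally show ?thesis by (simp add: emeasure_N[OF t])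
  qed
  have "(\<integral>\<^sup>+x. F x \<partial>distr M borel (Y t)) = (\<integral>\<^sup>+\<omega>. F (X (N t \<omega>) \<omega>) \<partial>M)"
    using Y_measurable[of t] t by (subst nn_integral_distr) (auto simp: poissonized_def)
  also have "\<dots> = (\<integral>\<^sup>+\<omega>. (\<Sum>k. indicator {k} (N t \<omega>) * F (X k \<omega>)) \<partial>M)"
  proof (rule nn_integral_cong)
    fix \<omega>
    have "(\<Sum>k. indicator {k} (N t \<omega>) * F (X k \<omega>)) = (\<Sum>k\<in>{N t \<omega>}. indicator {k} (N t \<omega>) * F (X k \<omega>))"
      by (rule suminf_finite) auto
    then show "F (X (N t \<omega>) \<omega>) = (\<Sum>k. indicator {k} (N t \<omega>) * F (X k \<omega>))" by simp
  qed
  also have "\<dots> = (\<Sum>k. \<integral>\<^sup>+\<omega>. indicator {k} (N t \<omega>) * F (X k \<omega>) \<partial>M)"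
    by (intro nn_integral_suminf borel_measurable_times_ennreal measurable_compose[OF Nt]
        measurable_compose[OF X_measurable]) auto
  finally show ?thesis by (simp add: one)
qed

text \<open>Conditioning on the time of the last jump before \<open>T\<close>.\<close>

lemma renewal:
  assumes T: "0 < T" and [measurable]: "F \<in> borel_measurable borel"
  shows "(\<integral>\<^sup>+x. F x \<partial>distr M borel (Y T)) = ennreal (exp (- T)) * (\<integral>\<^sup>+x. F x \<partial>\<mu>0)
     + (\<integral>\<^sup>+r\<in>{0..T}. ennreal (exp (- (T - r))) *
          (\<Sum>k. ennreal (poisson_weight r k) * (\<integral>\<^sup>+x. \<integral>\<^sup>+v. F (step x v) \<partial>\<mu>U \<partial>law k)) \<partial>lborel)"
proof -
  let ?L = "\<lambda>k. \<integral>\<^sup>+x. F x \<partial>law k"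
  have "(\<integral>\<^sup>+x. F x \<partial>distr M borel (Y T)) = (\<Sum>k. ennreal (poisson_weight T k) * ?L k)"
    by (rule nn_integral_poissonized) fact+
  also have "\<dots> = ennreal (poisson_weight T 0) * ?L 0 + (\<Sum>k. ennreal (poisson_weight T (Suc k)) * ?L (Suc k))"
    using suminf_offset[OF summableI, of "\<lambda>k. ennreal (poisson_weight T k) * ?L k" 1] by (simp add: add.commute)
  also have "(\<Sum>k. ennreal (poisson_weight T (Suc k)) * ?L (Suc k))
      = (\<Sum>k. \<integral>\<^sup>+r\<in>{0..T}. ennreal (exp (- (T - r))) * (ennreal (poisson_weight r k) * ?L (Suc k)) \<partial>lborel)"
    using T
    by (intro suminf_cong, unfold poisson_weight_Suc[OF less_imp_le], subst nn_integral_multc[symmetric])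
      (auto intro!: nn_integral_cong simp: ac_simps)
  also have "\<dots> = (\<integral>\<^sup>+r. (\<Sum>k. ennreal (exp (- (T - r))) * (ennreal (poisson_weight r k) * ?L (Suc k)) * indicator {0..T} r) \<partial>lborel)"
    by (rule nn_integral_suminf[symmetric]) measurable
  also have "\<dots> = (\<integral>\<^sup>+r\<in>{0..T}. ennreal (exp (- (T - r))) * (\<Sum>k. ennreal (poisson_weight r k) * ?L (Suc k)) \<partial>lborel)"
    by (simp only: ennreal_suminf_multc ennreal_suminf_cmult)
  finally show ?thesis
    by (simp only: law_0 nn_integral_law_Suc[OF assms(2)] poisson_weight_0)
qed

end


subsection \<open>One step against the Ornstein-Uhlenbeck step\<close>

lemma ennreal_sqrt_square: "(ennreal_sqrt x)\<^sup>2 = x"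
  by (cases x) (auto simp: ennreal_sqrt_def ennreal_power top_power_ennreal)

lemma ennreal_sqrt_measurable [measurable]: "ennreal_sqrt \<in> borel_measurable borel"
  unfolding ennreal_sqrt_def by measurable

lemma ennreal_square_le_imp_le:
  fixes x :: ennreal
  assumes "x\<^sup>2 \<le> (ennreal y)\<^sup>2" "0 \<le> y" shows "x \<le> ennreal y"
proof (cases x)
  case (real r)
  then have "ennreal (r\<^sup>2) \<le> ennreal (y\<^sup>2)" using assms by (simp add: ennreal_power)
  then have "r\<^sup>2 \<le> y\<^sup>2" by simp
  then have "r \<le> y" using assms(2) by (rule power2_le_imp_le)
  then show ?thesis unfolding real(2) by (rule ennreal_leI)
next
  case top
  then show ?thesis using assms by (simp add: top_power_ennreal ennreal_power top_unique)
qed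

lemma ennreal_half_eq:
  assumes "2 * z = ennreal x" shows "z = ennreal (x / 2)"
proof (cases z)
  case (real y)
  then have "ennreal (2 * y) = ennreal x" using assms by (simp add: ennreal_mult')
  then have "2 * y = x \<or> (y = 0 \<and> x \<le> 0)"
    using real(1) by (cases "0 \<le> x") (auto simp: ennreal_neg)
  then show ?thesis using real by (auto simp: ennreal_neg)
next
  case top
  then show ?thesis using assms by simp
qed

lemma nn_integral_mult_le:
  assumes [measurable]: "f \<in> borel_measurable M" "g \<in> borel_measurable M"
    and f: "(\<integral>\<^sup>+x. (f x)\<^sup>2 \<partial>M) \<le> ennreal (p\<^sup>2)" and g: "(\<integral>\<^sup>+x. (g x)\<^sup>2 \<partial>M) \<le> ennreal (q\<^sup>2)"
    and pq: "0 \<le> p" "0 \<le> q"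
  shows "(\<integral>\<^sup>+x. f x * g x \<partial>M) \<le> ennreal (p * q)"
proof (rule ennreal_square_le_imp_le)
  have "(\<integral>\<^sup>+x. f x * g x \<partial>M)\<^sup>2 \<le> (\<integral>\<^sup>+x. (f x)\<^sup>2 \<partial>M) * (\<integral>\<^sup>+x. (g x)\<^sup>2 \<partial>M)"
    by (rule Cauchy_Schwarz_nn_integral) measurable
  also have "\<dots> \<le> ennreal (p\<^sup>2) * ennreal (q\<^sup>2)" by (intro mult_mono f g) auto
  also have "\<dots> = (ennreal (p * q))\<^sup>2"
    using pq by (simp add: ennreal_power ennreal_mult'[symmetric] power_mult_distrib)
  finally show "(\<integral>\<^sup>+x. f x * g x \<partial>M)\<^sup>2 \<le> (ennreal (p * q))\<^sup>2" .
qed (use pq in simp)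

context gaussian
begin

text \<open>Symmetry of \<open>G\<close> cancels the cross term.\<close>

lemma nn_integral_G_norm_sq_shift:
  "(\<integral>\<^sup>+z. ennreal ((norm (p + s *\<^sub>R z))\<^sup>2) \<partial>G) = ennreal ((norm p)\<^sup>2 + s\<^sup>2 * (real DIM('a) * \<sigma>\<^sup>2))"
proof -
  let ?I = "\<integral>\<^sup>+z. ennreal ((norm (p + s *\<^sub>R z))\<^sup>2) \<partial>G"
  have "?I + ?I = ?I + (\<integral>\<^sup>+z. ennreal ((norm (p + s *\<^sub>R (- z)))\<^sup>2) \<partial>G)"
    using nn_integral_G_uminus[of "\<lambda>z. ennreal ((norm (p + s *\<^sub>R z))\<^sup>2)"] by simp
  also have "\<dots> = (\<integral>\<^sup>+z. ennreal ((norm (p + s *\<^sub>R z))\<^sup>2) + ennreal ((norm (p + s *\<^sub>R (- z)))\<^sup>2) \<partial>G)"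
    by (rule nn_integral_add[symmetric]) auto
  also have "\<dots> = (\<integral>\<^sup>+z. ennreal (2 * (norm p)\<^sup>2) + ennreal (2 * s\<^sup>2) * ennreal ((norm z)\<^sup>2) \<partial>G)"
  proof (rule nn_integral_cong)
    fix z :: 'a
    have "(norm (p + s *\<^sub>R z))\<^sup>2 + (norm (p + s *\<^sub>R (- z)))\<^sup>2 = 2 * (norm p)\<^sup>2 + 2 * s\<^sup>2 * (norm z)\<^sup>2"
      unfolding power2_norm_eq_inner
      by (simp add: inner_add_left inner_add_right inner_diff_left inner_diff_right inner_commute[of z p]
          power2_eq_square algebra_simps)
    then show "ennreal ((norm (p + s *\<^sub>R z))\<^sup>2) + ennreal ((norm (p + s *\<^sub>R (- z)))\<^sup>2)
        = ennreal (2 * (norm p)\<^sup>2) + ennreal (2 * s\<^sup>2) * ennreal ((norm z)\<^sup>2)"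
      by (simp add: ennreal_plus[symmetric] ennreal_mult'[symmetric] del: ennreal_plus)
  qed
  also have "\<dots> = ennreal (2 * (norm p)\<^sup>2) + ennreal (2 * s\<^sup>2) * ennreal (real DIM('a) * \<sigma>\<^sup>2)"
    by (simp add: nn_integral_add nn_integral_cmult nn_integral_G_norm_sq G.emeasure_space_1[simplified])
  also have "\<dots> = ennreal (2 * ((norm p)\<^sup>2 + s\<^sup>2 * (real DIM('a) * \<sigma>\<^sup>2)))"
    by (simp add: ennreal_plus[symmetric] ennreal_mult'[symmetric] algebra_simps del: ennreal_plus)
  finally have "2 * ?I = ennreal (2 * ((norm p)\<^sup>2 + s\<^sup>2 * (real DIM('a) * \<sigma>\<^sup>2)))" by (simp only: mult_2)
  moreover have "2 * y / 2 = y" for y :: real by simp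
  ultimately show ?thesis by (metis ennreal_half_eq)
qed

end

locale langevin = gaussian \<sigma> G + sgd_chain M G \<mu>U X0 U N \<eta> lam g
  for \<sigma> and G :: "'a::euclidean_space measure" and M :: "'w measure" and \<mu>U :: "'u measure"
    and X0 U N \<eta> lam g +
  fixes a b :: real
  assumes eta_pos: "0 < \<eta>" and lam_pos: "0 < lam" and contraction: "lam * \<eta> < 1"
    and a_pos: "0 < a" and b_pos: "0 < b"
begin

definition r where "r = 1 - lam * \<eta>"
definition s where "s = sqrt (1 - r\<^sup>2)"

lemma r_bounds: "0 < r" "r < 1"
  using eta_pos lam_pos contraction by (auto simp: r_def)

lemma s_bounds: "0 \<le> s" "s\<^sup>2 \<le> 2 * (lam * \<eta>)"
proof -
  have "0 \<le> 1 - r\<^sup>2" using r_bounds by (simp add: power_le_one)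
  moreover have "1 - r\<^sup>2 = 2 * (lam * \<eta>) - (lam * \<eta>)\<^sup>2" by (simp add: r_def power2_eq_square algebra_simps)
  ultimately show "0 \<le> s" "s\<^sup>2 \<le> 2 * (lam * \<eta>)" by (auto simp: s_def)
qed

text \<open>The integrand of \<open>entropy_bound\<close> enlarged by 3/2. This factor dominates
  \<open>sqrt 2\<close> and is the inverse of the 2/3 that the PAC-Bayesian bound leaves in front of
  the entropy.\<close>

definition err :: "ennreal \<Rightarrow> ennreal \<Rightarrow> ennreal" where
  "err n m = ennreal (3 / 2) * (n * (ennreal a * n + ennreal a * m + ennreal b))"

text \<open>In \<open>ennreal\<close>, \<open>0 * \<infinity> = 0\<close>. The term
  \<open>\<sigma>\<^sup>2 * lam * \<eta> * d\<close> keeps the first factor of the error away from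
  0, so that infinite moments do make the error infinite.\<close>

lemma step_size_nonzero: "step_size \<eta> lam \<sigma> g \<mu>U \<rho> \<noteq> 0"
proof
  assume "step_size \<eta> lam \<sigma> g \<mu>U \<rho> = 0"
  then have "(step_size \<eta> lam \<sigma> g \<mu>U \<rho>)\<^sup>2 = 0" by simp
  moreover have "0 < \<sigma>\<^sup>2 * lam * \<eta> * real DIM('a)"
    using sigma_pos lam_pos eta_pos by simp
  ultimately show False
    by (simp add: step_size_def ennreal_sqrt_square ennreal_eq_0_iff)
qed

lemma err_infinite: "n \<noteq> 0 \<Longrightarrow> n = \<infinity> \<or> m = \<infinity> \<Longrightarrow> err n m = \<infinity>"
  using a_pos b_pos
  by (auto simp: err_def ennreal_mult_eq_top_iff ennreal_eq_0_iff ennreal_mult_top ennreal_top_mult)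

text \<open>Both steps start from the same \<open>x\<close>, with Gaussian noise \<open>z\<close>
  independent of the batch \<open>u\<close>. They differ by \<open>- (\<eta> g + s z)\<close>, of
  size \<open>D\<close>, and their mean norm is at most \<open>B1 + B2\<close>, where
  \<open>B1\<close> is \<open>norm x\<close> and \<open>B2\<close> the mean of
  \<open>norm (\<eta> g)\<close> and \<open>norm (s z)\<close>. Cauchy-Schwarz then treats the three
  products separately. Adding \<open>C\<close> makes the integrands non-negative.\<close>

lemma step_compare:
  assumes \<rho>: "prob_space \<rho>" "sets \<rho> = sets borel"
    and f: "f \<in> borel_measurable borel" "\<And>x. \<bar>f x\<bar> \<le> C"
    and growth: "\<And>x y. \<bar>f x - f y\<bar> \<le> norm (x - y) * (a * ((norm x + norm y) / 2) + b)"
  shows "(\<integral>\<^sup>+x. \<integral>\<^sup>+v. ennreal (f (step x v) + C) \<partial>\<mu>U \<partial>\<rho>)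
     \<le> (\<integral>\<^sup>+x. ennreal (ou (r\<^sup>2) f x + C) \<partial>\<rho>) + err (step_size \<eta> lam \<sigma> g \<mu>U \<rho>) (moment_size \<rho>)"
proof -
  interpret \<rho>: prob_space \<rho> by fact
  have [measurable_cong]: "sets \<rho> = sets borel" by fact
  have [measurable]: "f \<in> borel_measurable borel" by fact
  interpret RU: pair_prob_space \<rho> \<mu>U ..
  let ?Q = "(\<rho> \<Otimes>\<^sub>M \<mu>U) \<Otimes>\<^sub>M G"
  let ?n = "step_size \<eta> lam \<sigma> g \<mu>U \<rho>" and ?m = "moment_size \<rho>"
  define I where "I = (\<integral>\<^sup>+(x, u). ennreal ((norm (g x u))\<^sup>2) \<partial>(\<rho> \<Otimes>\<^sub>M \<mu>U))"
  define nsq where "nsq = ennreal (\<eta>\<^sup>2) * I + ennreal (\<sigma>\<^sup>2 * lam * \<eta> * real DIM('a))"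
  have n_sq: "?n\<^sup>2 = nsq" by (simp add: step_size_def ennreal_sqrt_square nsq_def I_def)
  have m_sq: "?m\<^sup>2 = 2 * (\<integral>\<^sup>+x. ennreal ((norm x)\<^sup>2) \<partial>\<rho>)"
    by (simp add: moment_size_def ennreal_sqrt_square)
  have pos: "0 < \<sigma>\<^sup>2 * lam * \<eta> * real DIM('a)"
    using sigma_pos lam_pos eta_pos by simp
  show ?thesis
  proof (cases "?n = \<infinity> \<or> ?m = \<infinity>")
    case True
    then have "err ?n ?m = \<infinity>" by (rule err_infinite[OF step_size_nonzero])
    then show ?thesis by simp
  next
    case False
    then obtain n m where n: "?n = ennreal n" "0 \<le> n" and m: "?m = ennreal m" "0 \<le> m"
      by (metis ennreal_cases infinity_ennreal_def)
    have nsq: "nsq = ennreal (n\<^sup>2)" using n_sq n by (simp add: ennreal_power)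
    define D where "D p = ennreal (norm (\<eta> *\<^sub>R g (fst (fst p)) (snd (fst p)) + s *\<^sub>R snd p))" for p :: "('a \<times> 'u) \<times> 'a"
    define B1 where "B1 p = ennreal (norm (fst (fst p)))" for p :: "('a \<times> 'u) \<times> 'a"
    define B2 where "B2 p = ennreal ((norm (\<eta> *\<^sub>R g (fst (fst p)) (snd (fst p))) + norm (s *\<^sub>R snd p)) / 2)" for p :: "('a \<times> 'u) \<times> 'a"
    have [measurable]: "D \<in> borel_measurable ?Q" "B1 \<in> borel_measurable ?Q" "B2 \<in> borel_measurable ?Q"
      unfolding D_def B1_def B2_def by measurable
    have emeasure_Q: "emeasure ?Q (space ?Q) = 1"
    proof -
      interpret Q: pair_prob_space "\<rho> \<Otimes>\<^sub>M \<mu>U" G ..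
      show ?thesis by (rule Q.P.emeasure_space_1)
    qed
    have Q_iter: "(\<integral>\<^sup>+p. F p \<partial>?Q) = (\<integral>\<^sup>+q. \<integral>\<^sup>+z. F (q, z) \<partial>G \<partial>(\<rho> \<Otimes>\<^sub>M \<mu>U))"
      if "F \<in> borel_measurable ?Q" for F
      using that by (rule G.nn_integral_fst[symmetric])
    have gI: "(\<integral>\<^sup>+q. ennreal ((norm (\<eta> *\<^sub>R g (fst q) (snd q)))\<^sup>2) \<partial>(\<rho> \<Otimes>\<^sub>M \<mu>U)) = ennreal (\<eta>\<^sup>2) * I"
    proof -
      have "(\<integral>\<^sup>+q. ennreal ((norm (\<eta> *\<^sub>R g (fst q) (snd q)))\<^sup>2) \<partial>(\<rho> \<Otimes>\<^sub>M \<mu>U))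
          = (\<integral>\<^sup>+q. ennreal (\<eta>\<^sup>2) * ennreal ((norm (g (fst q) (snd q)))\<^sup>2) \<partial>(\<rho> \<Otimes>\<^sub>M \<mu>U))"
        by (simp add: power_mult_distrib ennreal_mult')
      also have "\<dots> = ennreal (\<eta>\<^sup>2) * I"
        unfolding I_def split_beta by (rule nn_integral_cmult) measurable
      finally show ?thesis .
    qed
    have s_le: "s\<^sup>2 * (real DIM('a) * \<sigma>\<^sup>2) \<le> 2 * (\<sigma>\<^sup>2 * lam * \<eta> * real DIM('a))"
      using mult_right_mono[OF s_bounds(2), of "real DIM('a) * \<sigma>\<^sup>2"] by (simp add: ac_simps)
    have double_le: "x \<le> 2 * x" for x :: ennreal
      unfolding mult_2 by (rule add_increasing) auto
    \<comment> \<open>The noise contributes \<open>s\<^sup>2 * \<sigma>\<^sup>2 * d\<close>, at most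
      twice the last term of \<open>nsq\<close>; the gradient term is doubled to match. This is the
      source of \<open>sqrt 2\<close>.\<close>
    have D_sq: "(\<integral>\<^sup>+p. (D p)\<^sup>2 \<partial>?Q) \<le> ennreal ((sqrt 2 * n)\<^sup>2)"
    proof -
      have "(\<integral>\<^sup>+p. (D p)\<^sup>2 \<partial>?Q)
          = (\<integral>\<^sup>+q. ennreal ((norm (\<eta> *\<^sub>R g (fst q) (snd q)))\<^sup>2 + s\<^sup>2 * (real DIM('a) * \<sigma>\<^sup>2)) \<partial>(\<rho> \<Otimes>\<^sub>M \<mu>U))"
        by (subst Q_iter) (simp_all add: D_def split_beta ennreal_power nn_integral_G_norm_sq_shift)
      also have "\<dots> = ennreal (\<eta>\<^sup>2) * I + ennreal (s\<^sup>2 * (real DIM('a) * \<sigma>\<^sup>2))"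
        by (simp add: ennreal_plus nn_integral_add gI RU.P.emeasure_space_1 del: norm_scaleR)
      also have "\<dots> \<le> 2 * (ennreal (\<eta>\<^sup>2) * I) + ennreal (2 * (\<sigma>\<^sup>2 * lam * \<eta> * real DIM('a)))"
        by (intro add_mono double_le ennreal_leI s_le)
      also have "\<dots> = 2 * nsq"
        using pos by (simp add: nsq_def distrib_left ennreal_mult')
      also have "\<dots> = ennreal ((sqrt 2 * n)\<^sup>2)"
        by (simp add: nsq power_mult_distrib ennreal_mult')
      finally show ?thesis .
    qed
    \<comment> \<open>\<open>moment_size\<close> has a factor 2 under its root, hence
      \<open>m / sqrt 2\<close>; in the product with \<open>D\<close> it cancels the
      \<open>sqrt 2\<close>.\<close>
    have B1_sq: "(\<integral>\<^sup>+p. (B1 p)\<^sup>2 \<partial>?Q) \<le> ennreal ((m / sqrt 2)\<^sup>2)"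
    proof -
      have "(\<integral>\<^sup>+p. (B1 p)\<^sup>2 \<partial>?Q) = (\<integral>\<^sup>+q. ennreal ((norm (fst q))\<^sup>2) \<partial>(\<rho> \<Otimes>\<^sub>M \<mu>U))"
        by (subst Q_iter) (simp_all add: B1_def split_beta ennreal_power G.emeasure_space_1[simplified])
      also have "\<dots> = (\<integral>\<^sup>+x. ennreal ((norm x)\<^sup>2) \<partial>\<rho>)"
        by (subst \<mu>U.nn_integral_fst[symmetric]) (auto simp: \<mu>U.emeasure_space_1)
      finally have "2 * (\<integral>\<^sup>+p. (B1 p)\<^sup>2 \<partial>?Q) = ennreal (m\<^sup>2)"
        using m_sq m by (simp add: ennreal_power)
      from ennreal_half_eq[OF this] show ?thesis by (simp add: power_divide)
    qed
    \<comment> \<open>The square of a mean is at most the mean of the squares, and half of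
      \<open>s\<^sup>2 * \<sigma>\<^sup>2 * d\<close> fits under the noise term of
      \<open>nsq\<close>, so no extra factor arises.\<close>
    have B2_sq: "(\<integral>\<^sup>+p. (B2 p)\<^sup>2 \<partial>?Q) \<le> ennreal (n\<^sup>2)"
    proof -
      have am: "((x + y) / 2)\<^sup>2 \<le> x\<^sup>2 / 2 + y\<^sup>2 / 2" for x y :: real
        using zero_le_power2[of "x - y"] by (simp add: power2_eq_square field_simps)
      define h :: real where "h = 1 / 2"
      have h0: "0 \<le> h" by (simp add: h_def)
      have "(\<integral>\<^sup>+p. (B2 p)\<^sup>2 \<partial>?Q)
          \<le> (\<integral>\<^sup>+p. ennreal h * ennreal ((norm (\<eta> *\<^sub>R g (fst (fst p)) (snd (fst p))))\<^sup>2)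
               + ennreal h * (ennreal (s\<^sup>2) * ennreal ((norm (snd p))\<^sup>2)) \<partial>?Q)"
      proof (rule nn_integral_mono)
        fix p :: "('a \<times> 'u) \<times> 'a"
        let ?u = "norm (\<eta> *\<^sub>R g (fst (fst p)) (snd (fst p)))"
        have "(B2 p)\<^sup>2 = ennreal (((?u + norm (s *\<^sub>R snd p)) / 2)\<^sup>2)"
          by (simp add: B2_def ennreal_power del: norm_scaleR)
        also have "\<dots> \<le> ennreal (h * ?u\<^sup>2 + h * (s\<^sup>2 * (norm (snd p))\<^sup>2))"
          using am[of ?u "norm (s *\<^sub>R snd p)"]
          by (intro ennreal_leI) (simp add: h_def power_mult_distrib)
        also have "\<dots> = ennreal h * ennreal (?u\<^sup>2) + ennreal h * (ennreal (s\<^sup>2) * ennreal ((norm (snd p))\<^sup>2))"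
          using h0 by (simp add: ennreal_plus ennreal_mult' del: norm_scaleR)
        finally show "(B2 p)\<^sup>2 \<le> ennreal h * ennreal (?u\<^sup>2)
            + ennreal h * (ennreal (s\<^sup>2) * ennreal ((norm (snd p))\<^sup>2))" .
      qed
      also have "\<dots> = ennreal h * (ennreal (\<eta>\<^sup>2) * I)
          + ennreal h * (ennreal (s\<^sup>2) * ennreal (real DIM('a) * \<sigma>\<^sup>2))"
        by (subst Q_iter)
          (simp_all add: nn_integral_add nn_integral_cmult gI nn_integral_G_norm_sq
            G.emeasure_space_1[simplified] RU.P.emeasure_space_1 del: norm_scaleR)
      also have "\<dots> \<le> 1 * (ennreal (\<eta>\<^sup>2) * I) + ennreal (\<sigma>\<^sup>2 * lam * \<eta> * real DIM('a))"
      proof (intro add_mono mult_right_mono)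
        show "ennreal h \<le> 1" by (rule ennreal_le_1[THEN iffD2]) (simp add: h_def)
        have "ennreal h * (ennreal (s\<^sup>2) * ennreal (real DIM('a) * \<sigma>\<^sup>2)) = ennreal (h * (s\<^sup>2 * (real DIM('a) * \<sigma>\<^sup>2)))"
          using h0 by (simp add: ennreal_mult')
        also have "\<dots> \<le> ennreal (\<sigma>\<^sup>2 * lam * \<eta> * real DIM('a))"
          using s_le by (intro ennreal_leI) (simp add: h_def)
        finally show "ennreal h * (ennreal (s\<^sup>2) * ennreal (real DIM('a) * \<sigma>\<^sup>2))
            \<le> ennreal (\<sigma>\<^sup>2 * lam * \<eta> * real DIM('a))" .
      qed simp
      finally show ?thesis by (simp add: nsq_def[symmetric] nsq)
    qed
    have pw: "ennreal (f (step x u) + C)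
        \<le> ennreal (f (r *\<^sub>R x + s *\<^sub>R z) + C)
          + (ennreal a * (D ((x, u), z) * B1 ((x, u), z)) + ennreal a * (D ((x, u), z) * B2 ((x, u), z))
            + ennreal b * (D ((x, u), z) * 1))" for x u z
    proof -
      let ?d = "norm (\<eta> *\<^sub>R g x u + s *\<^sub>R z)"
      let ?b2 = "(norm (\<eta> *\<^sub>R g x u) + norm (s *\<^sub>R z)) / 2"
      have rx: "norm (r *\<^sub>R x) \<le> norm x"
        using r_bounds by (simp add: mult_left_le_one_le)
      have n1: "norm (step x u) \<le> norm x + norm (\<eta> *\<^sub>R g x u)"
        unfolding sgd_step_def r_def[symmetric]
        by (rule order_trans[OF norm_triangle_ineq4]) (intro add_mono rx order_refl)
      have n2: "norm (r *\<^sub>R x + s *\<^sub>R z) \<le> norm x + norm (s *\<^sub>R z)"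
        by (rule order_trans[OF norm_triangle_ineq]) (intro add_mono rx order_refl)
      have half: "(norm (step x u) + norm (r *\<^sub>R x + s *\<^sub>R z)) / 2 \<le> norm x + ?b2"
        using n1 n2 by argo
      have d: "norm (step x u - (r *\<^sub>R x + s *\<^sub>R z)) = ?d"
      proof -
        have "step x u - (r *\<^sub>R x + s *\<^sub>R z) = - (\<eta> *\<^sub>R g x u + s *\<^sub>R z)"
          by (simp add: sgd_step_def r_def)
        then show ?thesis by (simp only: norm_minus_cancel)
      qed
      have "f (step x u) - f (r *\<^sub>R x + s *\<^sub>R z)
          \<le> ?d * (a * ((norm (step x u) + norm (r *\<^sub>R x + s *\<^sub>R z)) / 2) + b)"
        using growth[of "step x u" "r *\<^sub>R x + s *\<^sub>R z"] by (simp add: d abs_le_iff)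
      also have "\<dots> \<le> ?d * (a * (norm x + ?b2) + b)"
        using a_pos by (intro mult_left_mono add_mono half order_refl) auto
      also have "\<dots> = a * (?d * norm x) + a * (?d * ?b2) + b * ?d" by (simp add: algebra_simps)
      finally have "f (step x u) + C \<le> (f (r *\<^sub>R x + s *\<^sub>R z) + C) + (a * (?d * norm x) + a * (?d * ?b2) + b * ?d)"
        by simp
      moreover have "0 \<le> f (r *\<^sub>R x + s *\<^sub>R z) + C" using f(2)[of "r *\<^sub>R x + s *\<^sub>R z"] by simp
      ultimately show ?thesis
        using a_pos b_pos
        by (simp add: D_def B1_def B2_def ennreal_mult'[symmetric] ennreal_plus[symmetric] ennreal_leI
            del: ennreal_plus norm_scaleR)
    qed
    have "(\<integral>\<^sup>+x. \<integral>\<^sup>+v. ennreal (f (step x v) + C) \<partial>\<mu>U \<partial>\<rho>)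
        = (\<integral>\<^sup>+p. ennreal (f (step (fst (fst p)) (snd (fst p))) + C) \<partial>?Q)"
      by (subst Q_iter) (simp_all add: \<mu>U.nn_integral_fst[symmetric] G.emeasure_space_1[simplified])
    also have "\<dots> \<le> (\<integral>\<^sup>+p. ennreal (f (r *\<^sub>R fst (fst p) + s *\<^sub>R snd p) + C)
          + (ennreal a * (D p * B1 p) + ennreal a * (D p * B2 p) + ennreal b * (D p * 1)) \<partial>?Q)"
      using pw by (intro nn_integral_mono) (metis prod.collapse)
    also have "\<dots> = (\<integral>\<^sup>+p. ennreal (f (r *\<^sub>R fst (fst p) + s *\<^sub>R snd p) + C) \<partial>?Q)
          + (ennreal a * (\<integral>\<^sup>+p. D p * B1 p \<partial>?Q) + ennreal a * (\<integral>\<^sup>+p. D p * B2 p \<partial>?Q)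
            + ennreal b * (\<integral>\<^sup>+p. D p * 1 \<partial>?Q))"
      by (simp add: nn_integral_add nn_integral_cmult)
    also have "\<dots> \<le> (\<integral>\<^sup>+x. ennreal (ou (r\<^sup>2) f x + C) \<partial>\<rho>) + err ?n ?m"
    proof (rule add_mono)
      have "(\<integral>\<^sup>+z. ennreal (f (r *\<^sub>R x + s *\<^sub>R z) + C) \<partial>G) = ennreal (ou (r\<^sup>2) f x + C)" for x
      proof -
        have i: "integrable G (\<lambda>z. f (r *\<^sub>R x + s *\<^sub>R z))"
          by (rule G.integrable_bdd[of _ C]) (auto simp: f)
        have "0 \<le> f y + C" for y using f(2)[of y] by simp
        then have "(\<integral>\<^sup>+z. ennreal (f (r *\<^sub>R x + s *\<^sub>R z) + C) \<partial>G) = ennreal (\<integral>z. f (r *\<^sub>R x + s *\<^sub>R z) + C \<partial>G)"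
          using i by (intro nn_integral_eq_integral) auto
        then show ?thesis using i r_bounds by (simp add: ou_def s_def G.prob_space[simplified])
      qed
      then show "(\<integral>\<^sup>+p. ennreal (f (r *\<^sub>R fst (fst p) + s *\<^sub>R snd p) + C) \<partial>?Q)
          \<le> (\<integral>\<^sup>+x. ennreal (ou (r\<^sup>2) f x + C) \<partial>\<rho>)"
        using bdd_borel_measurable[OF bdd_ou[OF bdd_borelI[OF f]], measurable]
        by (subst Q_iter, measurable, simp, subst \<mu>U.nn_integral_fst[symmetric])
          (auto simp: \<mu>U.emeasure_space_1)
      have "(\<integral>\<^sup>+p. D p * B1 p \<partial>?Q) \<le> ennreal (sqrt 2 * n * (m / sqrt 2))"
        by (intro nn_integral_mult_le D_sq B1_sq) (use n m in auto)
      moreover have "(\<integral>\<^sup>+p. D p * B2 p \<partial>?Q) \<le> ennreal (sqrt 2 * n * n)"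
        by (intro nn_integral_mult_le D_sq B2_sq) (use n m in auto)
      moreover have "(\<integral>\<^sup>+p. D p * 1 \<partial>?Q) \<le> ennreal (sqrt 2 * n * 1)"
        by (intro nn_integral_mult_le D_sq) (use n m emeasure_Q in auto)
      ultimately have "ennreal a * (\<integral>\<^sup>+p. D p * B1 p \<partial>?Q) + ennreal a * (\<integral>\<^sup>+p. D p * B2 p \<partial>?Q)
            + ennreal b * (\<integral>\<^sup>+p. D p * 1 \<partial>?Q)
          \<le> ennreal a * ennreal (sqrt 2 * n * (m / sqrt 2)) + ennreal a * ennreal (sqrt 2 * n * n)
            + ennreal b * ennreal (sqrt 2 * n * 1)"
        by (intro add_mono mult_left_mono) auto
      also have "\<dots> = ennreal (a * (n * m) + a * (sqrt 2 * n * n) + b * (sqrt 2 * n))"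
        using n m a_pos b_pos by (simp add: ennreal_mult'[symmetric] ennreal_plus[symmetric] del: ennreal_plus)
      also have "\<dots> \<le> ennreal (3 / 2 * (n * (a * n + a * m + b)))"
      proof (rule ennreal_leI)
        have s2: "sqrt 2 \<le> 3 / 2" by (rule real_le_lsqrt) (auto simp: power2_eq_square)
        have "sqrt 2 * (a * n * n) \<le> 3 / 2 * (a * n * n)" "sqrt 2 * (b * n) \<le> 3 / 2 * (b * n)"
          "1 * (a * n * m) \<le> 3 / 2 * (a * n * m)"
          using s2 n m a_pos b_pos by (intro mult_right_mono; simp)+
        then show "a * (n * m) + a * (sqrt 2 * n * n) + b * (sqrt 2 * n) \<le> 3 / 2 * (n * (a * n + a * m + b))"
          by (simp add: algebra_simps)
      qed
      also have "\<dots> = err ?n ?m"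
        using n m a_pos b_pos
        by (subst ennreal_mult', simp) (simp add: err_def ennreal_mult' ennreal_plus)
      finally show "ennreal a * (\<integral>\<^sup>+p. D p * B1 p \<partial>?Q) + ennreal a * (\<integral>\<^sup>+p. D p * B2 p \<partial>?Q)
            + ennreal b * (\<integral>\<^sup>+p. D p * 1 \<partial>?Q) \<le> err ?n ?m" .
    qed
    finally show ?thesis .
  qed
qed

end


subsection \<open>Entropy along the Poissonised chain\<close>

lemma nn_integral_exp_Icc:
  assumes "0 \<le> T" "c \<noteq> 0"
  shows "(\<integral>\<^sup>+r\<in>{0..T}. ennreal (exp (- c * (T - r))) \<partial>lborel) = ennreal ((1 - exp (- c * T)) / c)"
proof -
  have "(\<integral>\<^sup>+r\<in>{0..T}. ennreal (exp (- c * (T - r))) \<partial>lborel)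
      = ennreal (exp (- c * (T - T)) / c - exp (- c * (T - 0)) / c)"
  proof (rule nn_integral_FTC_Icc)
    show "((\<lambda>r. exp (- c * (T - r)) / c) has_real_derivative exp (- c * (T - r))) (at r)" for r
      using assms(2) by (auto intro!: derivative_eq_intros)
  qed (use assms in auto)
  then show ?thesis by (simp add: diff_divide_distrib)
qed

text \<open>The Poisson formulas hold for positive times and the entropy is controlled only before
  \<open>T\<close>; both endpoints are null.\<close>

lemma nn_integral_lborel_mono_open:
  fixes f g :: "real \<Rightarrow> ennreal"
  assumes "\<And>r. 0 < r \<Longrightarrow> r < T \<Longrightarrow> f r \<le> g r"
  shows "(\<integral>\<^sup>+r\<in>{0..T}. f r \<partial>lborel) \<le> (\<integral>\<^sup>+r\<in>{0..T}. g r \<partial>lborel)"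
proof (rule nn_integral_mono_AE)
  show "AE r in lborel. f r * indicator {0..T} r \<le> g r * indicator {0..T} r"
    using AE_lborel_singleton[of 0] AE_lborel_singleton[of T]
  proof eventually_elim
    case (elim r)
    then show ?case using assms[of r] by (auto split: split_indicator)
  qed
qed

section \<open>Integral inequality for the entropy along the chain\<close>

locale langevin_score = langevin \<sigma> G M \<mu>U X0 U N \<eta> lam g a b
  for \<sigma> and G :: "'a::euclidean_space measure" and M :: "'w measure" and \<mu>U :: "'u measure"
    and X0 U N \<eta> lam g a b +
  fixes h :: "real \<Rightarrow> 'a \<Rightarrow> real"
  assumes h_measurable: "\<And>t. 0 < t \<Longrightarrow> h t \<in> borel_measurable borel"
    and law_density: "\<And>t. 0 < t \<Longrightarrow> distr M borel (Y t) = density G (\<lambda>x. ennreal (exp (h t x)))"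
    and h_growth: "\<And>t x y. 0 < t \<Longrightarrow>
      \<bar>h t x - h t y\<bar> \<le> norm (x - y) * (a * ((norm x + norm y) / 2) + b)"
begin

abbreviation \<rho> :: "real \<Rightarrow> 'a measure" where "\<rho> t \<equiv> distr M borel (Y t)"

lemma prob_\<rho>: "0 \<le> t \<Longrightarrow> prob_space (\<rho> t)"
  by (intro M.prob_space_distr Y_measurable)

text \<open>The average of a sequence against the law of \<open>N t\<close>. Integrals over
  \<open>\<rho> t\<close> take this form, in which measurability in \<open>t\<close> is
  immediate.\<close>

definition poisson_mean :: "(nat \<Rightarrow> ennreal) \<Rightarrow> real \<Rightarrow> ennreal" where
  "poisson_mean L t = (\<Sum>k. ennreal (poisson_weight t k) * L k)"

lemma poisson_mean_measurable [measurable]: "poisson_mean L \<in> borel_measurable borel"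
  unfolding poisson_mean_def by measurable

lemma nn_integral_\<rho>:
  "0 < t \<Longrightarrow> F \<in> borel_measurable borel \<Longrightarrow> (\<integral>\<^sup>+x. F x \<partial>\<rho> t) = poisson_mean (\<lambda>k. \<integral>\<^sup>+x. F x \<partial>law k) t"
  by (simp add: nn_integral_poissonized poisson_mean_def)

text \<open>Equals the error term of \<open>\<rho> t\<close> for positive \<open>t\<close>, but is visibly measurable in \<open>t\<close>.\<close>

definition err_at :: "real \<Rightarrow> ennreal" where
  "err_at t = err
     (ennreal_sqrt (ennreal (\<eta>\<^sup>2) * poisson_mean (\<lambda>k. \<integral>\<^sup>+x. \<integral>\<^sup>+v. ennreal ((norm (g x v))\<^sup>2) \<partial>\<mu>U \<partial>law k) t
       + ennreal (\<sigma>\<^sup>2 * lam * \<eta> * real DIM('a))))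
     (ennreal_sqrt (2 * poisson_mean (\<lambda>k. \<integral>\<^sup>+x. ennreal ((norm x)\<^sup>2) \<partial>law k) t))"

lemma err_at_measurable [measurable]: "err_at \<in> borel_measurable borel"
  unfolding err_at_def err_def by measurable

lemma err_at_eq:
  assumes t: "0 < t"
  shows "err_at t = err (step_size \<eta> lam \<sigma> g \<mu>U (\<rho> t)) (moment_size (\<rho> t))"
proof -
  have "(\<integral>\<^sup>+(x, u). ennreal ((norm (g x u))\<^sup>2) \<partial>(\<rho> t \<Otimes>\<^sub>M \<mu>U))
      = (\<integral>\<^sup>+x. \<integral>\<^sup>+v. ennreal ((norm (g x v))\<^sup>2) \<partial>\<mu>U \<partial>\<rho> t)"
    by (subst \<mu>U.nn_integral_fst[symmetric]) auto
  then show ?thesis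
    using t by (simp add: err_at_def step_size_def moment_size_def nn_integral_\<rho>)
qed

text \<open>One pass of the integral inequality: bounds \<open>H\<close> at times before
  \<open>T\<close> produce the bound \<open>K\<close> at \<open>T\<close>. The test function is the
  truncated log-density at the final time, used unchanged at every earlier \<open>t\<close>, so only
  the growth of \<open>h T\<close> matters. Truncation is 1-Lipschitz and inherits that
  growth.\<close>

lemma entropy_recursion:
  assumes T: "0 < T" and H [measurable]: "H \<in> borel_measurable borel"
    and ent: "\<And>t. 0 < t \<Longrightarrow> t < T \<Longrightarrow> H t < \<infinity> \<Longrightarrow> ent_le (\<rho> t) (enn2real (H t))"
    and K: "(\<integral>\<^sup>+t\<in>{0..T}. ennreal (exp (- (T - t))) * (ennreal r * H t + err_at t) \<partial>lborel) \<le> ennreal K"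
    and K0: "0 \<le> K"
  shows "ent_le (\<rho> T) K"
proof (rule ent_le_clampI)
  show "prob_space (\<rho> T)" using T by (intro prob_\<rho>) auto
  show "\<rho> T = density G (\<lambda>x. ennreal (exp (h T x)))" by (rule law_density[OF T])
  show h [measurable]: "h T \<in> borel_measurable borel" by (rule h_measurable[OF T])
  interpret \<rho>T: prob_space "\<rho> T" by fact
  fix n :: nat
  define f where "f x = clamp_to n (h T x) - exp (- real n)" for x
  \<comment> \<open>The shift by \<open>C\<close> makes the integrands non-negative. It cancels at
    the end because \<open>exp (- T) * C + (1 - exp (- T)) * C = C\<close>.\<close>
  define C where "C = real n + 1"
  have f_measurable [measurable]: "f \<in> borel_measurable borel" unfolding f_def by measurable
  have f_le: "\<bar>f x\<bar> \<le> C" for x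
  proof -
    have "exp (- real n) \<le> 1" by simp
    then show ?thesis using abs_clamp_to[of n "h T x"] exp_gt_zero[of "- real n"]
      unfolding f_def C_def by linarith
  qed
  have f_pos: "0 \<le> f x + C" for x using f_le[of x] by simp
  have bdd_f: "bdd_borel f" by (rule bdd_borelI[OF f_measurable f_le])
  have normalized_f: "normalized f"
    unfolding f_def
    by (rule normalized_clamp[OF \<open>prob_space (\<rho> T)\<close> \<open>\<rho> T = density G (\<lambda>x. ennreal (exp (h T x)))\<close> h]) simp
  have growth: "\<bar>f x - f y\<bar> \<le> norm (x - y) * (a * ((norm x + norm y) / 2) + b)" for x y
    using clamp_to_diff[of n "h T x" "h T y"] h_growth[OF T, of x y] by (simp add: f_def)
  have bdd_nn: "(\<integral>\<^sup>+x. ennreal (F x + C) \<partial>\<mu>) = ennreal ((\<integral>x. F x \<partial>\<mu>) + C)"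
    if "prob_space \<mu>" "sets \<mu> = sets borel" "bdd_borel F" "\<And>x. 0 \<le> F x + C" for \<mu> and F :: "'a \<Rightarrow> real"
  proof -
    interpret prob_space \<mu> by fact
    have i: "integrable \<mu> F" by (rule integrable_bdd_borel) fact+
    then show ?thesis using that(4) by (subst nn_integral_eq_integral) (auto simp: prob_space)
  qed
  have ou_pos: "0 \<le> ou y f x + C" for y x
  proof -
    have "\<bar>ou y f x\<bar> \<le> C" unfolding ou_def by (rule G.abs_integral_le) (auto simp: f_le)
    then show ?thesis by simp
  qed
  have one_step: "poisson_mean (\<lambda>k. \<integral>\<^sup>+x. \<integral>\<^sup>+v. ennreal (f (step x v) + C) \<partial>\<mu>U \<partial>law k) t
      \<le> ennreal C + (ennreal r * H t + err_at t)" if t: "0 < t" "t < T" for t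
  proof (cases "H t < \<infinity>")
    case True
    have e: "ent_le (\<rho> t) (enn2real (H t))" using ent t True by blast
    have p: "prob_space (\<rho> t)" using t by (intro prob_\<rho>) auto
    have "poisson_mean (\<lambda>k. \<integral>\<^sup>+x. \<integral>\<^sup>+v. ennreal (f (step x v) + C) \<partial>\<mu>U \<partial>law k) t
        = (\<integral>\<^sup>+x. \<integral>\<^sup>+v. ennreal (f (step x v) + C) \<partial>\<mu>U \<partial>\<rho> t)"
      using t by (subst nn_integral_\<rho>) auto
    also have "\<dots> \<le> (\<integral>\<^sup>+x. ennreal (ou (r\<^sup>2) f x + C) \<partial>\<rho> t) + err_at t"
      unfolding err_at_eq[OF t(1)] by (rule step_compare[OF p _ f_measurable f_le growth]) simp
    also have "(\<integral>\<^sup>+x. ennreal (ou (r\<^sup>2) f x + C) \<partial>\<rho> t) = ennreal ((\<integral>x. ou (r\<^sup>2) f x \<partial>\<rho> t) + C)"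
      by (rule bdd_nn[OF p _ bdd_ou[OF bdd_f] ou_pos]) simp
    also have "\<dots> \<le> ennreal (r * enn2real (H t) + C)"
      using ent_le_ou[OF r_bounds p _ e bdd_f normalized_f] by (intro ennreal_leI) simp
    also have "\<dots> = ennreal C + ennreal r * H t"
      using r_bounds True by (simp add: C_def ennreal_plus ennreal_mult' add.commute add.left_commute)
    finally show ?thesis by (simp add: add.assoc)
  next
    case False
    then have "ennreal r * H t = \<infinity>" using r_bounds by (auto simp: ennreal_mult_eq_top_iff less_top[symmetric])
    then show ?thesis by simp
  qed
  have "ennreal ((\<integral>x. f x \<partial>\<rho> T) + C) = (\<integral>\<^sup>+x. ennreal (f x + C) \<partial>\<rho> T)"
    by (rule bdd_nn[symmetric]) (use bdd_f f_pos in \<open>auto intro: \<open>prob_space (\<rho> T)\<close>\<close>)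
  also have "\<dots> = ennreal (exp (- T)) * (\<integral>\<^sup>+x. ennreal (f x + C) \<partial>G)
     + (\<integral>\<^sup>+t\<in>{0..T}. ennreal (exp (- (T - t))) *
          poisson_mean (\<lambda>k. \<integral>\<^sup>+x. \<integral>\<^sup>+v. ennreal (f (step x v) + C) \<partial>\<mu>U \<partial>law k) t \<partial>lborel)"
    unfolding poisson_mean_def by (rule renewal[OF T]) measurable
  also have "\<dots> \<le> ennreal (exp (- T)) * ennreal C
     + (\<integral>\<^sup>+t\<in>{0..T}. ennreal (exp (- (T - t))) * (ennreal C + (ennreal r * H t + err_at t)) \<partial>lborel)"
  proof (intro add_mono mult_left_mono nn_integral_lborel_mono_open one_step)
    \<comment> \<open>The chain starts in \<open>G\<close>, where a normalized function has
      non-positive mean, so the event of no jump adds no entropy.\<close>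
    have "(\<integral>\<^sup>+x. ennreal (f x + C) \<partial>G) = ennreal ((\<integral>x. f x \<partial>G) + C)"
      by (rule bdd_nn) (use bdd_f f_pos G.prob_space_axioms in auto)
    also have "\<dots> \<le> ennreal C"
      using integral_normalized_le_0[OF integrable_G_bdd[OF bdd_f] normalized_f] by (intro ennreal_leI) simp
    finally show "(\<integral>\<^sup>+x. ennreal (f x + C) \<partial>G) \<le> ennreal C" .
  qed auto
  also have "(\<integral>\<^sup>+t\<in>{0..T}. ennreal (exp (- (T - t))) * (ennreal C + (ennreal r * H t + err_at t)) \<partial>lborel)
      = (\<integral>\<^sup>+t. ennreal C * (ennreal (exp (- 1 * (T - t))) * indicator {0..T} t)
          + ennreal (exp (- (T - t))) * (ennreal r * H t + err_at t) * indicator {0..T} t \<partial>lborel)"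
    by (intro nn_integral_cong) (simp add: algebra_simps)
  also have "\<dots> = ennreal C * ennreal ((1 - exp (- 1 * T)) / 1)
      + (\<integral>\<^sup>+t\<in>{0..T}. ennreal (exp (- (T - t))) * (ennreal r * H t + err_at t) \<partial>lborel)"
    using T by (subst nn_integral_add, measurable, subst nn_integral_cmult, measurable,
        subst nn_integral_exp_Icc) auto
  also have "ennreal (exp (- T)) * ennreal C + (ennreal C * ennreal ((1 - exp (- 1 * T)) / 1)
      + (\<integral>\<^sup>+t\<in>{0..T}. ennreal (exp (- (T - t))) * (ennreal r * H t + err_at t) \<partial>lborel))
      \<le> ennreal (exp (- T)) * ennreal C + (ennreal C * ennreal ((1 - exp (- 1 * T)) / 1) + ennreal K)"
    using K by (intro add_left_mono)
  also have "\<dots> = ennreal (C + K)"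
  proof -
    have "ennreal (exp (- T)) * ennreal C + (ennreal C * ennreal ((1 - exp (- 1 * T)) / 1) + ennreal K)
        = ennreal (exp (- T) * C + (C * (1 - exp (- T)) + K))"
      using T K0 by (simp add: C_def ennreal_plus ennreal_mult')
    then show ?thesis by (simp add: algebra_simps)
  qed
  finally have "ennreal ((\<integral>x. f x \<partial>\<rho> T) + C) \<le> ennreal (C + K)" .
  then have "(\<integral>x. f x \<partial>\<rho> T) + C \<le> C + K"
    by (subst (asm) ennreal_le_iff) (use K0 in \<open>simp_all add: C_def\<close>)
  moreover have "(\<integral>x. f x \<partial>\<rho> T) = (\<integral>x. clamp_to n (h T x) \<partial>\<rho> T) - exp (- real n)"
  proof -
    have "bdd_borel (\<lambda>x. clamp_to n (h T x))"
      by (rule bdd_borelI[of _ n]) (auto simp: abs_clamp_to)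
    then have "integrable (\<rho> T) (\<lambda>x. clamp_to n (h T x))"
      by (intro integrable_bdd_borel \<open>prob_space (\<rho> T)\<close>) auto
    then show ?thesis unfolding f_def using \<rho>T.prob_space by simp
  qed
  ultimately show "(\<integral>x. clamp_to n (h T x) \<partial>\<rho> T) \<le> K + exp (- real n)" by simp
qed

text \<open>Variation of constants for \<open>J' = - lam * \<eta> * J + err_at\<close> with
  \<open>J 0 = 0\<close>.\<close>

definition J :: "real \<Rightarrow> ennreal" where
  "J t = (\<integral>\<^sup>+s\<in>{0..t}. ennreal (exp (- (lam * \<eta>) * (t - s))) * err_at s \<partial>lborel)"

lemma J_measurable [measurable]: "J \<in> borel_measurable borel"
proof -
  have "(\<lambda>(t, s). ennreal (exp (- (lam * \<eta>) * (t - s))) * err_at s * indicator {0..t} s)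
      \<in> borel_measurable (borel \<Otimes>\<^sub>M lborel)"
    unfolding indicator_def atLeastAtMost_iff by measurable
  then show ?thesis unfolding J_def by measurable
qed

text \<open>\<open>J\<close> is a fixed point of the recursion. After exchanging the integrals the
  inner one is elementary: \<open>exp (- (T - t)) * exp (- c * (t - s))\<close> with
  \<open>c = lam * \<eta>\<close> has derivative \<open>1 - c = r\<close> times itself. Its lower
  boundary term \<open>exp (- (T - s))\<close> is restored by the direct \<open>err_at\<close>
  term.\<close>

lemma J_renewal:
  assumes T: "0 \<le> T"
  shows "(\<integral>\<^sup>+t\<in>{0..T}. ennreal (exp (- (T - t))) * (ennreal r * J t + err_at t) \<partial>lborel) = J T"
proof -
  let ?c = "lam * \<eta>"
  let ?K = "\<lambda>t s. ennreal (r * exp (- (T - t)) * exp (- ?c * (t - s))) * err_at s * indicator {0..t} s * indicator {0..T} t"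
  have [measurable]: "(\<lambda>(t, s). ?K t s) \<in> borel_measurable (lborel \<Otimes>\<^sub>M lborel)"
    unfolding indicator_def atLeastAtMost_iff by measurable
  have 1: "(\<integral>\<^sup>+t\<in>{0..T}. ennreal (exp (- (T - t))) * (ennreal r * J t) \<partial>lborel) = (\<integral>\<^sup>+t. \<integral>\<^sup>+s. ?K t s \<partial>lborel \<partial>lborel)"
  proof (rule nn_integral_cong)
    fix t :: real
    have "(\<integral>\<^sup>+s. ?K t s \<partial>lborel) = (\<integral>\<^sup>+s. (ennreal (exp (- (T - t))) * ennreal r * indicator {0..T} t) *
        (ennreal (exp (- ?c * (t - s))) * err_at s * indicator {0..t} s) \<partial>lborel)"
      using r_bounds by (intro nn_integral_cong) (simp add: ennreal_mult' ac_simps)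
    also have "\<dots> = (ennreal (exp (- (T - t))) * ennreal r * indicator {0..T} t) * J t"
      unfolding J_def by (rule nn_integral_cmult) measurable
    finally show "ennreal (exp (- (T - t))) * (ennreal r * J t) * indicator {0..T} t = (\<integral>\<^sup>+s. ?K t s \<partial>lborel)"
      by (simp add: ac_simps)
  qed
  have 2: "(\<integral>\<^sup>+t. ?K t s \<partial>lborel)
      = ennreal (exp (- ?c * (T - s)) - exp (- (T - s))) * err_at s * indicator {0..T} s" for s
  proof (cases "s \<in> {0..T}")
    case True
    have "(\<integral>\<^sup>+t. ?K t s \<partial>lborel)
        = (\<integral>\<^sup>+t. ennreal (r * exp (- (T - t)) * exp (- ?c * (t - s))) * indicator {s..T} t * err_at s \<partial>lborel)"
      using True by (intro nn_integral_cong) (auto split: split_indicator simp: ac_simps)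
    also have "\<dots> = (\<integral>\<^sup>+t. ennreal (r * exp (- (T - t)) * exp (- ?c * (t - s))) * indicator {s..T} t \<partial>lborel) * err_at s"
      by (rule nn_integral_multc) measurable
    also have "(\<integral>\<^sup>+t. ennreal (r * exp (- (T - t)) * exp (- ?c * (t - s))) * indicator {s..T} t \<partial>lborel)
        = ennreal (exp (- (T - T)) * exp (- ?c * (T - s)) - exp (- (T - s)) * exp (- ?c * (s - s)))"
    proof (rule nn_integral_FTC_Icc)
      show "((\<lambda>t. exp (- (T - t)) * exp (- ?c * (t - s))) has_real_derivative
          r * exp (- (T - t)) * exp (- ?c * (t - s))) (at t)" for t
        by (auto intro!: derivative_eq_intros simp: r_def algebra_simps)
    qed (use True r_bounds in auto)
    finally show ?thesis using True by simp
  next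
    case False
    then have "?K t s = 0" for t by (auto split: split_indicator)
    then have "(\<integral>\<^sup>+t. ?K t s \<partial>lborel) = (\<integral>\<^sup>+t. 0 \<partial>(lborel :: real measure))" by (simp only:)
    then show ?thesis using False by simp
  qed
  have "(\<integral>\<^sup>+t\<in>{0..T}. ennreal (exp (- (T - t))) * (ennreal r * J t + err_at t) \<partial>lborel)
      = (\<integral>\<^sup>+t. ennreal (exp (- (T - t))) * (ennreal r * J t) * indicator {0..T} t
          + ennreal (exp (- (T - t))) * err_at t * indicator {0..T} t \<partial>lborel)"
    by (intro nn_integral_cong) (simp add: algebra_simps)
  also have "\<dots> = (\<integral>\<^sup>+t\<in>{0..T}. ennreal (exp (- (T - t))) * (ennreal r * J t) \<partial>lborel)
      + (\<integral>\<^sup>+t\<in>{0..T}. ennreal (exp (- (T - t))) * err_at t \<partial>lborel)"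
    by (rule nn_integral_add) measurable
  also have "(\<integral>\<^sup>+t\<in>{0..T}. ennreal (exp (- (T - t))) * (ennreal r * J t) \<partial>lborel)
      = (\<integral>\<^sup>+s. \<integral>\<^sup>+t. ?K t s \<partial>lborel \<partial>lborel)"
    unfolding 1 by (rule lborel_pair.Fubini'[symmetric]) measurable
  also have "\<dots> = (\<integral>\<^sup>+s. ennreal (exp (- ?c * (T - s)) - exp (- (T - s))) * err_at s * indicator {0..T} s \<partial>lborel)"
    by (simp only: 2)
  also have "\<dots> + (\<integral>\<^sup>+t\<in>{0..T}. ennreal (exp (- (T - t))) * err_at t \<partial>lborel)
      = (\<integral>\<^sup>+s. ennreal (exp (- ?c * (T - s)) - exp (- (T - s))) * err_at s * indicator {0..T} s
          + ennreal (exp (- (T - s))) * err_at s * indicator {0..T} s \<partial>lborel)"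
    by (rule nn_integral_add[symmetric]) measurable
  also have "\<dots> = J T"
    unfolding J_def
  proof (rule nn_integral_cong)
    fix s :: real
    show "ennreal (exp (- ?c * (T - s)) - exp (- (T - s))) * err_at s * indicator {0..T} s
          + ennreal (exp (- (T - s))) * err_at s * indicator {0..T} s
        = ennreal (exp (- ?c * (T - s))) * err_at s * indicator {0..T} s"
    proof (cases "s \<in> {0..T}")
      case True
      have "?c * (T - s) \<le> 1 * (T - s)"
        using True contraction by (intro mult_right_mono) auto
      then have "0 \<le> exp (- ?c * (T - s)) - exp (- (T - s))" by simp
      then have "ennreal (exp (- ?c * (T - s)) - exp (- (T - s))) + ennreal (exp (- (T - s))) = ennreal (exp (- ?c * (T - s)))"
        by (subst ennreal_plus[symmetric]) auto
      then show ?thesis using True by (simp add: distrib_right[symmetric])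
    qed simp
  qed
  finally show ?thesis .
qed

text \<open>The discount may let \<open>J\<close> decrease, but between \<open>t\<close> and
  \<open>T\<close> by no more than the factor \<open>exp (lam * \<eta> * (T - t))\<close>.\<close>

lemma J_finite:
  assumes t: "t \<le> T" and J: "J T < \<infinity>" shows "J t < \<infinity>"
proof -
  let ?c = "lam * \<eta>"
  have "J t \<le> (\<integral>\<^sup>+s. ennreal (exp (?c * (T - t))) * (ennreal (exp (- ?c * (T - s))) * err_at s * indicator {0..T} s) \<partial>lborel)"
    unfolding J_def
  proof (rule nn_integral_mono)
    fix s
    have "ennreal (exp (?c * (T - t))) * ennreal (exp (- ?c * (T - s))) = ennreal (exp (- ?c * (t - s)))"
      by (simp add: ennreal_mult'[symmetric] exp_add[symmetric] algebra_simps)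
    then show "ennreal (exp (- ?c * (t - s))) * err_at s * indicator {0..t} s
        \<le> ennreal (exp (?c * (T - t))) * (ennreal (exp (- ?c * (T - s))) * err_at s * indicator {0..T} s)"
      using t by (auto simp: mult.assoc[symmetric] split: split_indicator)
  qed
  also have "\<dots> = ennreal (exp (?c * (T - t))) * J T"
    unfolding J_def by (rule nn_integral_cmult) measurable
  also have "\<dots> < \<infinity>" using J by (simp add: ennreal_mult_less_top)
  finally show ?thesis .
qed

text \<open>The Gronwall iteration needs some finite uniform bound to start from.\<close>

lemma entropy_a_priori:
  assumes T: "0 < T" and m: "(\<integral>\<^sup>+x. ennreal ((norm x)\<^sup>2) \<partial>\<rho> T) < \<infinity>"
  shows "\<exists>C. \<forall>t. 0 < t \<longrightarrow> t \<le> T \<longrightarrow> ent_le (\<rho> t) C"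
proof -
  have p: "prob_space (\<rho> T)" using T by (intro prob_\<rho>) auto
  interpret \<rho>T: prob_space "\<rho> T" by fact
  have h [measurable]: "h T \<in> borel_measurable borel" by (rule h_measurable[OF T])
  have sq: "integrable (\<rho> T) (\<lambda>x. (norm x)\<^sup>2)"
    using m by (intro integrableI_nonneg) auto
  define A where "A = \<bar>h T 0\<bar> + b"
  \<comment> \<open>Linear growth of the gradient gives quadratic growth of the log-density, so the
    finite second moment makes it integrable.\<close>
  have h_le: "\<bar>h T x\<bar> \<le> A + (a + b) * (norm x)\<^sup>2" for x
  proof -
    have "\<bar>h T x\<bar> \<le> \<bar>h T 0\<bar> + norm x * (a * (norm x / 2) + b)"
      using h_growth[OF T, of x 0] by simp
    moreover have "norm x * (a * (norm x / 2)) \<le> a * (norm x)\<^sup>2"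
      using a_pos by (simp add: power2_eq_square)
    moreover have "2 * norm x \<le> 1 + (norm x)\<^sup>2"
      using zero_le_power2[of "norm x - 1"] by (simp add: power2_eq_square algebra_simps)
    then have "norm x \<le> 1 + (norm x)\<^sup>2" using norm_ge_zero[of x] by linarith
    then have "b * norm x \<le> b * (1 + (norm x)\<^sup>2)" using b_pos by (intro mult_left_mono) auto
    ultimately show ?thesis by (simp add: A_def algebra_simps)
  qed
  have ih: "integrable (\<rho> T) (h T)"
    by (rule Bochner_Integration.integrable_bound[of _ "\<lambda>x. A + (a + b) * (norm x)\<^sup>2"])
      (use sq h_le in \<open>auto intro!: order_trans[OF h_le]\<close>)
  define C where "C = (\<integral>x. \<bar>h T x\<bar> \<partial>\<rho> T)"
  have entT: "ent_le (\<rho> T) C"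
  proof (rule ent_le_clampI[OF p law_density[OF T] h])
    fix n :: nat
    have "(\<integral>x. clamp_to n (h T x) \<partial>\<rho> T) \<le> C"
      unfolding C_def
    proof (rule integral_mono)
      show "integrable (\<rho> T) (\<lambda>x. clamp_to n (h T x))"
        by (rule \<rho>T.integrable_bdd[of _ n]) (auto simp: abs_clamp_to)
      show "clamp_to n (h T x) \<le> \<bar>h T x\<bar>" for x
        using abs_clamp_to_le[of n "h T x"] by simp
    qed (use ih in auto)
    then show "(\<integral>x. clamp_to n (h T x) \<partial>\<rho> T) \<le> C + exp (- real n)"
      by (simp add: add_increasing2)
  qed
  \<comment> \<open>Earlier laws are dominated:
    \<open>poisson_weight t k \<le> exp T * poisson_weight T k\<close>, so \<open>\<rho> t\<close>
    is at most \<open>exp T\<close> times \<open>\<rho> T\<close>. Domination respects only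
    non-negative integrands, and the passage from \<open>f\<close> to \<open>max 0 f\<close> costs
    \<open>ln 2\<close>, since the integral of \<open>exp (max 0 f)\<close> is at most
    \<open>1 + 1\<close>.\<close>
  have "ent_le (\<rho> t) (exp T * (C + ln 2))" if t: "0 < t" "t \<le> T" for t
    unfolding ent_le_def
  proof (intro allI impI)
    fix f assume f: "bdd_borel f" "normalized f"
    have [measurable]: "f \<in> borel_measurable borel" using f by (simp add: bdd_borel_measurable)
    have pt: "prob_space (\<rho> t)" using t by (intro prob_\<rho>) auto
    let ?F = "\<lambda>x. ennreal (max 0 (f x))"
    have "(\<integral>\<^sup>+x. ?F x \<partial>\<rho> t) \<le> (\<Sum>k. ennreal (exp T) * (ennreal (poisson_weight T k) * (\<integral>\<^sup>+x. ?F x \<partial>law k)))"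
    proof -
      have "poisson_weight t k \<le> exp T * poisson_weight T k" for k
      proof -
        have "t ^ k / fact k * exp (- t) \<le> T ^ k / fact k * 1"
          using t by (intro mult_mono divide_right_mono power_mono) auto
        moreover have "exp T * poisson_weight T k = T ^ k / fact k * (exp T * exp (- T))"
          by (simp add: poisson_weight_def)
        moreover have "exp T * exp (- T) = 1" by (simp flip: exp_add)
        ultimately show ?thesis by (simp only: poisson_weight_def)
      qed
      then have "ennreal (poisson_weight t k) \<le> ennreal (exp T) * ennreal (poisson_weight T k)" for k
        by (simp add: ennreal_mult'[symmetric] ennreal_leI)
      then show ?thesis
        using t by (subst nn_integral_poissonized)
          (auto intro!: suminf_le mult_right_mono simp: mult.assoc[symmetric])
    qed
    also have "\<dots> = ennreal (exp T) * (\<integral>\<^sup>+x. ?F x \<partial>\<rho> T)"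
      using T by (simp add: ennreal_suminf_cmult nn_integral_poissonized)
    also have "\<dots> \<le> ennreal (exp T) * ennreal (C + ln 2)"
    proof (intro mult_left_mono ent_le_nn_integral[OF p _ entT])
      have "(\<integral>\<^sup>+x. ennreal (exp (max 0 (f x))) \<partial>G) \<le> (\<integral>\<^sup>+x. 1 + ennreal (exp (f x)) \<partial>G)"
        by (intro nn_integral_mono) (auto simp: max_def ennreal_1[symmetric] ennreal_plus[symmetric]
            simp del: ennreal_plus ennreal_1 intro!: ennreal_leI)
      also have "\<dots> = 1 + (\<integral>\<^sup>+x. ennreal (exp (f x)) \<partial>G)"
        by (simp add: nn_integral_add G.emeasure_space_1[simplified])
      also have "\<dots> \<le> 1 + 1"
        using f(2) unfolding normalized_def by (rule add_left_mono)
      finally show "(\<integral>\<^sup>+x. ennreal (exp (max 0 (f x))) \<partial>G) \<le> ennreal 2" by simp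
    qed auto
    also have "\<dots> = ennreal (exp T * (C + ln 2))" by (simp add: ennreal_mult')
    finally have le: "(\<integral>\<^sup>+x. ?F x \<partial>\<rho> t) \<le> ennreal (exp T * (C + ln 2))" .
    obtain B where B: "0 \<le> B" "\<And>x. \<bar>f x\<bar> \<le> B" using f bdd_borel_bound by blast
    have b: "bdd_borel (\<lambda>x. max 0 (f x))" using B by (intro bdd_borelI[of _ B]) (auto simp: abs_le_iff max_def)
    have i: "integrable (\<rho> t) (\<lambda>x. max 0 (f x))" "integrable (\<rho> t) f"
      using pt b f by (auto intro!: integrable_bdd_borel)
    have "(\<integral>x. f x \<partial>\<rho> t) \<le> (\<integral>x. max 0 (f x) \<partial>\<rho> t)" using i by (intro integral_mono) auto
    also have "\<dots> \<le> exp T * (C + ln 2)"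
    proof -
      have "0 \<le> C" by (simp add: C_def)
      then show ?thesis using le i by (subst (asm) nn_integral_eq_integral) auto
    qed
    finally show "(\<integral>x. f x \<partial>\<rho> t) \<le> exp T * (C + ln 2)" .
  qed
  then show ?thesis by blast
qed

text \<open>Each pass of the recursion reproduces \<open>J\<close> and multiplies the excess over it
  by at most \<open>r\<close>, because \<open>exp (- (t - s))\<close> integrates to at most
  1.\<close>

lemma entropy_iterate:
  assumes T: "0 < T" and J: "J T < \<infinity>" and C0: "0 \<le> C"
    and C: "\<And>t. 0 < t \<Longrightarrow> t \<le> T \<Longrightarrow> ent_le (\<rho> t) C"
  shows "\<forall>t. 0 < t \<longrightarrow> t \<le> T \<longrightarrow> ent_le (\<rho> t) (enn2real (J t) + r ^ j * C)"
proof (induction j)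
  case 0
  show ?case
  proof (intro allI impI)
    fix t assume "0 < t" "t \<le> T"
    from C[OF this] show "ent_le (\<rho> t) (enn2real (J t) + r ^ 0 * C)"
      by (rule ent_le_mono) simp
  qed
next
  case (Suc j)
  show ?case
  proof (intro allI impI)
    fix t assume t: "0 < t" "t \<le> T"
    let ?D = "r ^ j * C"
    have D: "0 \<le> ?D" using r_bounds C0 by simp
    have Jt: "J t < \<infinity>" using J_finite[OF t(2) J] .
    show "ent_le (\<rho> t) (enn2real (J t) + r ^ Suc j * C)"
    proof (rule entropy_recursion[OF t(1), where H = "\<lambda>s. J s + ennreal ?D"])
      show "ent_le (\<rho> s) (enn2real (J s + ennreal ?D))" if "0 < s" "s < t" "J s + ennreal ?D < \<infinity>" for s
      proof -
        have "J s < \<infinity>" using that(3) by (auto simp: less_top[symmetric])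
        then have "enn2real (J s + ennreal ?D) = enn2real (J s) + ?D"
          using D by (subst enn2real_plus) (auto simp: less_top)
        then show ?thesis using Suc that t by auto
      qed
      have "(\<integral>\<^sup>+s\<in>{0..t}. ennreal (exp (- (t - s))) * (ennreal r * (J s + ennreal ?D) + err_at s) \<partial>lborel)
          = (\<integral>\<^sup>+s. ennreal (exp (- (t - s))) * (ennreal r * J s + err_at s) * indicator {0..t} s
              + ennreal (r * ?D) * (ennreal (exp (- 1 * (t - s))) * indicator {0..t} s) \<partial>lborel)"
      proof (rule nn_integral_cong)
        fix s
        have "ennreal (r * ?D) = ennreal r * ennreal ?D" using r_bounds by (intro ennreal_mult') simp
        then show "ennreal (exp (- (t - s))) * (ennreal r * (J s + ennreal ?D) + err_at s) * indicator {0..t} s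
            = ennreal (exp (- (t - s))) * (ennreal r * J s + err_at s) * indicator {0..t} s
              + ennreal (r * ?D) * (ennreal (exp (- 1 * (t - s))) * indicator {0..t} s)"
          by (simp only: mult_minus1 distrib_left distrib_right ac_simps)
      qed
      also have "\<dots> = J t + ennreal (r * ?D) * ennreal ((1 - exp (- 1 * t)) / 1)"
        using t by (subst nn_integral_add, measurable, subst nn_integral_cmult, measurable,
            subst nn_integral_exp_Icc, simp, simp, subst J_renewal) auto
      also have "\<dots> \<le> J t + ennreal (r * ?D) * 1"
        using t by (intro add_left_mono mult_left_mono) (auto simp: ennreal_le_1)
      also have "\<dots> = ennreal (enn2real (J t) + r ^ Suc j * C)"
        using Jt D r_bounds by (simp add: ennreal_plus mult.assoc)
      finally show "(\<integral>\<^sup>+s\<in>{0..t}. ennreal (exp (- (t - s))) * (ennreal r * (J s + ennreal ?D) + err_at s) \<partial>lborel)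
          \<le> ennreal (enn2real (J t) + r ^ Suc j * C)" .
      show "0 \<le> enn2real (J t) + r ^ Suc j * C" using C0 r_bounds by simp
    qed measurable
  qed
qed

text \<open>Finiteness of \<open>J T\<close> yields finite moments at almost every time, not
  necessarily at \<open>T\<close>. For each \<open>t < T\<close> a good time \<open>s\<close>
  between \<open>t\<close> and \<open>T\<close> is chosen, the a priori bound and the iteration run
  up to \<open>s\<close>, and one last recursion reaches \<open>T\<close>.\<close>

lemma entropy_le_J:
  assumes T: "0 < T" and J: "J T < \<infinity>"
  shows "ent_le (\<rho> T) (enn2real (J T))"
proof (rule entropy_recursion[OF T J_measurable])
  fix t assume t: "0 < t" "t < T"
  have ae: "AE s in lborel. ennreal (exp (- (lam * \<eta>) * (T - s))) * err_at s * indicator {0..T} s \<noteq> \<infinity>"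
    using J unfolding J_def by (intro nn_integral_noteq_infinite) (auto simp: less_top)
  have "\<exists>s\<in>{t<..<T}. ennreal (exp (- (lam * \<eta>) * (T - s))) * err_at s * indicator {0..T} s \<noteq> \<infinity>"
  proof (rule ccontr)
    assume no: "\<not> ?thesis"
    from ae have "AE s in lborel. s \<notin> {t<..<T}"
    proof eventually_elim
      case (elim s)
      then show ?case using no by blast
    qed
    then have "{t<..<T} \<in> null_sets lborel" by (subst AE_iff_null_sets) auto
    then have "emeasure lborel {t<..<T} = 0" by (rule null_setsD1)
    then show False using t by simp
  qed
  then obtain s where s: "t < s" "s < T" "ennreal (exp (- (lam * \<eta>) * (T - s))) * err_at s * indicator {0..T} s \<noteq> \<infinity>"
    by auto
  then have "err_at s \<noteq> \<infinity>" using t by (auto simp: ennreal_mult_eq_top_iff)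
  then have m: "(\<integral>\<^sup>+x. ennreal ((norm x)\<^sup>2) \<partial>\<rho> s) < \<infinity>"
  proof -
    have "moment_size (\<rho> s) \<noteq> \<infinity>"
      using \<open>err_at s \<noteq> \<infinity>\<close> s t err_at_eq[of s] err_infinite[OF step_size_nonzero, of "\<rho> s" "moment_size (\<rho> s)"]
      by auto
    then have "2 * (\<integral>\<^sup>+x. ennreal ((norm x)\<^sup>2) \<partial>\<rho> s) \<noteq> \<infinity>"
      unfolding moment_size_def ennreal_sqrt_def by metis
    then show ?thesis by (simp add: ennreal_mult_eq_top_iff less_top)
  qed
  obtain C where C: "\<And>q. 0 < q \<Longrightarrow> q \<le> s \<Longrightarrow> ent_le (\<rho> q) C"
    using entropy_a_priori[OF _ m] s t by auto
  have C0: "0 \<le> C" using C[of s] s t ent_le_nonneg by auto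
  have Js: "J s < \<infinity>" using J_finite[OF _ J] s by simp
  show "ent_le (\<rho> t) (enn2real (J t))"
  proof (rule ent_le_approx)
    fix \<epsilon> :: real assume "0 < \<epsilon>"
    \<comment> \<open>\<open>C + 1\<close> because \<open>C\<close> may be 0.\<close>
    then have "0 < \<epsilon> / (C + 1)" using C0 by simp
    then obtain j where j: "r ^ j < \<epsilon> / (C + 1)" using real_arch_pow_inv[OF _ r_bounds(2)] by blast
    have "r ^ j * C \<le> r ^ j * (C + 1)" using r_bounds by simp
    also have "\<dots> \<le> \<epsilon>" using j C0 by (simp add: pos_less_divide_eq less_imp_le)
    finally have "r ^ j * C \<le> \<epsilon>" .
    moreover have "ent_le (\<rho> t) (enn2real (J t) + r ^ j * C)"
      using entropy_iterate[OF _ Js C0 C, of j] s t by auto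
    ultimately show "ent_le (\<rho> t) (enn2real (J t) + \<epsilon>)" by (auto elim: ent_le_mono)
  qed
next
  show "(\<integral>\<^sup>+t\<in>{0..T}. ennreal (exp (- (T - t))) * (ennreal r * J t + err_at t) \<partial>lborel) \<le> ennreal (enn2real (J T))"
    by (subst J_renewal) (use T J in auto)
qed simp

lemma entropy_bound_eq_J:
  "entropy_bound \<eta> lam a b (\<lambda>t. step_size \<eta> lam \<sigma> g \<mu>U (\<rho> t)) (\<lambda>t. moment_size (\<rho> t)) T
     = ennreal (2 / 3) * J T"
proof -
  have "entropy_bound \<eta> lam a b (\<lambda>t. step_size \<eta> lam \<sigma> g \<mu>U (\<rho> t)) (\<lambda>t. moment_size (\<rho> t)) T
      = (\<integral>\<^sup>+t. ennreal (2 / 3) * (ennreal (exp (- (lam * \<eta>) * (T - t))) * err_at t * indicator {0..T} t) \<partial>lborel)"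
    unfolding entropy_bound_def
  proof (rule nn_integral_cong_AE, use AE_lborel_singleton[of 0] in eventually_elim)
    fix t :: real assume "t \<noteq> 0"
    let ?n = "step_size \<eta> lam \<sigma> g \<mu>U (\<rho> t)" and ?m = "moment_size (\<rho> t)"
    let ?e = "?n * (ennreal a * ?n + ennreal a * ?m + ennreal b)"
    have one: "ennreal (2 / 3) * ennreal (3 / 2) = 1" by (subst ennreal_mult'[symmetric]) auto
    show "ennreal (exp (- lam * \<eta> * (T - t))) * ?e * indicator {0..T} t
        = ennreal (2 / 3) * (ennreal (exp (- (lam * \<eta>) * (T - t))) * err_at t * indicator {0..T} t)"
    proof (cases "t \<in> {0..T}")
      case True
      then have "err_at t = ennreal (3 / 2) * ?e"
        using \<open>t \<noteq> 0\<close> err_at_eq[of t] by (simp only: err_def) auto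
      then have "ennreal (2 / 3) * (ennreal (exp (- (lam * \<eta>) * (T - t))) * err_at t)
          = (ennreal (2 / 3) * ennreal (3 / 2)) * (ennreal (exp (- (lam * \<eta>) * (T - t))) * ?e)"
        by (simp only: ac_simps)
      then show ?thesis using True by (simp only: one) simp
    qed simp
  qed
  also have "\<dots> = ennreal (2 / 3) * J T"
    unfolding J_def by (rule nn_integral_cmult) measurable
  finally show ?thesis .
qed

lemma entropy_le_bound:
  fixes T
  defines "B \<equiv> entropy_bound \<eta> lam a b (\<lambda>t. step_size \<eta> lam \<sigma> g \<mu>U (\<rho> t)) (\<lambda>t. moment_size (\<rho> t)) T"
  assumes T: "0 < T" and B: "B < \<infinity>"
  shows "ent_le (\<rho> T) (3 / 2 * enn2real B)"
proof -
  have eq: "B = ennreal (2 / 3) * J T" unfolding B_def by (rule entropy_bound_eq_J)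
  then have J: "J T < \<infinity>" using B by (cases "J T") (auto simp: ennreal_mult_top)
  have "enn2real B = 2 / 3 * enn2real (J T)" unfolding eq by (simp add: enn2real_mult)
  then have "3 / 2 * enn2real B = enn2real (J T)" by simp
  then show ?thesis using entropy_le_J[OF T J] by (simp only:)
qed

end


subsection \<open>A uniform PAC-Bayesian bound\<close>

lemma nn_integral_std_normal_exp:
  "(\<integral>\<^sup>+x. ennreal (std_normal_density x * exp (s * x)) \<partial>lborel) = ennreal (exp (s\<^sup>2 / 2))"
proof -
  have "std_normal_density x * exp (s * x) = exp (s\<^sup>2 / 2) * normal_density s 1 x" for x
    by (simp add: normal_density_def exp_add[symmetric] power2_eq_square field_simps)
  then have "(\<integral>\<^sup>+x. ennreal (std_normal_density x * exp (s * x)) \<partial>lborel)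
      = (\<integral>\<^sup>+x. ennreal (exp (s\<^sup>2 / 2)) * ennreal (normal_density s 1 x) \<partial>lborel)"
    by (simp add: ennreal_mult')
  also have "\<dots> = ennreal (exp (s\<^sup>2 / 2)) * (\<integral>\<^sup>+x. ennreal (normal_density s 1 x) \<partial>lborel)"
    by (rule nn_integral_cmult) measurable
  also have "(\<integral>\<^sup>+x. ennreal (normal_density s 1 x) \<partial>lborel) = 1"
    by (simp add: nn_integral_eq_integral)
  finally show ?thesis by simp
qed

text \<open>Since \<open>- 1/2 + 3/8 = - 1/8\<close>, the integrand is twice the normal density of
  variance 4.\<close>

lemma nn_integral_std_normal_exp_square:
  "(\<integral>\<^sup>+x. ennreal (std_normal_density x * exp (3 * x\<^sup>2 / 8)) \<partial>lborel) = 2"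
proof -
  have "sqrt ((2::real)\<^sup>2) = 2" by (rule real_sqrt_unique) auto
  then have "sqrt (2 * pi * 2\<^sup>2) = 2 * sqrt (2 * pi)" by (simp only: real_sqrt_mult ac_simps)
  then have "std_normal_density x * exp (3 * x\<^sup>2 / 8) = 2 * normal_density 0 2 x" for x
    by (simp add: normal_density_def exp_add[symmetric])
  then have "(\<integral>\<^sup>+x. ennreal (std_normal_density x * exp (3 * x\<^sup>2 / 8)) \<partial>lborel)
      = (\<integral>\<^sup>+x. 2 * ennreal (normal_density 0 2 x) \<partial>lborel)"
    by (simp add: ennreal_mult')
  also have "\<dots> = 2 * (\<integral>\<^sup>+x. ennreal (normal_density 0 2 x) \<partial>lborel)"
    by (rule nn_integral_cmult) measurable
  also have "(\<integral>\<^sup>+x. ennreal (normal_density 0 2 x) \<partial>lborel) = 1"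
    by (simp add: nn_integral_eq_integral)
  finally show ?thesis by simp
qed

lemma ennreal_eq_0_by_scaling:
  assumes "\<And>m::real. 0 < m \<Longrightarrow> ennreal m * z \<le> ennreal c"
  shows "z = 0"
proof (cases z)
  case (real x)
  show ?thesis
  proof (rule ccontr)
    assume "z \<noteq> 0"
    then have x: "0 < x" using real by (cases "x = 0") auto
    define m where "m = (max 0 c + 1) / x"
    have "0 < m" using x by (simp add: m_def add_nonneg_pos)
    then have "ennreal (m * x) \<le> ennreal c" using assms[of m] real by (simp add: ennreal_mult')
    moreover have "m * x = max 0 c + 1" using x by (simp add: m_def)
    ultimately have "ennreal (max 0 c + 1) \<le> ennreal (max 0 c)" by (simp add: ennreal_max_0)
    then show False by (subst (asm) ennreal_le_iff) auto
  qed
next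
  case top
  then show ?thesis using assms[of 1] by (simp add: top_unique)
qed

section \<open>Exponential moments of the generalization gap\<close>

locale subgaussian_risk = \<mu>z: prob_space \<mu>z for \<mu>z :: "'z measure" +
  fixes l :: "'a::euclidean_space \<Rightarrow> 'z \<Rightarrow> real" and n :: nat
  assumes n_pos: "1 \<le> n"
    and l_measurable [measurable]: "(\<lambda>(w, z). l w z) \<in> borel_measurable (borel \<Otimes>\<^sub>M \<mu>z)"
begin

abbreviation "Smp \<equiv> sample_space n \<mu>z"
abbreviation "gap \<equiv> gen_gap l \<mu>z n"

sublocale Smp: prob_space Smp
  unfolding sample_space_def by (rule prob_space_PiM) (rule \<mu>z.prob_space_axioms)

lemma risk_measurable [measurable]: "risk l \<mu>z \<in> borel_measurable borel"
  unfolding risk_def by measurable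

lemma gap_measurable [measurable]:
  "(\<lambda>(S, w). gap S w) \<in> borel_measurable (Smp \<Otimes>\<^sub>M borel)"
proof -
  have "(\<lambda>(S, w). l w (S i)) \<in> borel_measurable (Smp \<Otimes>\<^sub>M borel)" if "i < n" for i
    unfolding sample_space_def by measurable (use that in auto)
  then show ?thesis unfolding gen_gap_def empirical_risk_def by (simp add: split_beta') measurable
qed

lemma mgf_gap:
  assumes sub: "subgaussian_loss Sig l \<mu>z"
  shows "(\<integral>\<^sup>+S. ennreal (exp (t * gap S w)) \<partial>Smp) \<le> ennreal (exp (t\<^sup>2 * Sig\<^sup>2 / (2 * real n)))"
proof -
  interpret P: product_sigma_finite "\<lambda>_::nat. \<mu>z" ..
  have eq: "exp (t * gap S w) = (\<Prod>i<n. exp (- t / real n * (l w (S i) - risk l \<mu>z w)))" for S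
  proof -
    have "t * gap S w = (\<Sum>i<n. - t / real n * (l w (S i) - risk l \<mu>z w))"
    proof -
      have "(\<Sum>i<n. - t / real n * (l w (S i) - risk l \<mu>z w))
          = - t / real n * ((\<Sum>i<n. l w (S i)) - real n * risk l \<mu>z w)"
        by (simp only: sum_distrib_left[symmetric] sum_subtractf sum_constant card_lessThan)
      then show ?thesis using n_pos by (simp add: gen_gap_def empirical_risk_def field_simps)
    qed
    then show ?thesis by (simp add: exp_sum)
  qed
  have "(\<integral>\<^sup>+S. ennreal (exp (t * gap S w)) \<partial>Smp)
      = (\<integral>\<^sup>+S. (\<Prod>i<n. ennreal (exp (- t / real n * (l w (S i) - risk l \<mu>z w)))) \<partial>Pi\<^sub>M {..<n} (\<lambda>_. \<mu>z))"
    unfolding eq sample_space_def by (simp add: prod_ennreal)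
  also have "\<dots> = (\<Prod>i<n. \<integral>\<^sup>+z. ennreal (exp (- t / real n * (l w z - risk l \<mu>z w))) \<partial>\<mu>z)"
    by (rule P.product_nn_integral_prod) auto
  also have "\<dots> \<le> (\<Prod>i<n. ennreal (exp ((- t / real n)\<^sup>2 * Sig\<^sup>2 / 2)))"
    using sub unfolding subgaussian_loss_def by (intro prod_mono_ennreal) blast
  also have "\<dots> = ennreal (exp (real n * ((- t / real n)\<^sup>2 * Sig\<^sup>2 / 2)))"
    by (simp only: prod_constant card_lessThan ennreal_power[OF exp_ge_zero] exp_of_nat_mult)
  also have "real n * ((- t / real n)\<^sup>2 * Sig\<^sup>2 / 2) = t\<^sup>2 * Sig\<^sup>2 / (2 * real n)"
    using n_pos by (simp add: power2_eq_square field_simps)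
  finally show ?thesis .
qed

text \<open>Writes the exponential of a square as a Gaussian mixture of exponentials.\<close>

lemma exp_square_gap:
  assumes sub: "subgaussian_loss Sig l \<mu>z" and Sig: "0 < Sig"
  defines "\<kappa> \<equiv> 3 * real n / (8 * Sig\<^sup>2)"
  shows "(\<integral>\<^sup>+S. ennreal (exp (\<kappa> * (gap S w)\<^sup>2)) \<partial>Smp) \<le> 2"
proof -
  have \<kappa>: "0 \<le> \<kappa>" by (simp add: \<kappa>_def)
  interpret SL: pair_sigma_finite Smp lborel ..
  have [measurable]: "(\<lambda>S. gap S w) \<in> borel_measurable Smp" by measurable
  have "ennreal (exp (\<kappa> * (gap S w)\<^sup>2))
      = (\<integral>\<^sup>+x. ennreal (std_normal_density x * exp (sqrt (2 * \<kappa>) * gap S w * x)) \<partial>lborel)" for S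
    unfolding nn_integral_std_normal_exp using \<kappa> by (simp add: power_mult_distrib)
  then have "(\<integral>\<^sup>+S. ennreal (exp (\<kappa> * (gap S w)\<^sup>2)) \<partial>Smp)
      = (\<integral>\<^sup>+S. \<integral>\<^sup>+x. ennreal (std_normal_density x * exp (sqrt (2 * \<kappa>) * gap S w * x)) \<partial>lborel \<partial>Smp)"
    by simp
  also have "\<dots> = (\<integral>\<^sup>+x. \<integral>\<^sup>+S. ennreal (std_normal_density x * exp (sqrt (2 * \<kappa>) * gap S w * x)) \<partial>Smp \<partial>lborel)"
    by (rule SL.Fubini'[symmetric]) measurable
  also have "\<dots> \<le> (\<integral>\<^sup>+x. ennreal (std_normal_density x * exp (3 * x\<^sup>2 / 8)) \<partial>lborel)"
  proof (rule nn_integral_mono)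
    fix x :: real
    have "(\<integral>\<^sup>+S. ennreal (std_normal_density x * exp (sqrt (2 * \<kappa>) * gap S w * x)) \<partial>Smp)
        = (\<integral>\<^sup>+S. ennreal (std_normal_density x) * ennreal (exp ((sqrt (2 * \<kappa>) * x) * gap S w)) \<partial>Smp)"
      by (simp add: ennreal_mult' ac_simps)
    also have "\<dots> = ennreal (std_normal_density x) * (\<integral>\<^sup>+S. ennreal (exp ((sqrt (2 * \<kappa>) * x) * gap S w)) \<partial>Smp)"
      by (rule nn_integral_cmult) measurable
    also have "\<dots> \<le> ennreal (std_normal_density x) * ennreal (exp ((sqrt (2 * \<kappa>) * x)\<^sup>2 * Sig\<^sup>2 / (2 * real n)))"
      by (intro mult_left_mono mgf_gap sub) simp
    \<comment> \<open>The exponent equals \<open>\<kappa> * Sig\<^sup>2 / n * x\<^sup>2\<close>. The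
      coefficient 3/8 is the one for which
      \<open>1 / \<kappa> = 2 / 3 * (4 * Sig\<^sup>2 / n)\<close>, matching the factor 3/2 lost in
      the entropy bound.\<close>
    also have "(sqrt (2 * \<kappa>) * x)\<^sup>2 * Sig\<^sup>2 / (2 * real n) = 3 * x\<^sup>2 / 8"
      using \<kappa> n_pos Sig by (simp add: power_mult_distrib) (simp add: \<kappa>_def field_simps)
    finally show "(\<integral>\<^sup>+S. ennreal (std_normal_density x * exp (sqrt (2 * \<kappa>) * gap S w * x)) \<partial>Smp)
        \<le> ennreal (std_normal_density x * exp (3 * x\<^sup>2 / 8))" by (simp add: ennreal_mult')
  qed
  finally show ?thesis by (simp add: nn_integral_std_normal_exp_square)
qed

end

section \<open>From the prior to all posteriors\<close>

locale pac_bayes = gaussian \<sigma> G + subgaussian_risk \<mu>z l n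
  for \<sigma> and G :: "'a::euclidean_space measure" and \<mu>z :: "'z measure" and l :: "'a \<Rightarrow> 'z \<Rightarrow> real" and n
begin

sublocale SG: pair_prob_space Smp G ..

lemma gap_measurable_w [measurable]: "S \<in> space Smp \<Longrightarrow> gap S \<in> borel_measurable borel"
  using measurable_compose[OF measurable_Pair1' gap_measurable] by simp

lemma prior_exp_square_gap:
  assumes "subgaussian_loss Sig l \<mu>z" "0 < Sig"
  shows "(\<integral>\<^sup>+S. \<integral>\<^sup>+w. ennreal (exp (3 * real n / (8 * Sig\<^sup>2) * (gap S w)\<^sup>2)) \<partial>G \<partial>Smp) \<le> 2"
proof -
  have "(\<integral>\<^sup>+S. \<integral>\<^sup>+w. ennreal (exp (3 * real n / (8 * Sig\<^sup>2) * (gap S w)\<^sup>2)) \<partial>G \<partial>Smp)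
      = (\<integral>\<^sup>+w. \<integral>\<^sup>+S. ennreal (exp (3 * real n / (8 * Sig\<^sup>2) * (gap S w)\<^sup>2)) \<partial>Smp \<partial>G)"
    by (rule SG.Fubini'[symmetric]) measurable
  also have "\<dots> \<le> (\<integral>\<^sup>+w. 2 \<partial>G)"
    by (intro nn_integral_mono exp_square_gap assms)
  finally show ?thesis by (simp add: G.emeasure_space_1[simplified])
qed

lemma second_moment_gap:
  assumes sub: "subgaussian_loss Sig l \<mu>z" and Sig: "0 \<le> Sig" and \<zeta>: "0 < \<zeta>" "\<zeta> < 1"
  shows "\<exists>A\<in>sets Smp. 1 - \<zeta> \<le> measure Smp A \<and> (\<forall>S\<in>A. \<forall>\<mu> k. prob_space \<mu> \<longrightarrow> sets \<mu> = sets borel \<longrightarrow>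
     ent_le \<mu> k \<longrightarrow> (\<integral>\<^sup>+w. ennreal ((gap S w)\<^sup>2) \<partial>\<mu>) \<le> ennreal (8 * Sig\<^sup>2 / (3 * real n) * (k + ln (2 / \<zeta>))))"
proof (cases "Sig = 0")
  case False
  define \<kappa> where "\<kappa> = 3 * real n / (8 * Sig\<^sup>2)"
  have \<kappa>: "0 < \<kappa>" using False n_pos by (simp add: \<kappa>_def)
  define \<Phi> where "\<Phi> S = (\<integral>\<^sup>+w. ennreal (exp (\<kappa> * (gap S w)\<^sup>2)) \<partial>G)" for S
  have \<Phi>_measurable [measurable]: "\<Phi> \<in> borel_measurable Smp"
    unfolding \<Phi>_def by measurable
  have \<Phi>_le: "(\<integral>\<^sup>+S. \<Phi> S \<partial>Smp) \<le> 2"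
    unfolding \<Phi>_def \<kappa>_def using prior_exp_square_gap[OF sub] False Sig by simp
  define A where "A = {S \<in> space Smp. \<Phi> S \<le> ennreal (2 / \<zeta>)}"
  have A [measurable]: "A \<in> sets Smp" unfolding A_def by measurable
  have "emeasure Smp (space Smp - A) \<le> emeasure Smp {S \<in> space Smp. 1 \<le> ennreal (\<zeta> / 2) * \<Phi> S}"
  proof (rule emeasure_mono)
    show "space Smp - A \<subseteq> {S \<in> space Smp. 1 \<le> ennreal (\<zeta> / 2) * \<Phi> S}"
    proof
      fix S assume S: "S \<in> space Smp - A"
      then have "ennreal (2 / \<zeta>) \<le> \<Phi> S" by (auto simp: A_def not_le)
      then have "ennreal (\<zeta> / 2) * ennreal (2 / \<zeta>) \<le> ennreal (\<zeta> / 2) * \<Phi> S" by (rule mult_left_mono) simp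
      moreover have "ennreal (\<zeta> / 2) * ennreal (2 / \<zeta>) = 1"
        using \<zeta> by (subst ennreal_mult'[symmetric]) auto
      ultimately show "S \<in> {S \<in> space Smp. 1 \<le> ennreal (\<zeta> / 2) * \<Phi> S}" using S by simp
    qed
  qed measurable
  also have "\<dots> \<le> ennreal (\<zeta> / 2) * (\<integral>\<^sup>+S. \<Phi> S * indicator (space Smp) S \<partial>Smp)"
    using nn_integral_Markov_inequality[of \<Phi> "space Smp" Smp "ennreal (\<zeta> / 2)"] by simp
  also have "(\<integral>\<^sup>+S. \<Phi> S * indicator (space Smp) S \<partial>Smp) = (\<integral>\<^sup>+S. \<Phi> S \<partial>Smp)"
    by (intro nn_integral_cong) simp
  also have "ennreal (\<zeta> / 2) * \<dots> \<le> ennreal (\<zeta> / 2) * ennreal 2"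
    using \<Phi>_le by (intro mult_left_mono) auto
  also have "\<dots> = ennreal \<zeta>" using \<zeta> by (subst ennreal_mult'[symmetric]) auto
  finally have "measure Smp (space Smp - A) \<le> \<zeta>"
    using \<zeta> by (simp add: Smp.emeasure_eq_measure)
  \<comment> \<open>\<open>\<Phi>\<close> and hence \<open>A\<close> involve the prior only;
    \<open>\<mu>\<close> and \<open>k\<close> enter afterwards, through
    \<open>ent_le_nn_integral\<close> with \<open>c = 2 / \<zeta>\<close>.\<close>
  then have "1 - \<zeta> \<le> measure Smp A" using Smp.prob_compl[OF A] by simp
  moreover have "(\<integral>\<^sup>+w. ennreal ((gap S w)\<^sup>2) \<partial>\<mu>) \<le> ennreal (8 * Sig\<^sup>2 / (3 * real n) * (k + ln (2 / \<zeta>)))"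
    if S: "S \<in> A" and \<mu>: "prob_space \<mu>" "sets \<mu> = sets borel" and k: "ent_le \<mu> k" for S \<mu> k
  proof -
    have [measurable_cong]: "sets \<mu> = sets borel" by fact
    have [measurable]: "gap S \<in> borel_measurable borel" using S by (intro gap_measurable_w) (simp add: A_def)
    have "(\<integral>\<^sup>+w. ennreal ((gap S w)\<^sup>2) \<partial>\<mu>) = (\<integral>\<^sup>+w. ennreal (1 / \<kappa>) * ennreal (\<kappa> * (gap S w)\<^sup>2) \<partial>\<mu>)"
      using \<kappa> by (simp add: ennreal_mult'[symmetric])
    also have "\<dots> = ennreal (1 / \<kappa>) * (\<integral>\<^sup>+w. ennreal (\<kappa> * (gap S w)\<^sup>2) \<partial>\<mu>)"
      by (rule nn_integral_cmult) measurable
    also have "\<dots> \<le> ennreal (1 / \<kappa>) * ennreal (k + ln (2 / \<zeta>))"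
      using S \<kappa> \<zeta> by (intro mult_left_mono ent_le_nn_integral[OF \<mu> k]) (auto simp: A_def \<Phi>_def)
    also have "\<dots> = ennreal (1 / \<kappa> * (k + ln (2 / \<zeta>)))"
      using \<kappa> by (intro ennreal_mult'[symmetric]) simp
    finally show ?thesis by (simp add: \<kappa>_def)
  qed
  ultimately show ?thesis using A by blast
next
  case True
  \<comment> \<open>For \<open>Sig = 0\<close> the loss is subgaussian with every parameter
    \<open>s > 0\<close>, so every multiple of the squared gap obeys the same bound. Hence for
    almost every sample the gap is 0 almost everywhere under the prior, and scaling in the entropy
    inequality transfers this to every \<open>\<mu>\<close> with an entropy bound.\<close>
  define \<Phi> where "\<Phi> S = (\<integral>\<^sup>+w. ennreal ((gap S w)\<^sup>2) \<partial>G)" for S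
  have \<Phi>_measurable [measurable]: "\<Phi> \<in> borel_measurable Smp"
    unfolding \<Phi>_def by measurable
  have small: "ennreal \<kappa> * (\<integral>\<^sup>+S. \<Phi> S \<partial>Smp) \<le> ennreal 2" if \<kappa>: "0 < \<kappa>" for \<kappa>
  proof -
    define s where "s = sqrt (3 * real n / (8 * \<kappa>))"
    have s: "0 < s" "3 * real n / (8 * s\<^sup>2) = \<kappa>" using \<kappa> n_pos by (auto simp: s_def)
    have sub': "subgaussian_loss s l \<mu>z"
      unfolding subgaussian_loss_def
    proof (intro allI)
      fix w t
      have "(\<integral>\<^sup>+z. ennreal (exp (t * (l w z - risk l \<mu>z w))) \<partial>\<mu>z) \<le> ennreal (exp (t\<^sup>2 * Sig\<^sup>2 / 2))"
        using sub unfolding subgaussian_loss_def by blast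
      also have "\<dots> \<le> ennreal (exp (t\<^sup>2 * s\<^sup>2 / 2))" by (intro ennreal_leI) (simp add: True)
      finally show "(\<integral>\<^sup>+z. ennreal (exp (t * (l w z - risk l \<mu>z w))) \<partial>\<mu>z) \<le> ennreal (exp (t\<^sup>2 * s\<^sup>2 / 2))" .
    qed
    have "ennreal \<kappa> * (\<integral>\<^sup>+S. \<Phi> S \<partial>Smp) = (\<integral>\<^sup>+S. ennreal \<kappa> * \<Phi> S \<partial>Smp)"
      by (rule nn_integral_cmult[symmetric]) measurable
    also have "\<dots> \<le> (\<integral>\<^sup>+S. \<integral>\<^sup>+w. ennreal (exp (\<kappa> * (gap S w)\<^sup>2)) \<partial>G \<partial>Smp)"
    proof (rule nn_integral_mono)
      fix S assume "S \<in> space Smp"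
      then have [measurable]: "gap S \<in> borel_measurable borel" by (rule gap_measurable_w)
      have "ennreal \<kappa> * \<Phi> S = (\<integral>\<^sup>+w. ennreal \<kappa> * ennreal ((gap S w)\<^sup>2) \<partial>G)"
        unfolding \<Phi>_def by (rule nn_integral_cmult[symmetric]) measurable
      also have "\<dots> \<le> (\<integral>\<^sup>+w. ennreal (exp (\<kappa> * (gap S w)\<^sup>2)) \<partial>G)"
      proof (rule nn_integral_mono)
        fix w
        have "\<kappa> * (gap S w)\<^sup>2 \<le> exp (\<kappa> * (gap S w)\<^sup>2)"
          using exp_ge_add_one_self[of "\<kappa> * (gap S w)\<^sup>2"] by linarith
        then show "ennreal \<kappa> * ennreal ((gap S w)\<^sup>2) \<le> ennreal (exp (\<kappa> * (gap S w)\<^sup>2))"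
          using \<kappa> by (subst ennreal_mult'[symmetric]) (auto intro: ennreal_leI)
      qed
      finally show "ennreal \<kappa> * \<Phi> S \<le> (\<integral>\<^sup>+w. ennreal (exp (\<kappa> * (gap S w)\<^sup>2)) \<partial>G)" .
    qed
    also have "\<dots> \<le> ennreal 2"
      using prior_exp_square_gap[OF sub' s(1)] s(2) by simp
    finally show ?thesis .
  qed
  have "(\<integral>\<^sup>+S. \<Phi> S \<partial>Smp) = 0" by (rule ennreal_eq_0_by_scaling[OF small])
  then have ae: "AE S in Smp. \<Phi> S = 0" by (subst (asm) nn_integral_0_iff_AE) auto
  define A where "A = {S \<in> space Smp. \<Phi> S = 0}"
  have A [measurable]: "A \<in> sets Smp" unfolding A_def by measurable
  have "AE S in Smp. S \<in> A" using ae AE_space by eventually_elim (simp add: A_def)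
  then have "measure Smp A = 1" using Smp.prob_eq_1[OF A] by simp
  moreover have "(\<integral>\<^sup>+w. ennreal ((gap S w)\<^sup>2) \<partial>\<mu>) \<le> ennreal (8 * Sig\<^sup>2 / (3 * real n) * (k + ln (2 / \<zeta>)))"
    if S: "S \<in> A" and \<mu>: "prob_space \<mu>" "sets \<mu> = sets borel" and k: "ent_le \<mu> k" for S \<mu> k
  proof -
    have [measurable_cong]: "sets \<mu> = sets borel" by fact
    have [measurable]: "gap S \<in> borel_measurable borel" using S by (intro gap_measurable_w) (simp add: A_def)
    have z: "AE w in G. gap S w = 0"
      using S by (simp add: A_def \<Phi>_def nn_integral_0_iff_AE)
    have "(\<integral>\<^sup>+w. ennreal ((gap S w)\<^sup>2) \<partial>\<mu>) = 0"
    proof (rule ennreal_eq_0_by_scaling)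
      fix m :: real assume m: "0 < m"
      have "(\<integral>\<^sup>+w. ennreal (exp (m * (gap S w)\<^sup>2)) \<partial>G) = (\<integral>\<^sup>+w. 1 \<partial>G)"
        by (rule nn_integral_cong_AE) (use z in \<open>eventually_elim, simp\<close>)
      also have "\<dots> = ennreal 1" by (simp add: G.emeasure_space_1[simplified])
      finally have "(\<integral>\<^sup>+w. ennreal (m * (gap S w)\<^sup>2) \<partial>\<mu>) \<le> ennreal (k + ln 1)"
        using m by (intro ent_le_nn_integral[OF \<mu> k]) auto
      then show "ennreal m * (\<integral>\<^sup>+w. ennreal ((gap S w)\<^sup>2) \<partial>\<mu>) \<le> ennreal (k + ln 1)"
        using m by (subst nn_integral_cmult[symmetric]) (auto simp: ennreal_mult')
    qed
    then show ?thesis by simp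
  qed
  ultimately show ?thesis using A \<zeta> by (intro bexI[of _ A]) auto
qed

text \<open>The second moment controls the mean \<open>m\<close> through
  \<open>0 \<le> (gap - m)\<^sup>2\<close>. Splitting \<open>8 / 3 = 4 * (2 / 3)\<close> leaves 2/3
  in front of both \<open>k\<close> and \<open>ln (2 / \<zeta>)\<close>; the second is enlarged to
  the \<open>ln (3 / \<zeta>)\<close> of the statement.\<close>

lemma pac_bayes_bound:
  assumes sub: "subgaussian_loss Sig l \<mu>z" and Sig: "0 \<le> Sig" and \<zeta>: "0 < \<zeta>" "\<zeta> < 1"
  shows "\<exists>A\<in>sets Smp. 1 - \<zeta> \<le> measure Smp A \<and> (\<forall>S\<in>A. \<forall>\<mu> k. prob_space \<mu> \<longrightarrow> sets \<mu> = sets borel \<longrightarrow>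
     ent_le \<mu> k \<longrightarrow> integrable \<mu> (gap S) \<and>
       (\<integral>w. gap S w \<partial>\<mu>) \<le> 2 * Sig / sqrt (real n) * sqrt (2 / 3 * k + ln (3 / \<zeta>)))"
proof -
  obtain A where A: "A \<in> sets Smp" "1 - \<zeta> \<le> measure Smp A"
    and le: "\<And>S \<mu> k. S \<in> A \<Longrightarrow> prob_space \<mu> \<Longrightarrow> sets \<mu> = sets borel \<Longrightarrow> ent_le \<mu> k \<Longrightarrow>
      (\<integral>\<^sup>+w. ennreal ((gap S w)\<^sup>2) \<partial>\<mu>) \<le> ennreal (8 * Sig\<^sup>2 / (3 * real n) * (k + ln (2 / \<zeta>)))"
    using second_moment_gap[OF assms] by blast
  have "integrable \<mu> (gap S) \<and> (\<integral>w. gap S w \<partial>\<mu>) \<le> 2 * Sig / sqrt (real n) * sqrt (2 / 3 * k + ln (3 / \<zeta>))"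
    if S: "S \<in> A" and \<mu>: "prob_space \<mu>" "sets \<mu> = sets borel" and k: "ent_le \<mu> k" for S \<mu> k
  proof -
    interpret prob_space \<mu> by fact
    have [measurable_cong]: "sets \<mu> = sets borel" by fact
    have [measurable]: "gap S \<in> borel_measurable borel"
      using S A sets.sets_into_space by (intro gap_measurable_w) blast
    let ?B = "8 * Sig\<^sup>2 / (3 * real n) * (k + ln (2 / \<zeta>))"
    have k0: "0 \<le> k" by (rule ent_le_nonneg[OF k])
    have ln2: "0 \<le> ln (2 / \<zeta>)" using \<zeta> by (intro ln_ge_zero) (simp add: field_simps)
    have i2: "integrable \<mu> (\<lambda>w. (gap S w)\<^sup>2)"
      using le[OF S \<mu> k] by (intro integrableI_nonneg) (auto intro: le_less_trans)
    have i1: "integrable \<mu> (gap S)"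
    proof (rule Bochner_Integration.integrable_bound[of _ "\<lambda>w. 1 + (gap S w)\<^sup>2"])
      show "AE w in \<mu>. norm (gap S w) \<le> norm (1 + (gap S w)\<^sup>2)"
      proof (rule AE_I2)
        fix w
        have "2 * \<bar>gap S w\<bar> \<le> 1 + (gap S w)\<^sup>2"
          using zero_le_power2[of "\<bar>gap S w\<bar> - 1"] by (simp add: power2_eq_square algebra_simps)
        then show "norm (gap S w) \<le> norm (1 + (gap S w)\<^sup>2)" by simp
      qed
    qed (use i2 in auto)
    have "(\<integral>w. (gap S w)\<^sup>2 \<partial>\<mu>) \<le> ?B"
      using le[OF S \<mu> k] i2 k0 ln2 by (subst (asm) nn_integral_eq_integral) auto
    define m where "m = (\<integral>w. gap S w \<partial>\<mu>)"
    have "m\<^sup>2 = (\<integral>w. 2 * m * gap S w - m\<^sup>2 \<partial>\<mu>)"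
      using i1 by (simp add: m_def[symmetric] prob_space power2_eq_square)
    also have "\<dots> \<le> (\<integral>w. (gap S w)\<^sup>2 \<partial>\<mu>)"
    proof (rule integral_mono)
      show "2 * m * gap S w - m\<^sup>2 \<le> (gap S w)\<^sup>2" for w
        using zero_le_power2[of "gap S w - m"] by (simp add: power2_eq_square algebra_simps)
    qed (use i1 i2 in auto)
    also have "\<dots> \<le> ?B" by fact
    also have "\<dots> \<le> 4 * Sig\<^sup>2 / real n * (2 / 3 * k + ln (3 / \<zeta>))"
    proof -
      have "2 / 3 * ln (2 / \<zeta>) \<le> ln (2 / \<zeta>)" using ln2 by simp
      also have "\<dots> \<le> ln (3 / \<zeta>)" using \<zeta> by (subst ln_le_cancel_iff) (auto simp: divide_right_mono)
      finally have "4 * Sig\<^sup>2 / real n * (2 / 3 * k + 2 / 3 * ln (2 / \<zeta>)) \<le> 4 * Sig\<^sup>2 / real n * (2 / 3 * k + ln (3 / \<zeta>))"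
        by (intro mult_left_mono) auto
      moreover have "?B = 4 * Sig\<^sup>2 / real n * (2 / 3 * k + 2 / 3 * ln (2 / \<zeta>))"
        using n_pos by (simp add: field_simps)
      ultimately show ?thesis by simp
    qed
    finally have "m\<^sup>2 \<le> 4 * Sig\<^sup>2 / real n * (2 / 3 * k + ln (3 / \<zeta>))" .
    then have "\<bar>m\<bar> \<le> sqrt (4 * Sig\<^sup>2 / real n * (2 / 3 * k + ln (3 / \<zeta>)))"
      by (metis real_sqrt_abs real_sqrt_le_iff)
    also have "\<dots> = 2 * Sig / sqrt (real n) * sqrt (2 / 3 * k + ln (3 / \<zeta>))"
      using Sig by (simp add: real_sqrt_mult real_sqrt_divide)
    finally show ?thesis using i1 by (simp add: m_def)
  qed
  then show ?thesis using A by blast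
qed

end


subsection \<open>The generalization bound\<close>

theorem theorem21:
  fixes \<mu>z :: "'z measure"
    and \<mu>U :: "'u measure"
    and M :: "'w measure"
    and l :: "'a::euclidean_space \<Rightarrow> 'z \<Rightarrow> real"
    and g :: "(nat \<Rightarrow> 'z) \<Rightarrow> 'a \<Rightarrow> 'u \<Rightarrow> 'a"
    and X0 :: "(nat \<Rightarrow> 'z) \<Rightarrow> 'w \<Rightarrow> 'a"
    and U :: "nat \<Rightarrow> 'w \<Rightarrow> 'u"
    and N :: "real \<Rightarrow> 'w \<Rightarrow> nat"
    and n :: nat
    and \<eta> lam \<sigma> Sig a b \<zeta> :: real
    and \<nu> \<mu>0 :: "'a measure"
    and X :: "(nat \<Rightarrow> 'z) \<Rightarrow> nat \<Rightarrow> 'w \<Rightarrow> 'a"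
    and Y :: "(nat \<Rightarrow> 'z) \<Rightarrow> real \<Rightarrow> 'w \<Rightarrow> 'a"
    and \<rho> :: "(nat \<Rightarrow> 'z) \<Rightarrow> real \<Rightarrow> 'a measure"
    and u :: "(nat \<Rightarrow> 'z) \<Rightarrow> real \<Rightarrow> 'a \<Rightarrow> real"
    and Nsz Msz :: "(nat \<Rightarrow> 'z) \<Rightarrow> real \<Rightarrow> ennreal"
  defines "\<nu> \<equiv> isotropic_gaussian \<sigma>"
    and "\<mu>0 \<equiv> \<nu>"
    and "X \<equiv> (\<lambda>S. sgd_iterate \<eta> lam (g S) (X0 S) U)"
    and "Y \<equiv> (\<lambda>S. poissonized (X S) N)"
    and "\<rho> \<equiv> (\<lambda>S t. distr M borel (Y S t))"
    and "Nsz \<equiv> (\<lambda>S t. step_size \<eta> lam \<sigma> (g S) \<mu>U (\<rho> S t))"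
    and "Msz \<equiv> (\<lambda>S t. moment_size (\<rho> S t))"
  assumes "prob_space \<mu>z" and "prob_space \<mu>U" and "1 \<le> n"
    and params: "0 < \<eta>" "0 < lam" "lam * \<eta> < 1" "0 < \<sigma>" "0 \<le> Sig" "0 < a" "0 < b"
      "0 < \<zeta>" "\<zeta> < 1"
    and loss_nonneg: "\<And>w z. z \<in> space \<mu>z \<Longrightarrow> 0 \<le> l w z"
    and loss_measurable: "(\<lambda>(w, z). l w z) \<in> borel_measurable (borel \<Otimes>\<^sub>M \<mu>z)"
    and subgaussian: "subgaussian_loss Sig l \<mu>z"
    and gradient_measurable: "\<And>S. S \<in> space (sample_space n \<mu>z) \<Longrightarrow>
      (\<lambda>(x, v). g S x v) \<in> borel_measurable (borel \<Otimes>\<^sub>M \<mu>U)"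
    and randomness: "\<And>S. S \<in> space (sample_space n \<mu>z) \<Longrightarrow> sgd_randomness M \<mu>0 \<mu>U (X0 S) U N"
    and compatible: "compatible n \<mu>z \<nu> \<mu>0 (\<lambda>S. sgd_kernel \<eta> lam (g S) \<mu>U) \<rho>"
    and lebesgue_density: "\<And>S t. S \<in> space (sample_space n \<mu>z) \<Longrightarrow> 0 \<le> t \<Longrightarrow>
      u S t \<in> borel_measurable borel \<and> (\<forall>x. 0 < u S t x)
      \<and> \<rho> S t = density lborel (\<lambda>x. ennreal (u S t x))"
    and score_growth: "\<And>S t x. S \<in> space (sample_space n \<mu>z) \<Longrightarrow> 0 \<le> t \<Longrightarrow>
      \<exists>D. GDERIV (\<lambda>y. ln (u S t y)) x :> D \<and> norm (D + x /\<^sub>R \<sigma>\<^sup>2) \<le> a * norm x + b"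
  shows "\<exists>A\<in>sets (sample_space n \<mu>z). 1 - \<zeta> \<le> measure (sample_space n \<mu>z) A \<and>
    (\<forall>S\<in>A. \<forall>T>0. entropy_bound \<eta> lam a b (Nsz S) (Msz S) T < \<infinity> \<longrightarrow>
       integrable M (\<lambda>\<omega>. gen_gap l \<mu>z n S (Y S T \<omega>)) \<and>
       (\<integral>\<omega>. gen_gap l \<mu>z n S (Y S T \<omega>) \<partial>M)
         \<le> 2 * Sig / sqrt (real n)
            * sqrt (enn2real (entropy_bound \<eta> lam a b (Nsz S) (Msz S) T) + ln (3 / \<zeta>)))"
proof -
  have \<nu>: "gaussian \<sigma> \<nu>" using params by unfold_locales (simp_all add: \<nu>_def)
  interpret PB: pac_bayes \<sigma> \<nu> \<mu>z l n
    using \<nu> assms(8,10) loss_measurable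
    by (simp add: pac_bayes_def subgaussian_risk_def subgaussian_risk_axioms_def)
  have ent: "PB.ent_le (\<rho> S T) (3 / 2 * enn2real (entropy_bound \<eta> lam a b (Nsz S) (Msz S) T))"
    and meas: "Y S T \<in> M \<rightarrow>\<^sub>M borel" and prob: "prob_space (\<rho> S T)"
    if S: "S \<in> space (sample_space n \<mu>z)" and T: "0 < T"
      and fin: "entropy_bound \<eta> lam a b (Nsz S) (Msz S) T < \<infinity>" for S T
  proof -
    \<comment> \<open>The log-density of \<open>\<rho> S t\<close> with respect to the Gaussian. Its
      gradient is the score plus \<open>x / \<sigma>\<^sup>2\<close>, exactly the quantity whose
      growth is assumed.\<close>
    define h where "h t x = ln (u S t x) - ln (PB.dens x)" for t x
    have chain: "sgd_chain M \<nu> \<mu>U (X0 S) U N (g S)"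
      using randomness[OF S] gradient_measurable[OF S] assms(9)
      by (simp add: sgd_chain_def \<mu>0_def)
    interpret L: langevin_score \<sigma> \<nu> M \<mu>U "X0 S" U N \<eta> lam "g S" a b h
    proof (intro langevin_score.intro langevin.intro \<nu> chain langevin_axioms.intro langevin_score_axioms.intro params)
      fix t :: real assume t: "0 < t"
      have [measurable]: "u S t \<in> borel_measurable borel" and u_pos: "\<And>x. 0 < u S t x"
        and u_law: "\<rho> S t = density lborel (\<lambda>x. ennreal (u S t x))"
        using lebesgue_density[OF S, of t] t by auto
      show [measurable]: "h t \<in> borel_measurable borel" unfolding h_def by measurable
      have "density \<nu> (\<lambda>x. ennreal (exp (h t x))) = density lborel (\<lambda>x. ennreal (PB.dens x) * ennreal (exp (h t x)))"
        unfolding PB.G_density by (rule density_density_eq) measurable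
      also have "\<dots> = density lborel (\<lambda>x. ennreal (u S t x))"
      proof (rule arg_cong[where f = "density lborel"], rule ext)
        fix x
        have "exp (h t x) = u S t x / PB.dens x"
          using u_pos[of x] PB.dens_pos[of x] by (simp add: h_def exp_diff)
        then show "ennreal (PB.dens x) * ennreal (exp (h t x)) = ennreal (u S t x)"
          using PB.dens_pos[of x] u_pos[of x] by (subst ennreal_mult'[symmetric]) auto
      qed
      finally show "distr M borel (poissonized (sgd_iterate \<eta> lam (g S) (X0 S) U) N t) = density \<nu> (\<lambda>x. ennreal (exp (h t x)))"
        using u_law by (simp add: \<rho>_def Y_def X_def)
      fix x y
      show "\<bar>h t x - h t y\<bar> \<le> norm (x - y) * (a * ((norm x + norm y) / 2) + b)"
      proof (rule gradient_growth_diff)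
        fix x
        obtain D where D: "GDERIV (\<lambda>y. ln (u S t y)) x :> D" "norm (D + x /\<^sub>R \<sigma>\<^sup>2) \<le> a * norm x + b"
          using score_growth[OF S, of t x] t by auto
        let ?c = "ln ((1 / sqrt (2 * pi * \<sigma>\<^sup>2)) ^ DIM('a))"
        have "h t = (\<lambda>x. ln (u S t x) + ((x \<bullet> x) / (2 * \<sigma>\<^sup>2) - ?c))"
          using params(4)
          by (intro ext) (simp add: h_def PB.dens_def ln_mult power2_norm_eq_inner)
        also have "\<dots> = (\<lambda>x. ln (u S t x) + (inverse (2 * \<sigma>\<^sup>2) * (x \<bullet> x) - ?c))"
          by (simp only: divide_inverse mult.commute)
        finally have "h t = (\<lambda>x. ln (u S t x) + (inverse (2 * \<sigma>\<^sup>2) * (x \<bullet> x) - ?c))" .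
        moreover have "GDERIV (\<lambda>x. inverse (2 * \<sigma>\<^sup>2) * (x \<bullet> x) - ?c) x :> x /\<^sub>R \<sigma>\<^sup>2"
        proof -
          have "((\<lambda>x. inverse (2 * \<sigma>\<^sup>2) * (x \<bullet> x) - ?c) has_derivative
              (\<lambda>v. inverse (2 * \<sigma>\<^sup>2) * (x \<bullet> v + v \<bullet> x) - 0)) (at x)"
            by (intro derivative_intros)
          moreover have "(\<lambda>v. inverse (2 * \<sigma>\<^sup>2) * (x \<bullet> v + v \<bullet> x) - 0) = (\<lambda>v. v \<bullet> (x /\<^sub>R \<sigma>\<^sup>2))"
            by (intro ext) (simp add: inner_commute[of x])
          ultimately show ?thesis unfolding gderiv_def by (simp only:)
        qed
        ultimately have "GDERIV (h t) x :> D + x /\<^sub>R \<sigma>\<^sup>2"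
          using GDERIV_add[OF D(1)] by simp
        then show "\<exists>D. GDERIV (h t) x :> D \<and> norm D \<le> a * norm x + b" using D(2) by blast
      qed (use params in auto)
    qed
    have eqs: "Y S = poissonized (sgd_iterate \<eta> lam (g S) (X0 S) U) N" by (simp add: Y_def X_def)
    show "Y S T \<in> M \<rightarrow>\<^sub>M borel" "prob_space (\<rho> S T)"
      unfolding \<rho>_def eqs using T by (auto intro: L.Y_measurable L.prob_\<rho>)
    show "PB.ent_le (\<rho> S T) (3 / 2 * enn2real (entropy_bound \<eta> lam a b (Nsz S) (Msz S) T))"
      using L.entropy_le_bound[OF T] fin by (simp add: \<rho>_def eqs Nsz_def Msz_def)
  qed
  \<comment> \<open>The event is fixed before \<open>T\<close> appears. Uniformity in time is free
    because the bound covers all measures with an entropy estimate, in particular every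
    \<open>\<rho> S T\<close>.\<close>
  from PB.pac_bayes_bound[OF subgaussian params(5) params(8,9)]
  obtain A where A: "A \<in> sets (sample_space n \<mu>z)" "1 - \<zeta> \<le> measure (sample_space n \<mu>z) A"
    and bound: "\<forall>S\<in>A. \<forall>\<mu> k. prob_space \<mu> \<longrightarrow> sets \<mu> = sets borel \<longrightarrow> PB.ent_le \<mu> k \<longrightarrow>
      integrable \<mu> (gen_gap l \<mu>z n S) \<and>
      (\<integral>w. gen_gap l \<mu>z n S w \<partial>\<mu>) \<le> 2 * Sig / sqrt (real n) * sqrt (2 / 3 * k + ln (3 / \<zeta>))"
    by (elim bexE conjE) (rule that)
  have "integrable M (\<lambda>\<omega>. gen_gap l \<mu>z n S (Y S T \<omega>)) \<and>
       (\<integral>\<omega>. gen_gap l \<mu>z n S (Y S T \<omega>) \<partial>M)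
         \<le> 2 * Sig / sqrt (real n)
            * sqrt (enn2real (entropy_bound \<eta> lam a b (Nsz S) (Msz S) T) + ln (3 / \<zeta>))"
    if S: "S \<in> A" and T: "0 < T" and fin: "entropy_bound \<eta> lam a b (Nsz S) (Msz S) T < \<infinity>" for S T
  proof -
    have S': "S \<in> space (sample_space n \<mu>z)" using S A sets.sets_into_space by blast
    note Y = meas[OF S' T fin]
    have gap: "gen_gap l \<mu>z n S \<in> borel_measurable borel" by (rule PB.gap_measurable_w[OF S'])
    \<comment> \<open>With \<open>k\<close> equal to 3/2 times the entropy bound, the factors 2/3
      and 3/2 cancel.\<close>
    have "integrable (\<rho> S T) (gen_gap l \<mu>z n S)"
      "(\<integral>w. gen_gap l \<mu>z n S w \<partial>\<rho> S T) \<le> 2 * Sig / sqrt (real n)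
        * sqrt (2 / 3 * (3 / 2 * enn2real (entropy_bound \<eta> lam a b (Nsz S) (Msz S) T)) + ln (3 / \<zeta>))"
      using bound[rule_format, OF S prob[OF S' T fin] _ ent[OF S' T fin]] by (simp_all add: \<rho>_def)
    then show ?thesis
      unfolding \<rho>_def using integrable_distr_eq[OF Y gap] integral_distr[OF Y gap] by simp
  qed
  then show ?thesis using A by blast
qed

end
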